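(* Let $F$ be a planar graph and let $n$ be an integer with $n\geq \max\{2.16\times 10^{17},\, 2|V(F)|\}$. Suppose that $F$ is (isomorphic to) a subgraph of $2K_1+P_{\lfloor n/2\rfloor}$ but not of $K_{2,n-2}$. Then every extremal graph to $\mathrm{spex}_{\mathcal{P}}(n,F)$, i.e. every $n$-vertex $F$-free planar graph of maximum spectral radius, contains a copy of $K_{2,n-2}$ as a subgraph.
   Context: All graphs are finite and simple. $\rho(G)$ denotes the spectral radius of the adjacency matrix of $G$. A graph is $F$-free if it does not contain $F$ as a (not necessarily induced) subgraph. $\mathrm{spex}_{\mathcal{P}}(n,F)$ is the maximum of $\rho(G)$ over all $n$-vertex $F$-free planar graphs $G$; an extremal graph to $\mathrm{spex}_{\mathcal{P}}(n,F)$ is an $n$-vertex $F$-free planar graph attaining this maximum. $G+H$ denotes the join of $G$ and $H$ (the disjoint union together with all edges between $V(G)$ and $V(H)$), $tK_1$ is the graph of $t$ isolated vertices, and $P_m$ is the path on $m$ vertices. *)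

theory Defs
  imports
    "HOL-Analysis.Path_Connected"
    "Graph_Theory.Pair_Digraph"
    "Jordan_Normal_Form.Spectral_Radius"
begin

text \<open>
  A finite simple graph is a graph \<open>G\<close> with \<open>pair_graph G\<close>, i.e. a finite, loopfree, symmetric
  digraph without parallel arcs: an edge \<open>uv\<close> is the pair of arcs \<open>(u, v)\<close>, \<open>(v, u)\<close>.
\<close>

definition isolated_graph :: "nat \<Rightarrow> nat pair_pre_digraph" where
  "isolated_graph t = \<lparr>pverts = {..<t}, parcs = {}\<rparr>"

definition path_graph :: "nat \<Rightarrow> nat pair_pre_digraph" where
  "path_graph m = \<lparr>pverts = {..<m},
     parcs = {(i, j). i < m \<and> j < m \<and> (j = Suc i \<or> i = Suc j)}\<rparr>"

definition complete_bipartite_graph :: "nat \<Rightarrow> nat \<Rightarrow> (nat + nat) pair_pre_digraph" where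
  "complete_bipartite_graph s t = \<lparr>pverts = {..<s} <+> {..<t},
     parcs = Inl ` {..<s} \<times> Inr ` {..<t} \<union> Inr ` {..<t} \<times> Inl ` {..<s}\<rparr>"

definition graph_join ::
    "'a pair_pre_digraph \<Rightarrow> 'b pair_pre_digraph \<Rightarrow> ('a + 'b) pair_pre_digraph" where
  "graph_join G H = \<lparr>pverts = pverts G <+> pverts H,
     parcs = map_prod Inl Inl ` parcs G \<union> map_prod Inr Inr ` parcs H
       \<union> Inl ` pverts G \<times> Inr ` pverts H \<union> Inr ` pverts H \<times> Inl ` pverts G\<rparr>"

text \<open>\<open>contains_copy G F\<close>: some not necessarily induced subgraph of \<open>G\<close> is isomorphic to \<open>F\<close>.\<close>

definition contains_copy :: "'a pair_pre_digraph \<Rightarrow> 'b pair_pre_digraph \<Rightarrow> bool" where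
  "contains_copy G F \<longleftrightarrow> (\<exists>\<phi>. inj_on \<phi> (pverts F) \<and> \<phi> ` pverts F \<subseteq> pverts G \<and>
     (\<forall>(u, v)\<in>parcs F. (\<phi> u, \<phi> v) \<in> parcs G))"

text \<open>
  A drawing places the vertices at distinct points of the plane and draws every edge as an arc
  (a homeomorphic image of \<open>[0, 1]\<close>) between its two ends, such that an arc meets the set of
  vertices only in its ends and two distinct arcs meet only in vertices. The curves are indexed by
  the sets \<open>{u, v}\<close>, so both directions of an edge share one arc.
\<close>

definition plane_drawing ::
    "'a pair_pre_digraph \<Rightarrow> ('a \<Rightarrow> complex) \<Rightarrow> ('a set \<Rightarrow> real \<Rightarrow> complex) \<Rightarrow> bool" where
  "plane_drawing G p \<gamma> \<longleftrightarrow>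
     inj_on p (pverts G) \<and>
     (\<forall>(u, v)\<in>parcs G.
        arc (\<gamma> {u, v}) \<and>
        {pathstart (\<gamma> {u, v}), pathfinish (\<gamma> {u, v})} = {p u, p v} \<and>
        path_image (\<gamma> {u, v}) \<inter> p ` pverts G = {p u, p v}) \<and>
     (\<forall>(u, v)\<in>parcs G. \<forall>(x, y)\<in>parcs G. {u, v} \<noteq> {x, y} \<longrightarrow>
        path_image (\<gamma> {u, v}) \<inter> path_image (\<gamma> {x, y}) \<subseteq> p ` pverts G)"

definition planar :: "'a pair_pre_digraph \<Rightarrow> bool" where
  "planar G \<longleftrightarrow> (\<exists>p \<gamma>. plane_drawing G p \<gamma>)"

definition adj_mat :: "'a pair_pre_digraph \<Rightarrow> 'a list \<Rightarrow> complex mat" where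
  "adj_mat G xs = Matrix.mat (length xs) (length xs)
     (\<lambda>(i, j). if (xs ! i, xs ! j) \<in> parcs G then 1 else 0)"

text \<open>
  The adjacency matrix is taken with respect to some enumeration of the vertices; the choice does
  not matter, see \<open>graph_spectral_radius_eq\<close> below.
\<close>

definition graph_spectral_radius :: "'a pair_pre_digraph \<Rightarrow> real" where
  "graph_spectral_radius G =
     spectral_radius (adj_mat G (SOME xs. distinct xs \<and> set xs = pverts G))"

text \<open>
  Every \<open>n\<close>-vertex graph is isomorphic to one on \<open>{..<n}\<close>, so the maximum is taken over the
  finitely many labelled graphs on this set. The value is meaningful only if one of them is
  planar and \<open>F\<close>-free.
\<close>

definition spex_planar :: "nat \<Rightarrow> 'a pair_pre_digraph \<Rightarrow> real" where
  "spex_planar n F = Max {graph_spectral_radius H | H :: nat pair_pre_digraph.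
     pair_graph H \<and> pverts H = {..<n} \<and> planar H \<and> \<not> contains_copy H F}"

definition extremal_spex_planar ::
    "nat \<Rightarrow> 'a pair_pre_digraph \<Rightarrow> 'b pair_pre_digraph \<Rightarrow> bool" where
  "extremal_spex_planar n F G \<longleftrightarrow>
     pair_graph G \<and> card (pverts G) = n \<and> planar G \<and> \<not> contains_copy G F \<and>
     graph_spectral_radius G = spex_planar n F"

lemma eigenvalue_adj_mat:
  assumes "distinct xs"
  shows "eigenvalue (adj_mat G xs) k \<longleftrightarrow> (\<exists>f. (\<exists>v\<in>set xs. f v \<noteq> 0) \<and>
     (\<forall>v\<in>set xs. (\<Sum>u\<in>set xs. if (v, u) \<in> parcs G then f u else 0) = k * f v))"
    (is "?L \<longleftrightarrow> ?R")
proof -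
  let ?n = "length xs"
  have mult: "vec_index (adj_mat G xs *\<^sub>v w) i = k * (vec_index w i) \<longleftrightarrow>
      (\<Sum>u\<in>set xs. if (xs ! i, u) \<in> parcs G then f u else 0) = k * f (xs ! i)"
    if "w \<in> carrier_vec ?n" "i < ?n" "\<And>j. j < ?n \<Longrightarrow> f (xs ! j) = vec_index w j" for w f i
  proof -
    have "vec_index (adj_mat G xs *\<^sub>v w) i =
        (\<Sum>j<?n. if (xs ! i, xs ! j) \<in> parcs G then f (xs ! j) else 0)"
      using that by (auto simp: adj_mat_def scalar_prod_def atLeast0LessThan intro!: sum.cong)
    also have "\<dots> = (\<Sum>u\<in>set xs. if (xs ! i, u) \<in> parcs G then f u else 0)"
      by (rule sum.reindex_bij_betw[OF bij_betw_nth[OF assms refl refl]])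
    finally show ?thesis by (simp only: that(3)[OF that(2)])
  qed
  show ?thesis
  proof
    assume ?L
    then obtain w where w: "w \<in> carrier_vec ?n" "w \<noteq> 0\<^sub>v ?n" "adj_mat G xs *\<^sub>v w = k \<cdot>\<^sub>v w"
      by (auto simp: eigenvalue_def eigenvector_def adj_mat_def)
    define f where "f v = vec_index w (THE j. j < ?n \<and> xs ! j = v)" for v
    have f: "f (xs ! j) = vec_index w j" if "j < ?n" for j
    proof -
      have "(THE j'. j' < ?n \<and> xs ! j' = xs ! j) = j"
        using that assms by (intro the_equality) (auto simp: nth_eq_iff_index_eq)
      then show ?thesis by (simp add: f_def)
    qed
    have "\<exists>j<?n. vec_index w j \<noteq> 0"
      proof (rule ccontr)
      assume "\<not> ?thesis"
      then have "w = 0\<^sub>v ?n" using w(1) by (intro eq_vecI) auto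
      with w(2) show False ..
    qed
    then obtain j where "j < ?n" "vec_index w j \<noteq> 0" by blast
    then have "\<exists>v\<in>set xs. f v \<noteq> 0" using f by (intro bexI[of _ "xs ! j"]) simp_all
    moreover have "(\<Sum>u\<in>set xs. if (v, u) \<in> parcs G then f u else 0) = k * f v"
      if "v \<in> set xs" for v
    proof -
      obtain i where i: "i < ?n" "xs ! i = v"
        using \<open>v \<in> set xs\<close> by (auto simp: in_set_conv_nth)
      have "vec_index (adj_mat G xs *\<^sub>v w) i = k * vec_index w i"
        unfolding w(3) using w(1) i(1) by simp
      then show ?thesis unfolding i(2)[symmetric] using mult[OF w(1) i(1), of f] f by blast
    qed
    ultimately show ?R by blast
  next
    assume ?R
    then obtain f where f: "\<exists>v\<in>set xs. f v \<noteq> 0"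
      "\<And>v. v \<in> set xs \<Longrightarrow> (\<Sum>u\<in>set xs. if (v, u) \<in> parcs G then f u else 0) = k * f v"
      by blast
    define w where "w = Matrix.vec ?n (\<lambda>j. f (xs ! j))"
    have w: "w \<in> carrier_vec ?n" "\<And>j. j < ?n \<Longrightarrow> f (xs ! j) = vec_index w j"
      by (auto simp: w_def)
    have "w \<noteq> 0\<^sub>v ?n" proof
      assume "w = 0\<^sub>v ?n"
      then have "f v = 0" if "v \<in> set xs" for v
        proof -
        obtain j where j: "j < ?n" "xs ! j = v"
          using \<open>v \<in> set xs\<close> by (auto simp: in_set_conv_nth)
        show ?thesis using w(2)[OF j(1)] unfolding j(2) \<open>w = 0\<^sub>v ?n\<close> by (simp add: j(1))
      qed
      with f(1) show False by blast
    qed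
    moreover have "adj_mat G xs *\<^sub>v w = k \<cdot>\<^sub>v w"
    proof (rule eq_vecI)
      show "dim_vec (adj_mat G xs *\<^sub>v w) = dim_vec (k \<cdot>\<^sub>v w)"
        by (simp add: adj_mat_def w_def)
      fix i assume "i < dim_vec (k \<cdot>\<^sub>v w)"
      then have i: "i < ?n" by (simp add: w_def)
      have "vec_index (adj_mat G xs *\<^sub>v w) i = k * vec_index w i"
        using mult[OF w(1) i, of f] w(2) f(2)[OF nth_mem[OF i]] by blast
      also have "\<dots> = vec_index (k \<cdot>\<^sub>v w) i"
        using i w(1) by simp
      finally show "vec_index (adj_mat G xs *\<^sub>v w) i = vec_index (k \<cdot>\<^sub>v w) i" .
    qed
    ultimately show ?L using w(1) by (auto simp: eigenvalue_def eigenvector_def adj_mat_def)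
  qed
qed

lemma graph_spectral_radius_eq:
  assumes "distinct xs" "set xs = pverts G"
  shows "graph_spectral_radius G = spectral_radius (adj_mat G xs)"
proof -
  define ys where "ys = (SOME ys. distinct ys \<and> set ys = pverts G)"
  have ys: "distinct ys \<and> set ys = pverts G"
    unfolding ys_def by (rule someI[where x = xs]) (simp add: assms)
  have "spectrum (adj_mat G ys) = spectrum (adj_mat G xs)"
    unfolding spectrum_def using assms ys by (intro Collect_cong) (simp add: eigenvalue_adj_mat)
  then show ?thesis by (simp add: graph_spectral_radius_def spectral_radius_def flip: ys_def)
qed

end

theory Submission
  imports Defs "HOL-Analysis.Jordan_Curve" "HOL-Analysis.Function_Topology"
begin

text \<open>
  A planar graph has no \<open>K\<^sub>3\<^sub>,\<^sub>3\<close> minor (a chord of a closed curve separates the two arcs between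
  its ends, by Janiszewski's theorem), so by Mader's argument every vertex set \<open>W\<close> spans fewer
  than \<open>8 |W|\<close> edges. Let \<open>x\<close> be the Perron vector of an extremal graph \<open>G\<close>, with maximum \<open>1\<close>. As
  \<open>K\<^sub>2\<^sub>,\<^sub>n\<^sub>-\<^sub>2\<close> is planar and \<open>F\<close>-free, the spectral radius satisfies \<open>\<rho>\<^sup>2 \<ge> 2 n - 4\<close>. Counting walks of
  length two, and using that all but few vertices have at most two neighbours among the boundedly many
  vertices with \<open>x \<ge> 1/150\<close>, yields two vertices \<open>a\<close>, \<open>b\<close> with \<open>x\<close> close to \<open>1\<close> whose common
  neighbourhood \<open>A\<close> has at least \<open>0.97 n\<close> vertices, while \<open>x\<close> is small elsewhere.

  Since \<open>G\<close> contains no \<open>2 K\<^sub>1 + P\<close> with a path \<open>P\<close> on \<open>n div 2\<close> vertices, and no subdivision of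
  \<open>K\<^sub>5\<close>, the set \<open>A\<close> induces a linear forest. Let \<open>R\<close> be the set of the remaining vertices. Joining each
  of them to \<open>a\<close> and \<open>b\<close> only gives a subgraph of \<open>K\<^sub>2 + P\<^sub>n\<^sub>-\<^sub>2\<close>, which is planar by an explicit
  drawing and still \<open>F\<close>-free. If \<open>R\<close> were nonempty, this would increase the spectral radius.
\<close>

section \<open>Crossing arcs in the plane\<close>

text \<open>Planarity alone does not force a linear forest on \<open>A\<close>: a bipyramid is
  planar and has a cycle through all common neighbours of its two apexes. A spanning cycle contains
  a spanning path and is excluded by \<open>F\<close>; any shorter cycle leaves a vertex of
  \<open>A\<close> over, and that vertex supplies the missing link of a subdivided K_5. The
  comparison graph is tested with the old vector \<open>x\<close>. Connectedness of \<open>G\<close>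
  is not established, so \<open>x\<close> may vanish on all of \<open>R\<close> and the comparison
  need not be strict. Equality, however, makes \<open>x\<close> an eigenvector of the new graph as
  well, which fails at any single vertex of \<open>R\<close>. Mader's argument gives 16 arcs per
  vertex, far above the sharp bound for planar graphs, and this sets the scale of all constants. The
  size of \<open>n\<close> is spent twice: a term 38400 sqrt n must stay below n / 12000, and the
  exceptional vertices, whose number is cubic in the bound 48000 for the vertices with
  \<open>x\<close> at least 1/150, must contribute at most 0.0028 n.\<close>

lemma arc_image_minus_pathstart:
  fixes g :: "real \<Rightarrow> 'a::real_normed_vector"
  assumes "arc g"
  shows "connected (path_image g - {pathstart g})" "pathfinish g \<in> path_image g - {pathstart g}"
    "pathstart g \<in> closure (path_image g - {pathstart g})"
proof -
  have inj: "inj_on g {0..1}" and cont: "continuous_on {0..1} g"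
    using assms by (auto simp: arc_def path_def)
  have eq: "path_image g - {pathstart g} = g ` {0<..1}"
  proof
    show "path_image g - {pathstart g} \<subseteq> g ` {0<..1}"
      by (auto simp: path_image_def pathstart_def less_le)
    show "g ` {0<..1} \<subseteq> path_image g - {pathstart g}"
    proof clarify
      fix t :: real assume t: "t \<in> {0<..1}"
      then have "g t \<noteq> g 0" using inj_onD[OF inj, of t 0] by auto
      then show "g t \<in> path_image g - {pathstart g}" using t by (auto simp: path_image_def pathstart_def)
    qed
  qed
  show "connected (path_image g - {pathstart g})"
    unfolding eq by (intro connected_continuous_image continuous_on_subset[OF cont]) auto
  show "pathfinish g \<in> path_image g - {pathstart g}"
    unfolding eq by (auto simp: pathfinish_def)
  have "g ` closure {0<..1} \<subseteq> closure (g ` {0<..1})"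
    by (rule image_closure_subset) (auto simp: closure_subset intro: continuous_on_subset[OF cont])
  then show "pathstart g \<in> closure (path_image g - {pathstart g})"
    unfolding eq by (auto simp: pathstart_def)
qed

lemma arc_image_minus_pathfinish:
  fixes g :: "real \<Rightarrow> 'a::real_normed_vector"
  assumes "arc g"
  shows "connected (path_image g - {pathfinish g})" "pathstart g \<in> path_image g - {pathfinish g}"
    "pathfinish g \<in> closure (path_image g - {pathfinish g})"
  using arc_image_minus_pathstart[OF arc_reversepath[OF assms]] by auto

lemma arc_image_endless:
  fixes g :: "real \<Rightarrow> 'a::real_normed_vector"
  assumes "arc g"
  shows "connected (path_image g - {pathstart g, pathfinish g})"
    "path_image g - {pathstart g, pathfinish g} \<noteq> {}"
  using assms arc_imp_simple_path connected_simple_path_endless nonempty_simple_path_endless by blast+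

text \<open>Janiszewski's theorem applied to \<open>C \<union> g1\<close> and \<open>C \<union> g2\<close>: neither of them separates \<open>S\<close> from
  the side of the closed curve that avoids \<open>C\<close> and \<open>S\<close>, so neither does their union.\<close>

lemma chord_separates:
  fixes g1 g2 :: "real \<Rightarrow> complex"
  assumes g: "arc g1" "arc g2" "pathstart g1 = a" "pathfinish g1 = b" "pathstart g2 = a"
      "pathfinish g2 = b" "path_image g1 \<inter> path_image g2 = {a, b}"
    and J: "J = path_image g1 \<union> path_image g2"
    and C: "compact C" "connected C" "C \<inter> J = {a, b}"
    and S: "connected S" "S \<noteq> {}" "S \<inter> C = {}"
    and p: "p \<in> closure S" "p \<in> path_image g1 - {a, b}"
    and q: "q \<in> closure S" "q \<in> path_image g2 - {a, b}"
    and same: "S \<union> (C - {a, b}) \<subseteq> inside J \<or> S \<union> (C - {a, b}) \<subseteq> outside J"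
  shows False
proof -
  have simple: "simple_path (g1 +++ reversepath g2)"
    by (rule simple_path_join_loop) (use g in \<open>auto simp: arc_reversepath\<close>)
  have J': "path_image (g1 +++ reversepath g2) = J"
    using g by (simp add: J path_image_join)
  note jordan = Jordan_inside_outside[OF simple, unfolded J'] 
  \<comment> \<open>\<open>D\<close> is the side that holds \<open>S\<close> and the interior of the
    chord, \<open>E\<close> the opposite one. Naming them treats inside and outside alike.\<close>
  obtain D E where DE: "D \<inter> E = {}" "D \<union> E = - J" "S \<union> (C - {a, b}) \<subseteq> D" "open D" "open E"
      "connected D" "connected E" "E \<noteq> {}" "frontier E = J"
  proof (cases "S \<union> (C - {a, b}) \<subseteq> inside J")
    case True
    then show ?thesis using that[of "inside J" "outside J"] jordan g by simp
  next
    case False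
    then have "S \<union> (C - {a, b}) \<subseteq> outside J" using same by blast
    then show ?thesis using that[of "outside J" "inside J"] jordan g by (simp add: Int_commute Un_commute)
  qed
  have a_b_J: "a \<in> J" "b \<in> J" using C(3) by auto
  obtain x where x: "x \<in> S" using S by blast
  obtain y where y: "y \<in> E" using DE by blast
  \<comment> \<open>A point \<open>q\<close> of \<open>J\<close> in the closure of \<open>S\<close>
    is also in the closure of \<open>E\<close>, so a small ball around it bridges \<open>S\<close>
    and \<open>E\<close>. The ball avoids \<open>C\<close> and \<open>g\<close> if \<open>q\<close>
    does: with \<open>g1\<close> removed the bridge is at the point on \<open>g2\<close>, and
    conversely.\<close>
  have joined: "connected_component (- (C \<union> path_image g)) x y"
    if q: "q \<in> closure S" "q \<in> J" "q \<notin> C" "q \<notin> path_image g" and g': "path g" "path_image g \<subseteq> J" for q g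
  proof -
    have "closed (C \<union> path_image g)"
      using C g' by (auto intro: compact_imp_closed)
    then have "open (- (C \<union> path_image g))" by (rule open_Compl)
    moreover have "q \<in> - (C \<union> path_image g)" using q by simp
    ultimately obtain e where e: "e > 0" "ball q e \<subseteq> - (C \<union> path_image g)"
      by (rule openE)
    have "ball q e \<inter> S \<noteq> {}"
      using open_Int_closure_eq_empty[OF open_ball, of q e S] e(1) q(1) centre_in_ball by blast
    moreover have "q \<in> closure E" using DE(9) q(2) by (auto simp: frontier_def)
    then have "ball q e \<inter> E \<noteq> {}"
      using open_Int_closure_eq_empty[OF open_ball, of q e E] e(1) centre_in_ball by blast
    ultimately have "connected (S \<union> ball q e \<union> E)"
      using S(1) DE(7) by (intro connected_Un) auto
    moreover have "S \<union> ball q e \<union> E \<subseteq> - (C \<union> path_image g)"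
    proof -
      have "E \<inter> J = {}" "S \<inter> J = {}" "C \<inter> E = {}" using DE(1-3) C(3) a_b_J by auto
      then show ?thesis using e(2) S(3) g'(2) by auto
    qed
    ultimately show ?thesis
      using x y unfolding connected_component_def by blast
  qed
  have 1: "connected_component (- (C \<union> path_image g1)) x y"
    using q g C(3) J by (intro joined[of q]) (auto intro: arc_imp_path)
  have 2: "connected_component (- (C \<union> path_image g2)) x y"
    using p g C(3) J by (intro joined[of p]) (auto intro: arc_imp_path)
  have "compact (C \<union> path_image g1)" "closed (C \<union> path_image g2)"
    using C(1) g(1,2) by (simp_all add: compact_Un closed_Un compact_imp_closed compact_path_image arc_imp_path)
  \<comment> \<open>Janiszewski's theorem asks for a connected intersection. The two arcs meet only
    in the ends of \<open>C\<close>, so it is \<open>C\<close> itself.\<close>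
  moreover have "connected ((C \<union> path_image g1) \<inter> (C \<union> path_image g2))"
  proof -
    have "(C \<union> path_image g1) \<inter> (C \<union> path_image g2) = C"
      using g(7) C(3) by auto
    then show ?thesis using C(2) by simp
  qed
  ultimately have "connected_component (- ((C \<union> path_image g1) \<union> (C \<union> path_image g2))) x y"
    using 1 2 by (rule Janiszewski)
  then obtain T where T: "connected T" "T \<subseteq> - J" "x \<in> T" "y \<in> T"
    using J by (auto simp: connected_component_def)
  have "D \<inter> T = {} \<or> E \<inter> T = {}"
    using connectedD[OF T(1) DE(4,5)] T(2) DE(1,2) by blast
  then show False using T x y DE by blast
qed

lemma connected_Un_at: "connected S \<Longrightarrow> connected T \<Longrightarrow> x \<in> S \<Longrightarrow> x \<in> T \<Longrightarrow> connected (S \<union> T)"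
  by (rule connected_Un) auto

lemma connected_side:
  assumes "simple_path (g :: real \<Rightarrow> complex)" "pathfinish g = pathstart g"
    and "connected S" "S \<inter> path_image g = {}"
  shows "S \<subseteq> inside (path_image g) \<or> S \<subseteq> outside (path_image g)"
proof -
  note jordan = Jordan_inside_outside[OF assms(1,2)]
  have open_io: "open (inside (path_image g))" "open (outside (path_image g))"
    and disj: "inside (path_image g) \<inter> outside (path_image g) = {}"
    and un: "inside (path_image g) \<union> outside (path_image g) = - path_image g"
    using jordan by simp_all
  have "S \<subseteq> - path_image g" using assms(4) by auto
  then have S: "S \<subseteq> inside (path_image g) \<union> outside (path_image g)"
    using un by simp
  have "inside (path_image g) \<inter> S = {} \<or> outside (path_image g) \<inter> S = {}"
    using connectedD[OF assms(3) open_io _ S] disj by auto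
  then show ?thesis using S by blast
qed

text \<open>The four-cycle through \<open>a 0\<close>, \<open>b 0\<close>, \<open>a 1\<close>,
  \<open>b 1\<close> is a Jordan curve \<open>J\<close>. The rest of the drawing hangs together
  through \<open>b 2\<close> and \<open>a 2\<close>, hence lies on one side of \<open>J\<close>. On
  that side the path from \<open>a 0\<close> over \<open>b 2\<close> to \<open>a 1\<close> is a
  chord separating \<open>b 0\<close> from \<open>b 1\<close>, which the legs from
  \<open>a 2\<close> connect.\<close>

lemma K33_arcs_impossible:
  fixes h :: "nat \<Rightarrow> nat \<Rightarrow> real \<Rightarrow> complex"
  assumes h: "\<And>i j. i < 3 \<Longrightarrow> j < 3 \<Longrightarrow> arc (h i j) \<and> pathstart (h i j) = a i \<and> pathfinish (h i j) = b j"
    and disj: "\<And>i j k l. i < 3 \<Longrightarrow> j < 3 \<Longrightarrow> k < 3 \<Longrightarrow> l < 3 \<Longrightarrow> (i, j) \<noteq> (k, l) \<Longrightarrow>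
      path_image (h i j) \<inter> path_image (h k l) \<subseteq> (if i = k then {a i} else {}) \<union> (if j = l then {b j} else {})"
  shows False
proof -
  define I where "I i j = path_image (h i j)" for i j
  have ends: "a i \<in> I i j" "b j \<in> I i j" "a i \<noteq> b j" if "i < 3" "j < 3" for i j
    using h[OF that] arc_distinct_ends[of "h i j"] pathstart_in_path_image[of "h i j"]
      pathfinish_in_path_image[of "h i j"] by (auto simp: I_def)
  have ab: "a i \<noteq> a k" if "i < 3" "k < 3" "i \<noteq> k" for i k
    using disj[of i 0 k 1] ends[of i 0] ends[of k 1] that by (auto simp: I_def)
  have bb: "b i \<noteq> b k" if "i < 3" "k < 3" "i \<noteq> k" for i k
    using disj[of 0 i 1 k] ends[of 0 i] ends[of 1 k] that by (auto simp: I_def)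
  have Iint: "I i j \<inter> I k l = (if i = k then {a i} else {}) \<union> (if j = l then {b j} else {})"
    if "i < 3" "j < 3" "k < 3" "l < 3" "(i, j) \<noteq> (k, l)" for i j k l
    using disj[OF that] ends[of i j] ends[of k l] that by (auto simp: I_def split: if_splits)
  have aI: "a i \<in> I k l \<longleftrightarrow> i = k" if "i < 3" "k < 3" "l < 3" for i k l
  proof -
    obtain m :: nat where m: "m < 3" "m \<noteq> l" using that[of "if l = 0 then 1 else 0"] by simp
    show ?thesis using Iint[of i m k l] ends[of i m] ends[of k l] m that by (auto split: if_splits)
  qed
  have bI: "b i \<in> I k l \<longleftrightarrow> i = l" if "i < 3" "k < 3" "l < 3" for i k l
  proof -
    obtain m :: nat where m: "m < 3" "m \<noteq> k" using that[of "if k = 0 then 1 else 0"] by simp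
    show ?thesis using Iint[of m i k l] ends[of m i] ends[of k l] m that by (auto split: if_splits)
  qed
  define g where "g j = h 0 j +++ reversepath (h 1 j)" for j
  have g: "arc (g j)" "pathstart (g j) = a 0" "pathfinish (g j) = a 1" "path_image (g j) = I 0 j \<union> I 1 j" if "j < 3" for j
    using h[of 0 j] h[of 1 j] disj[of 0 j 1 j] that
    by (auto simp: g_def I_def arc_join arc_reversepath path_image_join split: if_splits)
  define J where "J = path_image (g 0) \<union> path_image (g 1)"
  have gg: "path_image (g 0) \<inter> path_image (g 1) = {a 0, a 1}"
    using Iint[of 0 0 0 1] Iint[of 0 0 1 1] Iint[of 1 0 0 1] Iint[of 1 0 1 1] g[of 0] g[of 1] ab[of 0 1] by auto
  have J4: "J = I 0 0 \<union> I 1 0 \<union> I 0 1 \<union> I 1 1"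
    using g by (auto simp: J_def)
  have simple: "simple_path (g 0 +++ reversepath (g 1))"
    by (rule simple_path_join_loop) (use g gg in \<open>auto simp: arc_reversepath\<close>)
  have loop: "pathfinish (g 0 +++ reversepath (g 1)) = pathstart (g 0 +++ reversepath (g 1))"
    and J': "path_image (g 0 +++ reversepath (g 1)) = J"
    using g by (auto simp: J_def path_image_join)
  define C where "C = I 0 2 \<union> I 1 2"
  define S where "S = (I 2 0 - {b 0}) \<union> (I 2 1 - {b 1})"
  \<comment> \<open>The arc from \<open>a 2\<close> to \<open>b 2\<close> ends on the chord
    \<open>C\<close> and cannot belong to \<open>S\<close>. It serves only to place \<open>S\<close>
    and the chord on the same side of \<open>J\<close>.\<close>
  define T where "T = (I 0 2 - {a 0}) \<union> (I 1 2 - {a 1}) \<union> I 2 2 \<union> S"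
  have conn: "connected (I i j)" "connected (I i j - {a i})" "connected (I i j - {b j})" if "i < 3" "j < 3" for i j
    using h[OF that] arc_image_minus_pathstart(1)[of "h i j"] arc_image_minus_pathfinish(1)[of "h i j"]
    by (simp_all add: I_def arc_imp_path connected_path_image)
  have CJ: "C \<inter> J = {a 0, a 1}"
    using Iint[of 0 2 0 0] Iint[of 0 2 0 1] Iint[of 0 2 1 0] Iint[of 0 2 1 1]
      Iint[of 1 2 0 0] Iint[of 1 2 0 1] Iint[of 1 2 1 0] Iint[of 1 2 1 1] by (auto simp: C_def J4)
  have SC: "S \<inter> C = {}"
    using Iint[of 2 0 0 2] Iint[of 2 0 1 2] Iint[of 2 1 0 2] Iint[of 2 1 1 2] by (auto simp: C_def S_def)
  have SJ: "S \<inter> J = {}"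
    using Iint[of 2 0 0 0] Iint[of 2 0 0 1] Iint[of 2 0 1 0] Iint[of 2 0 1 1]
      Iint[of 2 1 0 0] Iint[of 2 1 0 1] Iint[of 2 1 1 0] Iint[of 2 1 1 1] by (auto simp: J4 S_def)
  have I22: "I 2 2 \<inter> J = {}"
    using Iint[of 2 2 0 0] Iint[of 2 2 0 1] Iint[of 2 2 1 0] Iint[of 2 2 1 1] by (auto simp: J4)
  have "a 0 \<notin> I 1 2" "a 1 \<notin> I 0 2" using aI[of 0 1 2] aI[of 1 0 2] by auto
  moreover have "I 0 2 \<inter> J \<subseteq> {a 0, a 1}" "I 1 2 \<inter> J \<subseteq> {a 0, a 1}" using CJ by (auto simp: C_def)
  ultimately have "(I 0 2 - {a 0}) \<inter> J = {}" "(I 1 2 - {a 1}) \<inter> J = {}" by auto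
  then have TJ: "T \<inter> J = {}" using SJ I22 by (simp add: T_def Int_Un_distrib2)
  have a2: "a 2 \<in> S" using ends[of 2 0] by (auto simp: S_def)
  have cS: "connected S"
    unfolding S_def using ends[of 2 0] ends[of 2 1] by (intro connected_Un_at[of _ _ "a 2"] conn) auto
  have "connected ((I 0 2 - {a 0}) \<union> (I 1 2 - {a 1}))"
    using ends[of 0 2] ends[of 1 2] by (intro connected_Un_at[of _ _ "b 2"] conn) auto
  then have "connected ((I 0 2 - {a 0}) \<union> (I 1 2 - {a 1}) \<union> I 2 2)"
    by (rule connected_Un_at[of _ _ "b 2"]) (use ends[of 2 2] ends[of 0 2] conn in auto)
  then have cT: "connected T"
    unfolding T_def by (rule connected_Un_at[of _ _ "a 2"]) (use cS a2 ends[of 2 2] in auto)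
  have side: "T \<subseteq> inside J \<or> T \<subseteq> outside J"
    using connected_side[OF simple loop cT] TJ J' by auto
  have clS: "b j \<in> closure (I 2 j - {b j})" if "j < 3" for j
    using arc_image_minus_pathfinish(3)[of "h 2 j"] h[of 2 j] that by (auto simp: I_def)
  show False
  proof (rule chord_separates[OF g(1)[of 0] g(1)[of 1] g(2)[of 0] g(3)[of 0] g(2)[of 1] g(3)[of 1] gg J_def, of C S "b 0" "b 1"])
    show "compact C" using h[of 0 2] h[of 1 2] by (auto simp: C_def I_def intro!: compact_Un compact_path_image arc_imp_path)
    show "connected C" unfolding C_def using ends[of 0 2] ends[of 1 2] by (intro connected_Un_at[of _ _ "b 2"] conn) auto
    show "b 0 \<in> closure S" "b 1 \<in> closure S"
      using clS[of 0] clS[of 1] by (auto simp: S_def)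
    show "b 0 \<in> path_image (g 0) - {a 0, a 1}" "b 1 \<in> path_image (g 1) - {a 0, a 1}"
      using g ends[of 0 0] ends[of 0 1] ends[of 1 0] ends[of 1 1] by auto
    show "S \<noteq> {}" using a2 by auto
    have "S \<union> (C - {a 0, a 1}) \<subseteq> T" unfolding T_def C_def by auto
    then show "S \<union> (C - {a 0, a 1}) \<subseteq> inside J \<or> S \<union> (C - {a 0, a 1}) \<subseteq> outside J"
      using side by blast
  qed (use CJ SC cS in auto)
qed

lemma arc_image_endless_closure:
  fixes g :: "real \<Rightarrow> 'a::real_normed_vector"
  assumes "arc g"
  shows "pathstart g \<in> closure (path_image g - {pathstart g, pathfinish g})"
    "pathfinish g \<in> closure (path_image g - {pathstart g, pathfinish g})"
proof -
  have inj: "inj_on g {0..1}" and cont: "continuous_on {0..1} g"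
    using assms by (auto simp: arc_def path_def)
  have sub: "g ` {0<..<1} \<subseteq> path_image g - {pathstart g, pathfinish g}"
  proof clarify
    fix t :: real assume t: "t \<in> {0<..<1}"
    then have "g t \<noteq> g 0" "g t \<noteq> g 1" using inj_onD[OF inj, of t 0] inj_onD[OF inj, of t 1] by auto
    then show "g t \<in> path_image g - {pathstart g, pathfinish g}"
      using t by (auto simp: path_image_def pathstart_def pathfinish_def)
  qed
  have "g ` closure {0<..<1} \<subseteq> closure (g ` {0<..<1})"
    by (rule image_closure_subset) (auto simp: closure_subset intro: continuous_on_subset[OF cont])
  also have "\<dots> \<subseteq> closure (path_image g - {pathstart g, pathfinish g})"
    by (rule closure_mono[OF sub])
  finally show "pathstart g \<in> closure (path_image g - {pathstart g, pathfinish g})"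
    "pathfinish g \<in> closure (path_image g - {pathstart g, pathfinish g})"
    by (auto simp: pathstart_def pathfinish_def)
qed

section \<open>From points to connected sets as the vertices of K_{3,3}\<close>

lemma arc_split:
  fixes g :: "real \<Rightarrow> 'a::real_normed_vector"
  assumes "arc g" "m \<in> path_image g" "m \<noteq> pathstart g" "m \<noteq> pathfinish g"
  obtains g0 g1 where "arc g0" "arc g1" "pathstart g0 = m" "pathstart g1 = m"
    "pathfinish g0 = pathstart g" "pathfinish g1 = pathfinish g"
    "path_image g0 \<union> path_image g1 = path_image g" "path_image g0 \<inter> path_image g1 = {m}"
proof -
  obtain t where t: "t \<in> {0..1}" "m = g t" using assms(2) by (auto simp: path_image_def)
  have t01: "t \<noteq> 0" "t \<noteq> 1" using assms(3,4) t by (auto simp: pathstart_def pathfinish_def)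
  have inj: "inj_on g {0..1}" using assms(1) by (auto simp: arc_def)
  have im: "path_image (subpath t 0 g) = g ` {0..t}" "path_image (subpath t 1 g) = g ` {t..1}"
    using t by (auto simp: path_image_subpath)
  have "g ` {0..t} \<inter> g ` {t..1} = g ` ({0..t} \<inter> {t..1})"
    using t by (intro inj_on_image_Int[OF inj, symmetric]) auto
  also have "{0..t} \<inter> {t..1} = {t}" using t by auto
  finally have 1: "path_image (subpath t 0 g) \<inter> path_image (subpath t 1 g) = {m}"
    using t im by simp
  have "{0..t} \<union> {t..1} = {0..1}" using t by auto
  then have 2: "path_image (subpath t 0 g) \<union> path_image (subpath t 1 g) = path_image g"
    unfolding im by (metis image_Un path_image_def)
  show thesis
    using t t01 assms(1) 1 2 by (intro that[of "subpath t 0 g" "subpath t 1 g"])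
      (simp_all add: arc_subpath_arc, simp_all add: pathstart_def pathfinish_def subpath_def)
qed

text \<open>Turns a fat vertex with three legs into a genuine branch point. An arc
  \<open>\<alpha>\<close> joins the far ends of \<open>g 0\<close> and \<open>g 1\<close>, and a
  path from the far end of \<open>g 2\<close> is stopped where it first hits
  \<open>\<alpha>\<close>. The hitting point \<open>m\<close> lies in \<open>S\<close>, because
  \<open>g 2\<close> meets \<open>g 0\<close> and \<open>g 1\<close> only there, and it cuts
  \<open>\<alpha>\<close> into the other two legs.\<close>

lemma tripod:
  fixes S :: "'a::euclidean_space set"
  assumes S: "path_connected S"
    and g: "\<And>i. i < 3 \<Longrightarrow> arc (g i) \<and> pathstart (g i) \<in> S \<and> path_image (g i) \<inter> S \<subseteq> {pathstart (g i)}"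
    and disj: "\<And>i j. i < 3 \<Longrightarrow> j < 3 \<Longrightarrow> i \<noteq> j \<Longrightarrow> path_image (g i) \<inter> path_image (g j) \<subseteq> S"
  obtains m h where "m \<in> S"
    "\<And>i::nat. i < 3 \<Longrightarrow> arc (h i) \<and> pathstart (h i) = m \<and> pathfinish (h i) = pathfinish (g i) \<and>
      path_image (h i) \<subseteq> S \<union> (\<Union>j<3. path_image (g j))"
    "\<And>i j. i < 3 \<Longrightarrow> j < 3 \<Longrightarrow> i \<noteq> j \<Longrightarrow> path_image (h i) \<inter> path_image (h j) = {m}"
proof -
  define q where "q i = pathfinish (g i)" for i
  have q: "q i \<notin> S" "q i \<in> path_image (g i)" if "i < 3" for i
    using g[OF that] arc_distinct_ends[of "g i"] pathfinish_in_path_image[of "g i"] by (auto simp: q_def)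
  have pc: "path_connected (path_image (g i))" if "i < 3" for i
    using g[OF that] by (simp add: arc_imp_path path_connected_path_image)
  have start: "pathstart (g i) \<in> S \<inter> path_image (g i)" if "i < 3" for i
    using g[OF that] pathstart_in_path_image by auto
  have Sg: "path_connected (S \<union> path_image (g i))" if "i < 3" for i
    using S pc[OF that] start[OF that] by (intro path_connected_Un) auto
  define X where "X = (S \<union> path_image (g 0)) \<union> (S \<union> path_image (g 1))"
  have "path_connected X"
    unfolding X_def using Sg[of 0] Sg[of 1] start[of 0] by (intro path_connected_Un[of "S \<union> _"]) auto
  moreover have "q 0 \<noteq> q 1" "q 0 \<in> X" "q 1 \<in> X"
    using disj[of 0 1] q[of 0] q[of 1] by (auto simp: X_def)
  ultimately obtain \<alpha> where \<alpha>: "arc \<alpha>" "path_image \<alpha> \<subseteq> X" "pathstart \<alpha> = q 0" "pathfinish \<alpha> = q 1"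
    unfolding path_connected_arcwise by metis
  \<comment> \<open>The images of \<open>g 0\<close> and \<open>g 1\<close> are closed and meet only
    in \<open>S\<close>, so a connected \<open>\<alpha>\<close> that avoids \<open>S\<close> could
    not pass from one to the other.\<close>
  have "\<exists>s. s \<in> path_image \<alpha> \<inter> S"
  proof (rule ccontr)
    assume *: "\<not> ?thesis"
    have "connected (path_image \<alpha>)" using \<alpha>(1) by (simp add: arc_imp_path connected_path_image)
    moreover have "closed (path_image (g 0))" "closed (path_image (g 1))"
      using g[of 0] g[of 1] by (auto intro: closed_arc_image)
    moreover have "path_image \<alpha> \<subseteq> path_image (g 0) \<union> path_image (g 1)"
      using \<alpha>(2) * by (auto simp: X_def)
    moreover have "path_image (g 0) \<inter> path_image (g 1) \<inter> path_image \<alpha> = {}"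
      using * disj[of 0 1] by auto
    ultimately have "path_image (g 0) \<inter> path_image \<alpha> = {} \<or> path_image (g 1) \<inter> path_image \<alpha> = {}"
      unfolding connected_closed by blast
    then show False
      using q[of 0] q[of 1] \<alpha> pathstart_in_path_image[of \<alpha>] pathfinish_in_path_image[of \<alpha>] by auto
  qed
  then obtain s where s: "s \<in> path_image \<alpha>" "s \<in> S" by blast
  obtain \<beta> where \<beta>: "path \<beta>" "path_image \<beta> \<subseteq> S \<union> path_image (g 2)" "pathstart \<beta> = q 2" "pathfinish \<beta> = s"
    using Sg[of 2] s q[of 2] unfolding path_connected_def by (metis UnCI lessI numeral_3_eq_3 numeral_2_eq_2)
  have q2: "q 2 \<notin> path_image \<alpha>"
    using \<alpha>(2) q[of 2] disj[of 0 2] disj[of 1 2] by (auto simp: X_def)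
  have closed: "closed (path_image \<alpha>)" using \<alpha>(1) by (rule closed_arc_image)
  obtain \<beta>' where \<beta>': "path \<beta>'" "pathstart \<beta>' = q 2" "path_image \<beta>' \<subseteq> path_image \<beta>"
    "path_image \<beta>' - {pathfinish \<beta>'} \<subseteq> interior (- path_image \<alpha>)" "pathfinish \<beta>' \<in> frontier (- path_image \<alpha>)"
  proof (rule exists_path_subpath_to_frontier[OF \<beta>(1), of "- path_image \<alpha>"])
    show "pathstart \<beta> \<in> closure (- path_image \<alpha>)"
      using q2 \<beta>(3) closure_subset[of "- path_image \<alpha>"] by auto
  qed (use \<beta> s in auto)
  define m where "m = pathfinish \<beta>'"
  have m\<alpha>: "m \<in> path_image \<alpha>"
    using \<beta>'(5) frontier_subset_closed[OF closed] by (auto simp: m_def)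
  have "q 2 \<noteq> m" using m\<alpha> q2 by auto
  then obtain \<gamma> where \<gamma>: "arc \<gamma>" "path_image \<gamma> \<subseteq> path_image \<beta>'" "pathstart \<gamma> = q 2" "pathfinish \<gamma> = m"
    using path_contains_arc[OF \<beta>'(1,2) m_def[symmetric]] by blast
  have \<gamma>\<alpha>: "path_image \<gamma> \<inter> path_image \<alpha> = {m}"
    using \<gamma> \<beta>'(4) m\<alpha> interior_subset[of "- path_image \<alpha>"] pathfinish_in_path_image[of \<gamma>] by (auto simp: m_def)
  have "m \<in> S \<union> path_image (g 2)" "m \<in> X"
    using \<gamma>\<alpha> \<gamma>(2) \<beta>'(3) \<beta>(2) \<alpha>(2) by auto
  then have mS: "m \<in> S" using disj[of 0 2] disj[of 1 2] by (auto simp: X_def)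
  have "m \<noteq> q 0" "m \<noteq> q 1" using mS q[of 0] q[of 1] by auto
  then obtain \<alpha>0 \<alpha>1 where \<alpha>01: "arc \<alpha>0" "arc \<alpha>1" "pathstart \<alpha>0 = m" "pathstart \<alpha>1 = m"
    "pathfinish \<alpha>0 = q 0" "pathfinish \<alpha>1 = q 1"
    "path_image \<alpha>0 \<union> path_image \<alpha>1 = path_image \<alpha>" "path_image \<alpha>0 \<inter> path_image \<alpha>1 = {m}"
    using arc_split[OF \<alpha>(1) m\<alpha>] \<alpha>(3,4) by metis
  define h where "h = (\<lambda>i::nat. if i = 0 then \<alpha>0 else if i = 1 then \<alpha>1 else reversepath \<gamma>)"
  have i3: "i = 0 \<or> i = 1 \<or> i = 2" if "i < 3" for i :: nat using that by auto
  have U: "(\<Union>j<3. path_image (g j)) = path_image (g 0) \<union> path_image (g 1) \<union> path_image (g 2)"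
    by (auto simp: numeral_3_eq_3 lessThan_Suc numeral_2_eq_2)
  show thesis
  proof (rule that[of m h])
    fix i :: nat assume "i < 3"
    then have "i = 0 \<or> i = 1 \<or> i = 2" by (rule i3)
    then show "arc (h i) \<and> pathstart (h i) = m \<and> pathfinish (h i) = pathfinish (g i) \<and>
      path_image (h i) \<subseteq> S \<union> (\<Union>j<3. path_image (g j))"
      using \<alpha>01 \<gamma> \<alpha>(2) \<beta>'(3) \<beta>(2) unfolding U X_def q_def
      by (elim disjE) (auto simp: h_def arc_reversepath)
  next
    fix i j :: nat assume "i < 3" "j < 3" "i \<noteq> j"
    have sub: "path_image \<alpha>0 \<subseteq> path_image \<alpha>" "path_image \<alpha>1 \<subseteq> path_image \<alpha>" using \<alpha>01(7) by auto
    have "m \<in> path_image \<alpha>0" "m \<in> path_image \<alpha>1" "m \<in> path_image \<gamma>"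
      using \<alpha>01(3,4) \<gamma>(4) pathstart_in_path_image pathfinish_in_path_image by metis+
    then show "path_image (h i) \<inter> path_image (h j) = {m}"
      using \<open>i < 3\<close>[THEN i3] \<open>j < 3\<close>[THEN i3] \<open>i \<noteq> j\<close> \<alpha>01(8) \<gamma>\<alpha> sub
      by (elim disjE) (auto simp: h_def)
  qed (use mS in auto)
qed

text \<open>Each connecting arc is cut at \<open>mid i j\<close>, and its halves are handed to
  \<open>A i\<close> and \<open>B j\<close>. Among the six enlarged sets only \<open>XA i\<close>
  and \<open>XB j\<close> can meet, and only in \<open>mid i j\<close>; so tripods can be chosen in
  them independently and glued at these points.\<close>

lemma K33_fat_impossible:
  fixes A B :: "nat \<Rightarrow> complex set" and g :: "nat \<Rightarrow> nat \<Rightarrow> real \<Rightarrow> complex"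
  assumes pc: "\<And>i. i < 3 \<Longrightarrow> path_connected (A i)" "\<And>i. i < 3 \<Longrightarrow> path_connected (B i)"
    and AA: "\<And>i k. i < 3 \<Longrightarrow> k < 3 \<Longrightarrow> i \<noteq> k \<Longrightarrow> A i \<inter> A k = {}"
    and BB: "\<And>i k. i < 3 \<Longrightarrow> k < 3 \<Longrightarrow> i \<noteq> k \<Longrightarrow> B i \<inter> B k = {}"
    and AB: "\<And>i k. i < 3 \<Longrightarrow> k < 3 \<Longrightarrow> A i \<inter> B k = {}"
    and g: "\<And>i j. i < 3 \<Longrightarrow> j < 3 \<Longrightarrow> arc (g i j) \<and> pathstart (g i j) \<in> A i \<and> pathfinish (g i j) \<in> B j"
    and gU: "\<And>i j. i < 3 \<Longrightarrow> j < 3 \<Longrightarrow>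
      path_image (g i j) \<inter> (\<Union>k<3. A k \<union> B k) \<subseteq> {pathstart (g i j), pathfinish (g i j)}"
    and gg: "\<And>i j k l. i < 3 \<Longrightarrow> j < 3 \<Longrightarrow> k < 3 \<Longrightarrow> l < 3 \<Longrightarrow> (i, j) \<noteq> (k, l) \<Longrightarrow>
      path_image (g i j) \<inter> path_image (g k l) \<subseteq> (\<Union>k<3. A k \<union> B k)"
  shows False
proof -
  define U where "U = (\<Union>k<3. A k \<union> B k)"
  define mid where "mid i j = g i j (1/2)" for i j
  have "\<exists>gA gB. arc gA \<and> arc gB \<and> pathstart gA = pathstart (g i j) \<and> pathstart gB = pathfinish (g i j) \<and>
      pathfinish gA = mid i j \<and> pathfinish gB = mid i j \<and> path_image gA \<subseteq> path_image (g i j) \<and>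
      path_image gB \<subseteq> path_image (g i j) \<and> path_image gA \<inter> path_image gB = {mid i j}"
    if ij: "i < 3" "j < 3" for i j
  proof -
    have inj: "inj_on (g i j) {0..1}" using g[OF ij] by (auto simp: arc_def)
    have "mid i j \<in> path_image (g i j)" by (auto simp: mid_def path_image_def)
    moreover have "mid i j \<noteq> pathstart (g i j)" "mid i j \<noteq> pathfinish (g i j)"
      using inj_onD[OF inj, of "1/2" 0] inj_onD[OF inj, of "1/2" 1]
      by (auto simp: mid_def pathstart_def pathfinish_def)
    ultimately obtain g0 g1 where *: "arc g0" "arc g1" "pathstart g0 = mid i j" "pathstart g1 = mid i j"
      "pathfinish g0 = pathstart (g i j)" "pathfinish g1 = pathfinish (g i j)"
      "path_image g0 \<union> path_image g1 = path_image (g i j)" "path_image g0 \<inter> path_image g1 = {mid i j}"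
      using g[OF ij] arc_split[of "g i j" "mid i j"] by metis
    then show ?thesis
      by (intro exI[of _ "reversepath g0"] exI[of _ "reversepath g1"]) (auto simp: arc_reversepath)
  qed
  then obtain gA gB where half: "\<And>i j. i < 3 \<Longrightarrow> j < 3 \<Longrightarrow> arc (gA i j) \<and> arc (gB i j) \<and>
      pathstart (gA i j) = pathstart (g i j) \<and> pathstart (gB i j) = pathfinish (g i j) \<and>
      pathfinish (gA i j) = mid i j \<and> pathfinish (gB i j) = mid i j \<and> path_image (gA i j) \<subseteq> path_image (g i j) \<and>
      path_image (gB i j) \<subseteq> path_image (g i j) \<and> path_image (gA i j) \<inter> path_image (gB i j) = {mid i j}"
    by metis
  have A_U: "A i \<subseteq> U" "B i \<subseteq> U" if "i < 3" for i using that by (auto simp: U_def)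
  have gAU: "path_image (gA i j) \<inter> U = {pathstart (g i j)}"
    and gBU: "path_image (gB i j) \<inter> U = {pathfinish (g i j)}" if "i < 3" "j < 3" for i j
  proof -
    note h = half[OF that] and gij = g[OF that]
    have "pathstart (g i j) \<noteq> mid i j" "pathfinish (g i j) \<noteq> mid i j"
      using h arc_distinct_ends[of "gA i j"] arc_distinct_ends[of "gB i j"] by auto
    moreover have "pathstart (g i j) \<in> path_image (gA i j)" "pathfinish (g i j) \<in> path_image (gB i j)"
      using h pathstart_in_path_image[of "gA i j"] pathstart_in_path_image[of "gB i j"] by auto
    moreover have "pathstart (g i j) \<in> U" "pathfinish (g i j) \<in> U" using gij A_U that by auto
    ultimately show "path_image (gA i j) \<inter> U = {pathstart (g i j)}" "path_image (gB i j) \<inter> U = {pathfinish (g i j)}"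
      using h gU[OF that] unfolding U_def[symmetric] by blast+
  qed
  have gg': "path_image (g i j) \<inter> path_image (g k l) \<subseteq> U" if "i < 3" "j < 3" "k < 3" "l < 3" "(i, j) \<noteq> (k, l)" for i j k l
    using gg[OF that] by (simp add: U_def)
  have sub: "path_image (gA i j) \<subseteq> path_image (g i j)" "path_image (gB i j) \<subseteq> path_image (g i j)" if "i < 3" "j < 3" for i j
    using half[OF that] by simp_all
  have gAU': "path_image (gA i j) \<inter> U \<subseteq> A i" and gBU': "path_image (gB i j) \<inter> U \<subseteq> B j" if "i < 3" "j < 3" for i j
    using gAU[OF that] gBU[OF that] g[OF that] by simp_all
  have intU: "path_image (gA i j) \<inter> path_image (gA k l) \<subseteq> U" "path_image (gB i j) \<inter> path_image (gB k l) \<subseteq> U"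
    "path_image (gA i j) \<inter> path_image (gB k l) \<subseteq> U"
    if "i < 3" "j < 3" "k < 3" "l < 3" "(i, j) \<noteq> (k, l)" for i j k l
    using sub[OF that(1,2)] sub[OF that(3,4)] gg'[OF that] by (meson Int_mono order_trans)+
  have "\<exists>m h. m \<in> A i \<and> (\<forall>j<3. arc (h j) \<and> pathstart (h j) = m \<and> pathfinish (h j) = mid i j \<and>
      path_image (h j) \<subseteq> A i \<union> (\<Union>l<3. path_image (gA i l))) \<and>
      (\<forall>j<3. \<forall>l<3. j \<noteq> l \<longrightarrow> path_image (h j) \<inter> path_image (h l) = {m})" if i: "i < 3" for i
  proof (rule tripod[OF pc(1)[OF i], of "gA i"])
    show "arc (gA i j) \<and> pathstart (gA i j) \<in> A i \<and> path_image (gA i j) \<inter> A i \<subseteq> {pathstart (gA i j)}" if "j < 3" for j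
      using half[OF i that] g[OF i that] gAU[OF i that] A_U(1)[OF i] by auto
    show "path_image (gA i j) \<inter> path_image (gA i l) \<subseteq> A i" if "j < 3" "l < 3" "j \<noteq> l" for j l
      using intU(1)[OF i that(1) i that(2)] that(3) gAU'[OF i that(1)] by auto
    fix m h assume "m \<in> A i" and h: "\<And>j. j < 3 \<Longrightarrow> arc (h j) \<and> pathstart (h j) = m \<and> pathfinish (h j) = pathfinish (gA i j) \<and>
        path_image (h j) \<subseteq> A i \<union> (\<Union>l<3. path_image (gA i l))"
      "\<And>j l. j < 3 \<Longrightarrow> l < 3 \<Longrightarrow> j \<noteq> l \<Longrightarrow> path_image (h j) \<inter> path_image (h l) = {m}"
    then show ?thesis using half[OF i] by (intro exI[of _ m] exI[of _ h]) simp
  qed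
  then obtain a hA where A: "\<And>i. i < 3 \<Longrightarrow> a i \<in> A i \<and> (\<forall>j<3. arc (hA i j) \<and> pathstart (hA i j) = a i \<and>
      pathfinish (hA i j) = mid i j \<and> path_image (hA i j) \<subseteq> A i \<union> (\<Union>l<3. path_image (gA i l))) \<and>
      (\<forall>j<3. \<forall>l<3. j \<noteq> l \<longrightarrow> path_image (hA i j) \<inter> path_image (hA i l) = {a i})" by metis
  have "\<exists>m h. m \<in> B j \<and> (\<forall>i<3. arc (h i) \<and> pathstart (h i) = m \<and> pathfinish (h i) = mid i j \<and>
      path_image (h i) \<subseteq> B j \<union> (\<Union>l<3. path_image (gB l j))) \<and>
      (\<forall>i<3. \<forall>l<3. i \<noteq> l \<longrightarrow> path_image (h i) \<inter> path_image (h l) = {m})" if j: "j < 3" for j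
  proof (rule tripod[OF pc(2)[OF j], of "\<lambda>i. gB i j"])
    show "arc (gB i j) \<and> pathstart (gB i j) \<in> B j \<and> path_image (gB i j) \<inter> B j \<subseteq> {pathstart (gB i j)}" if "i < 3" for i
      using half[OF that j] g[OF that j] gBU[OF that j] A_U(2)[OF j] by auto
    show "path_image (gB i j) \<inter> path_image (gB l j) \<subseteq> B j" if "i < 3" "l < 3" "i \<noteq> l" for i l
      using intU(2)[OF that(1) j that(2) j] that(3) gBU'[OF that(1) j] by auto
    fix m h assume "m \<in> B j" and h: "\<And>i. i < 3 \<Longrightarrow> arc (h i) \<and> pathstart (h i) = m \<and> pathfinish (h i) = pathfinish (gB i j) \<and>
        path_image (h i) \<subseteq> B j \<union> (\<Union>l<3. path_image (gB l j))"
      "\<And>i l. i < 3 \<Longrightarrow> l < 3 \<Longrightarrow> i \<noteq> l \<Longrightarrow> path_image (h i) \<inter> path_image (h l) = {m}"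
    then show ?thesis using half[OF _ j] by (intro exI[of _ m] exI[of _ h]) simp
  qed
  then obtain b hB where B: "\<And>j. j < 3 \<Longrightarrow> b j \<in> B j \<and> (\<forall>i<3. arc (hB j i) \<and> pathstart (hB j i) = b j \<and>
      pathfinish (hB j i) = mid i j \<and> path_image (hB j i) \<subseteq> B j \<union> (\<Union>l<3. path_image (gB l j))) \<and>
      (\<forall>i<3. \<forall>l<3. i \<noteq> l \<longrightarrow> path_image (hB j i) \<inter> path_image (hB j l) = {b j})" by metis
  define XA where "XA i = A i \<union> (\<Union>l<3. path_image (gA i l))" for i
  define XB where "XB j = B j \<union> (\<Union>l<3. path_image (gB l j))" for j
  have gAA: "path_image (gA i j) \<inter> A k = {}" if "i < 3" "j < 3" "k < 3" "i \<noteq> k" for i j k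
    using gAU'[OF that(1,2)] A_U(1)[OF that(3)] AA[OF that(1,3,4)] by auto
  have gAB: "path_image (gA i j) \<inter> B k = {}" if "i < 3" "j < 3" "k < 3" for i j k
    using gAU'[OF that(1,2)] A_U(2)[OF that(3)] AB[OF that(1,3)] by auto
  have gBB: "path_image (gB i j) \<inter> B k = {}" if "i < 3" "j < 3" "k < 3" "j \<noteq> k" for i j k
    using gBU'[OF that(1,2)] A_U(2)[OF that(3)] BB[OF that(2,3,4)] by auto
  have gBA: "path_image (gB i j) \<inter> A k = {}" if "i < 3" "j < 3" "k < 3" for i j k
    using gBU'[OF that(1,2)] A_U(1)[OF that(3)] AB[OF that(3,2)] by auto
  have gAgA: "path_image (gA i j) \<inter> path_image (gA k l) = {}" if "i < 3" "j < 3" "k < 3" "l < 3" "i \<noteq> k" for i j k l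
    using intU(1)[OF that(1-4)] that(5) gAU'[OF that(1,2)] gAU'[OF that(3,4)] AA[OF that(1,3,5)] by auto
  have gBgB: "path_image (gB i j) \<inter> path_image (gB k l) = {}" if "i < 3" "j < 3" "k < 3" "l < 3" "j \<noteq> l" for i j k l
    using intU(2)[OF that(1-4)] that(5) gBU'[OF that(1,2)] gBU'[OF that(3,4)] BB[OF that(2,4,5)] by auto
  have gAgB: "path_image (gA i j) \<inter> path_image (gB k l) = {}" if "i < 3" "j < 3" "k < 3" "l < 3" "(i, j) \<noteq> (k, l)" for i j k l
    using intU(3)[OF that] gAU'[OF that(1,2)] gBU'[OF that(3,4)] AB[OF that(1,4)] by auto
  have XAA: "XA i \<inter> XA k = {}" if "i < 3" "k < 3" "i \<noteq> k" for i k
  proof -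
    have "A i \<inter> (\<Union>l<3. path_image (gA k l)) = {}" "(\<Union>l<3. path_image (gA i l)) \<inter> A k = {}"
      using gAA[of k _ i] gAA[of i _ k] that by auto
    moreover have "(\<Union>l<3. path_image (gA i l)) \<inter> (\<Union>l<3. path_image (gA k l)) = {}"
      using gAgA[of i _ k] that by auto
    ultimately show ?thesis using AA[of i k] that by (simp add: XA_def Int_Un_distrib Int_Un_distrib2)
  qed
  have XBB: "XB i \<inter> XB k = {}" if "i < 3" "k < 3" "i \<noteq> k" for i k
  proof -
    have "B i \<inter> (\<Union>l<3. path_image (gB l k)) = {}" "(\<Union>l<3. path_image (gB l i)) \<inter> B k = {}"
      using gBB[of _ k i] gBB[of _ i k] that by auto
    moreover have "(\<Union>l<3. path_image (gB l i)) \<inter> (\<Union>l<3. path_image (gB l k)) = {}"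
      using gBgB[of _ i _ k] that by auto
    ultimately show ?thesis using BB[of i k] that by (simp add: XB_def Int_Un_distrib Int_Un_distrib2)
  qed
  have XAB: "XA i \<inter> XB j \<subseteq> {mid i j}" if "i < 3" "j < 3" for i j
  proof -
    have "A i \<inter> (\<Union>l<3. path_image (gB l j)) = {}" "(\<Union>l<3. path_image (gA i l)) \<inter> B j = {}"
      using gBA[of _ j i] gAB[of i _ j] that by auto
    moreover have "path_image (gA i k) \<inter> path_image (gB l j) \<subseteq> {mid i j}" if "k < 3" "l < 3" for k l
      using gAgB[of i k l j] half[of i j] that \<open>i < 3\<close> \<open>j < 3\<close> by (cases "(i, k) = (l, j)") auto
    then have "(\<Union>l<3. path_image (gA i l)) \<inter> (\<Union>l<3. path_image (gB l j)) \<subseteq> {mid i j}" by blast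
    ultimately show ?thesis using AB[of i j] that by (simp add: XA_def XB_def Int_Un_distrib Int_Un_distrib2)
  qed
  have hA: "arc (hA i j)" "pathstart (hA i j) = a i" "pathfinish (hA i j) = mid i j" "path_image (hA i j) \<subseteq> XA i"
    and hB: "arc (hB j i)" "pathstart (hB j i) = b j" "pathfinish (hB j i) = mid i j" "path_image (hB j i) \<subseteq> XB j"
    if "i < 3" "j < 3" for i j
    using A[of i] B[of j] that by (auto simp: XA_def XB_def)
  have hAA: "path_image (hA i j) \<inter> path_image (hA i l) = {a i}" if "i < 3" "j < 3" "l < 3" "j \<noteq> l" for i j l
    using A[of i] that by auto
  have hBB: "path_image (hB j i) \<inter> path_image (hB j l) = {b j}" if "i < 3" "j < 3" "l < 3" "i \<noteq> l" for i j l
    using B[of j] that by auto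
  have midA: "mid i l \<notin> path_image (hA i j)" if "i < 3" "j < 3" "l < 3" "j \<noteq> l" for i j l
    using hAA[of i j l] hA(1,2,3)[of i l] that arc_distinct_ends[of "hA i l"] pathfinish_in_path_image[of "hA i l"] by auto
  have midB: "mid l j \<notin> path_image (hB j i)" if "i < 3" "j < 3" "l < 3" "i \<noteq> l" for i j l
    using hBB[of i j l] hB(1,2,3)[of l j] that arc_distinct_ends[of "hB j l"] pathfinish_in_path_image[of "hB j l"] by auto
  define h where "h i j = hA i j +++ reversepath (hB j i)" for i j
  have him: "path_image (h i j) = path_image (hA i j) \<union> path_image (hB j i)" if "i < 3" "j < 3" for i j
    using hA[OF that] hB[OF that] by (simp add: h_def path_image_join)
  have cross: "path_image (hA i j) \<inter> path_image (hB l k) = {}" if "i < 3" "j < 3" "k < 3" "l < 3" "(i, j) \<noteq> (k, l)" for i j k l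
  proof -
    have "path_image (hA i j) \<inter> path_image (hB l k) \<subseteq> {mid i l}"
      using hA(4)[of i j] hB(4)[of k l] XAB[of i l] that by blast
    then show ?thesis
      using midA[of i j l] midB[of k l i] that by (cases "j = l") auto
  qed
  show False
  proof (rule K33_arcs_impossible[of h a b])
    fix i j :: nat assume ij: "i < 3" "j < 3"
    have "path_image (hA i j) \<inter> path_image (hB j i) \<subseteq> {mid i j}"
      using hA(4)[OF ij] hB(4)[OF ij] XAB[OF ij] by (meson Int_mono order_trans)
    then show "arc (h i j) \<and> pathstart (h i j) = a i \<and> pathfinish (h i j) = b j"
      using hA[OF ij] hB[OF ij] unfolding h_def by (simp add: arc_join arc_reversepath)
    fix k l :: nat assume kl: "k < 3" "l < 3" "(i, j) \<noteq> (k, l)"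
    have "path_image (hA i j) \<inter> path_image (hA k l) \<subseteq> (if i = k then {a i} else {})"
      using hAA[of i j l] hA(4)[of i j] hA(4)[of k l] XAA[of i k] ij kl by (cases "i = k") auto
    moreover have "path_image (hB j i) \<inter> path_image (hB l k) \<subseteq> (if j = l then {b j} else {})"
      using hBB[of i j k] hB(4)[of i j] hB(4)[of k l] XBB[of j l] ij kl by (cases "j = l") auto
    moreover have "path_image (hA i j) \<inter> path_image (hB l k) = {}" "path_image (hA k l) \<inter> path_image (hB j i) = {}"
      using cross[of i j k l] cross[of k l i j] ij kl by auto
    ultimately show "path_image (h i j) \<inter> path_image (h k l) \<subseteq> (if i = k then {a i} else {}) \<union> (if j = l then {b j} else {})"
      unfolding him[OF ij] him[OF kl(1,2)] by blast
  qed
qed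

text \<open>The four-cycle through the vertices 0, 1, 2, 3 is a Jordan curve. The chord from 0 to 2,
  the chord from 1 to 3 and the star at vertex 4 each lie on one of its two sides. Hence two of the
  three share a side, but any two of them conflict there by \<open>chord_separates\<close>.\<close>

lemma K5_arcs_impossible:
  fixes h :: "nat \<Rightarrow> nat \<Rightarrow> real \<Rightarrow> complex"
  assumes h: "\<And>i j. i < j \<Longrightarrow> j < 5 \<Longrightarrow> arc (h i j) \<and> pathstart (h i j) = p i \<and> pathfinish (h i j) = p j"
    and disj: "\<And>i j k l. i < j \<Longrightarrow> j < 5 \<Longrightarrow> k < l \<Longrightarrow> l < 5 \<Longrightarrow> (i, j) \<noteq> (k, l) \<Longrightarrow>
      path_image (h i j) \<inter> path_image (h k l) \<subseteq> p ` ({i, j} \<inter> {k, l})"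
  shows False
proof -
  define I where "I i j = path_image (h i j)" for i j
  have ends: "p i \<in> I i j" "p j \<in> I i j" "p i \<noteq> p j" if "i < j" "j < 5" for i j
    using h[OF that] arc_distinct_ends[of "h i j"] pathstart_in_path_image[of "h i j"]
      pathfinish_in_path_image[of "h i j"] by (auto simp: I_def)
  have Iint: "I i j \<inter> I k l \<subseteq> p ` ({i, j} \<inter> {k, l})" if "i < j" "j < 5" "k < l" "l < 5" "(i, j) \<noteq> (k, l)" for i j k l
    using disj[OF that] by (simp add: I_def)
  note pts = ends(3)[of 0 1, simplified] ends(3)[of 0 2, simplified] ends(3)[of 0 3, simplified] ends(3)[of 0 4, simplified]
    ends(3)[of 1 2, simplified] ends(3)[of 1 3, simplified] ends(3)[of 1 4, simplified] ends(3)[of 2 3, simplified]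
    ends(3)[of 2 4, simplified] ends(3)[of 3 4, simplified]
  note on = ends(1,2)[of 0 1, simplified] ends(1,2)[of 0 2, simplified] ends(1,2)[of 0 3, simplified] ends(1,2)[of 0 4, simplified]
    ends(1,2)[of 1 2, simplified] ends(1,2)[of 1 3, simplified] ends(1,2)[of 1 4, simplified] ends(1,2)[of 2 3, simplified]
    ends(1,2)[of 2 4, simplified] ends(1,2)[of 3 4, simplified]
  have conn: "connected (I i j - {p i})" "connected (I i j - {p j})" "connected (I i j - {p i, p j})"
      "connected (I i j)" "compact (I i j)" if "i < j" "j < 5" for i j
    using h[OF that] arc_image_minus_pathstart(1)[of "h i j"] arc_image_minus_pathfinish(1)[of "h i j"]
      arc_image_endless(1)[of "h i j"]
    by (simp_all add: I_def arc_imp_path connected_path_image compact_path_image)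
  define g1 where "g1 = h 0 1 +++ h 1 2"
  define g2 where "g2 = h 0 3 +++ reversepath (h 2 3)"
  have g1: "arc g1" "pathstart g1 = p 0" "pathfinish g1 = p 2" "path_image g1 = I 0 1 \<union> I 1 2"
    using h[of 0 1] h[of 1 2] Iint[of 0 1 1 2] by (auto simp: g1_def I_def arc_join path_image_join)
  have g2: "arc g2" "pathstart g2 = p 0" "pathfinish g2 = p 2" "path_image g2 = I 0 3 \<union> I 2 3"
    using h[of 0 3] h[of 2 3] Iint[of 0 3 2 3] by (auto simp: g2_def I_def arc_join arc_reversepath path_image_join)
  define J where "J = path_image g1 \<union> path_image g2"
  have J: "J = I 0 1 \<union> I 1 2 \<union> (I 0 3 \<union> I 2 3)" by (simp add: J_def g1 g2)
  have gg: "path_image g1 \<inter> path_image g2 = {p 0, p 2}"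
    using Iint[of 0 1 0 3] Iint[of 0 1 2 3] Iint[of 1 2 0 3] Iint[of 1 2 2 3] on unfolding g1(4) g2(4) by auto
  have simple: "simple_path (g1 +++ reversepath g2)"
    by (rule simple_path_join_loop) (use g1 g2 gg in \<open>auto simp: arc_reversepath\<close>)
  have loop: "pathfinish (g1 +++ reversepath g2) = pathstart (g1 +++ reversepath g2)"
    and J': "path_image (g1 +++ reversepath g2) = J"
    using g1 g2 by (simp_all add: J_def path_image_join)
  have side: "S \<subseteq> inside J \<or> S \<subseteq> outside J" if "connected S" "S \<inter> J = {}" for S
    using connected_side[OF simple loop that(1)] that(2) J' by simp
  have avoid: "I i j \<inter> J \<subseteq> p ` ({i, j} \<inter> {0, 1, 2, 3})" if "i < j" "j < 5" "(i, j) \<in> {(0, 2), (1, 3)} \<or> j = 4" for i j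
  proof -
    have "I i j \<inter> I k l \<subseteq> p ` ({i, j} \<inter> {0, 1, 2, 3})" if kl: "(k, l) \<in> {(0, 1), (1, 2), (0, 3), (2, 3)}" for k l
    proof -
      have "k < l" "l < 5" "(i, j) \<noteq> (k, l)" "{k, l} \<subseteq> {0, 1, 2, 3}"
        using kl \<open>(i, j) \<in> {(0, 2), (1, 3)} \<or> j = 4\<close> by auto
      then show ?thesis
        using Iint[OF \<open>i < j\<close> \<open>j < 5\<close>, of k l] image_mono[of "{i, j} \<inter> {k, l}" "{i, j} \<inter> {0, 1, 2, 3}" p] by blast
    qed
    from this[of 0 1] this[of 1 2] this[of 0 3] this[of 2 3] show ?thesis
      by (simp add: J Int_Un_distrib)
  qed
  \<comment> \<open>All three conflicts have this form: \<open>C\<close> joins 0 to 2, while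
    \<open>S\<close> reaches 1 and 3 on the same side.\<close>
  have cross: False if C: "compact C" "connected C" "C \<inter> J = {p 0, p 2}" and S: "connected S" "S \<noteq> {}" "S \<inter> C = {}"
      "p 1 \<in> closure S" "p 3 \<in> closure S" and same: "S \<union> (C - {p 0, p 2}) \<subseteq> inside J \<or> S \<union> (C - {p 0, p 2}) \<subseteq> outside J" for C S
    by (rule chord_separates[OF g1(1) g2(1) g1(2,3) g2(2,3) gg J_def C S(1-3) S(4) _ S(5) _ same])
      (use pts on g1(4) g2(4) in auto)
  define T where "T = (I 0 4 - {p 0}) \<union> (I 1 4 - {p 1}) \<union> (I 2 4 - {p 2}) \<union> (I 3 4 - {p 3})"
  have "connected T"
    unfolding T_def by (intro connected_Un_at[of _ _ "p 4"] conn(1)) (use pts on in auto)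
  moreover have "T \<inter> J = {}"
    using avoid[of 0 4] avoid[of 1 4] avoid[of 2 4] avoid[of 3 4] unfolding T_def by auto
  ultimately have sideT: "T \<subseteq> inside J \<or> T \<subseteq> outside J" by (rule side)
  define D where "D = I 0 2 - {p 0, p 2}"
  define E where "E = I 1 3 - {p 1, p 3}"
  have D: "connected D" "D \<noteq> {}" and E: "connected E" "E \<noteq> {}"
    using conn(3)[of 0 2] conn(3)[of 1 3] arc_image_endless(2)[of "h 0 2"] arc_image_endless(2)[of "h 1 3"] h[of 0 2] h[of 1 3]
    by (simp_all add: D_def E_def I_def)
  have clE: "p 1 \<in> closure E" "p 3 \<in> closure E"
    using arc_image_endless_closure[of "h 1 3"] h[of 1 3] by (simp_all add: E_def I_def)
  have sideD: "D \<subseteq> inside J \<or> D \<subseteq> outside J" and sideE: "E \<subseteq> inside J \<or> E \<subseteq> outside J"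
  proof -
    have "D \<inter> J = {}" "E \<inter> J = {}" using avoid[of 0 2] avoid[of 1 3] by (auto simp: D_def E_def)
    then show "D \<subseteq> inside J \<or> D \<subseteq> outside J" "E \<subseteq> inside J \<or> E \<subseteq> outside J"
      using side D(1) E(1) by simp_all
  qed
  have chord02: "I 0 2 \<inter> J = {p 0, p 2}" using avoid[of 0 2] on by (auto simp: J)
  have chord04: "(I 0 4 \<union> I 2 4) \<inter> J = {p 0, p 2}" using avoid[of 0 4] avoid[of 2 4] on by (auto simp: J)
  have c024: "connected (I 0 4 \<union> I 2 4)" "compact (I 0 4 \<union> I 2 4)"
    using conn(4,5)[of 0 4] conn(4,5)[of 2 4] on by (auto intro: connected_Un_at[of _ _ "p 4"])
  have 1: "\<not> (E \<union> T \<subseteq> inside J \<or> E \<union> T \<subseteq> outside J)"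
  proof
    assume *: "E \<union> T \<subseteq> inside J \<or> E \<union> T \<subseteq> outside J"
    show False
    proof (rule cross[OF c024(2,1) chord04 E _ clE])
      show "E \<inter> (I 0 4 \<union> I 2 4) = {}" using Iint[of 1 3 0 4] Iint[of 1 3 2 4] by (auto simp: E_def)
      have "I 0 4 \<union> I 2 4 - {p 0, p 2} \<subseteq> T" by (auto simp: T_def)
      then show "E \<union> (I 0 4 \<union> I 2 4 - {p 0, p 2}) \<subseteq> inside J \<or> E \<union> (I 0 4 \<union> I 2 4 - {p 0, p 2}) \<subseteq> outside J"
        using * by blast
    qed
  qed
  have 2: "\<not> (D \<union> T \<subseteq> inside J \<or> D \<union> T \<subseteq> outside J)"
  proof
    define S where "S = (I 1 4 - {p 1}) \<union> (I 3 4 - {p 3})"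
    assume *: "D \<union> T \<subseteq> inside J \<or> D \<union> T \<subseteq> outside J"
    have S: "connected S" "S \<noteq> {}"
      unfolding S_def using pts on conn(1)[of 1 4] conn(1)[of 3 4] by (auto intro!: connected_Un_at[of _ _ "p 4"])
    have clS: "p 1 \<in> closure S" "p 3 \<in> closure S"
      using arc_image_minus_pathstart(3)[of "h 1 4"] arc_image_minus_pathstart(3)[of "h 3 4"] h[of 1 4] h[of 3 4]
      by (simp_all add: S_def I_def closure_Un)
    show False
    proof (rule cross[OF conn(5,4)[of 0 2] chord02 S _ clS])
      show "S \<inter> I 0 2 = {}" using Iint[of 1 4 0 2] Iint[of 3 4 0 2] by (auto simp: S_def)
      show "S \<union> (I 0 2 - {p 0, p 2}) \<subseteq> inside J \<or> S \<union> (I 0 2 - {p 0, p 2}) \<subseteq> outside J"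
        using * unfolding S_def D_def T_def by blast
    qed auto
  qed
  have 3: "\<not> (E \<union> D \<subseteq> inside J \<or> E \<union> D \<subseteq> outside J)"
  proof
    assume *: "E \<union> D \<subseteq> inside J \<or> E \<union> D \<subseteq> outside J"
    show False
    proof (rule cross[OF conn(5,4)[of 0 2] chord02 E _ clE])
      show "E \<inter> I 0 2 = {}" using Iint[of 1 3 0 2] by (auto simp: E_def)
      show "E \<union> (I 0 2 - {p 0, p 2}) \<subseteq> inside J \<or> E \<union> (I 0 2 - {p 0, p 2}) \<subseteq> outside J"
        using * unfolding D_def by blast
    qed auto
  qed
  show False using 1 2 3 sideT sideD sideE by blast
qed

section \<open>Clique minors of dense graphs\<close>

definition connected_in :: "('a \<times> 'a) set \<Rightarrow> 'a set \<Rightarrow> bool" where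
  "connected_in E B \<longleftrightarrow> (\<forall>u\<in>B. \<forall>v\<in>B. (u, v) \<in> (E \<inter> B \<times> B)\<^sup>*)"

definition clique_minor :: "('a \<times> 'a) set \<Rightarrow> 'a set \<Rightarrow> nat \<Rightarrow> bool" where
  "clique_minor E V r \<longleftrightarrow> (\<exists>B::nat \<Rightarrow> 'a set.
     (\<forall>i<r. B i \<noteq> {} \<and> B i \<subseteq> V \<and> connected_in E (B i)) \<and>
     (\<forall>i<r. \<forall>j<r. i \<noteq> j \<longrightarrow> B i \<inter> B j = {} \<and> (\<exists>u\<in>B i. \<exists>v\<in>B j. (u, v) \<in> E)))"

lemma connected_in_mono:
  assumes "connected_in E B" "E \<subseteq> E'"
  shows "connected_in E' B"
proof -
  have "(E \<inter> B \<times> B)\<^sup>* \<subseteq> (E' \<inter> B \<times> B)\<^sup>*" using assms(2) by (intro rtrancl_mono) auto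
  then show ?thesis using assms(1) unfolding connected_in_def by blast
qed

lemma connected_in_singleton: "connected_in E {u}"
  by (simp add: connected_in_def)

lemma connected_in_edge: "(u, v) \<in> E \<Longrightarrow> (v, u) \<in> E \<Longrightarrow> connected_in E {u, v}"
  by (auto simp: connected_in_def)

text \<open>An arc of \<open>E'\<close> that is missing in \<open>E\<close> joins \<open>u\<close>
  to some vertex of \<open>W\<close>, a neighbour of \<open>v\<close>. Adding \<open>v\<close> to
  the branch set that contains \<open>u\<close> lets this arc be replaced by a detour over
  \<open>v\<close>.\<close>

lemma clique_minor_contract:
  assumes symE: "sym E" and uv: "(u, v) \<in> E" and u: "u \<in> V" "v \<in> V" "u \<noteq> v"
    and W: "W \<subseteq> E `` {v} - {u}"
    and E': "E' = (E \<inter> (V - {v}) \<times> (V - {v})) \<union> ({u} \<times> W) \<union> (W \<times> {u})"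
    and minor: "clique_minor E' (V - {v}) r"
  shows "clique_minor E V r"
proof -
  obtain B where B: "\<forall>i<r. B i \<noteq> {} \<and> B i \<subseteq> V - {v} \<and> connected_in E' (B i)"
    "\<forall>i<r. \<forall>j<r. i \<noteq> j \<longrightarrow> B i \<inter> B j = {} \<and> (\<exists>u\<in>B i. \<exists>v\<in>B j. (u, v) \<in> E')"
    using minor unfolding clique_minor_def by blast
  define L where "L X = (if u \<in> X then insert v X else X)" for X
  have vu: "(v, u) \<in> E" using symE uv by (auto dest: symD)
  have vw: "(v, w) \<in> E" "(w, v) \<in> E" if "w \<in> W" for w
    using W that symE by (auto dest: symD)
  have conn: "connected_in E (L X)" if X: "connected_in E' X" for X
  proof -
    let ?R = "(E \<inter> L X \<times> L X)\<^sup>*"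
    have XL: "X \<subseteq> L X" by (auto simp: L_def)
    have step: "(x, y) \<in> ?R" if "(x, y) \<in> E' \<inter> X \<times> X" for x y
    proof (cases "(x, y) \<in> E")
      case True
      then show ?thesis using that XL by (intro r_into_rtrancl) auto
    next
      case False
      then have "x = u \<and> y \<in> W \<or> y = u \<and> x \<in> W" using that E' by auto
      then have "u \<in> X" "(x, v) \<in> E" "(v, y) \<in> E" using that uv vu vw by auto
      moreover from this have "v \<in> L X" by (simp add: L_def)
      ultimately have "(x, v) \<in> ?R" "(v, y) \<in> ?R" using that XL by (intro r_into_rtrancl; auto)+
      then show ?thesis by (rule rtrancl_trans)
    qed
    have "(E' \<inter> X \<times> X)\<^sup>* \<subseteq> ?R"
      by (metis (no_types, lifting) rtrancl_subset_rtrancl step subrelI)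
    then have *: "(x, y) \<in> ?R" if "x \<in> X" "y \<in> X" for x y
      using X that unfolding connected_in_def by blast
    show ?thesis
    proof (cases "u \<in> X")
      case True
      have "(u, v) \<in> ?R" "(v, u) \<in> ?R" using True uv vu by (auto simp: L_def intro!: r_into_rtrancl)
      then show ?thesis using * True unfolding connected_in_def
        by (smt (verit, best) L_def insertE rtrancl.rtrancl_refl rtrancl_trans)
    next
      case False
      then show ?thesis using * by (simp add: connected_in_def L_def)
    qed
  qed
  show ?thesis unfolding clique_minor_def
  proof (intro exI[of _ "\<lambda>i. L (B i)"] conjI allI impI)
    fix i assume i: "i < r"
    show "L (B i) \<noteq> {}" "L (B i) \<subseteq> V" using B(1) i u by (auto simp: L_def)
    show "connected_in E (L (B i))" using B(1) i by (intro conn) auto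
    fix j assume j: "j < r" "i \<noteq> j"
    have "v \<notin> B i" "v \<notin> B j" "B i \<inter> B j = {}" using B i j by auto
    then show "L (B i) \<inter> L (B j) = {}" by (auto simp: L_def)
    obtain x y where xy: "x \<in> B i" "y \<in> B j" "(x, y) \<in> E'" using B(2) i j by blast
    show "\<exists>x\<in>L (B i). \<exists>y\<in>L (B j). (x, y) \<in> E"
    proof (cases "(x, y) \<in> E")
      case True
      then show ?thesis using xy by (auto simp: L_def)
    next
      case False
      then have "x = u \<and> y \<in> W \<or> y = u \<and> x \<in> W" using xy(3) E' by auto
      then show ?thesis
      proof
        assume "x = u \<and> y \<in> W"
        then have "v \<in> L (B i)" "y \<in> L (B j)" "(v, y) \<in> E" using xy vw by (auto simp: L_def)
        then show ?thesis by blast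
      next
        assume "y = u \<and> x \<in> W"
        then have "v \<in> L (B j)" "x \<in> L (B i)" "(x, v) \<in> E" using xy vw by (auto simp: L_def)
        then show ?thesis by blast
      qed
    qed
  qed
qed

lemma card_arcs_eq_sum:
  assumes "finite V" "E \<subseteq> V \<times> V"
  shows "card E = (\<Sum>v\<in>V. card (E `` {v}))"
proof -
  have "card E = card (Sigma V (\<lambda>v. E `` {v}))"
    by (rule arg_cong[of _ _ card]) (use assms(2) in auto)
  moreover have "finite (E `` {v})" for v by (rule finite_subset[OF _ assms(1)]) (use assms(2) in auto)
  ultimately show ?thesis using card_SigmaI[OF assms(1), of "\<lambda>v. E `` {v}"] by simp
qed

text \<open>Mader's argument: contract edges as long as the density survives; if no edge can be contracted,
  every edge lies in so many triangles that the neighbourhood of a vertex has at least half the density.\<close>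

theorem dense_imp_clique_minor:
  assumes "finite V" "V \<noteq> {}" "E \<subseteq> V \<times> V" "sym E" "irrefl E" "2 ^ r * card V \<le> card E"
  shows "clique_minor E V (r + 2)"
  using assms
proof (induction r arbitrary: V E)
  case 0
  then have "card E \<noteq> 0" by auto
  then obtain u v where uv: "(u, v) \<in> E" by (metis card.empty ex_in_conv surj_pair)
  then have "(v, u) \<in> E" "u \<noteq> v" "u \<in> V" "v \<in> V" using 0 by (auto dest: symD simp: irrefl_def)
  with uv have "clique_minor E V 2" unfolding clique_minor_def
    by (intro exI[of _ "\<lambda>i. if i = 0 then {u} else {v}"]) (auto simp: connected_in_singleton less_2_cases_iff)
  then show ?case by (simp add: numeral_2_eq_2)
next
  case (Suc r)
  show ?case using Suc.prems
  proof (induction "card V" arbitrary: V E rule: less_induct)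
    case less
    note fin = \<open>finite V\<close> and EV = \<open>E \<subseteq> V \<times> V\<close> and symE = \<open>sym E\<close> and irr = \<open>irrefl E\<close>
    have finE: "finite E" using finite_subset[OF EV] fin by simp
    define N where "N v = E `` {v}" for v
    have N: "finite (N v)" "N v \<subseteq> V" "v \<notin> N v" for v
      using finE EV irr by (auto simp: N_def irrefl_def)
    have Nsym: "v \<in> N u \<longleftrightarrow> u \<in> N v" for u v using symE by (auto simp: N_def dest: symD)
    show ?case
    proof (cases "\<exists>u v. (u, v) \<in> E \<and> card (N u \<inter> N v) < 2 ^ r")
      case True
      then obtain u v where uv: "(u, v) \<in> E" "card (N u \<inter> N v) < 2 ^ r" by blast
      have u: "u \<in> V" "v \<in> V" "u \<noteq> v" using uv EV irr by (auto simp: irrefl_def)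
      define E0 where "E0 = E \<inter> (V - {v}) \<times> (V - {v})"
      \<comment> \<open>Only neighbours of \<open>v\<close> that \<open>u\<close> does not have yet
        are new to \<open>u\<close>. Fewer than \<open>2 ^ r\<close> common neighbours are merged
        and \<open>u\<close> itself is dropped from \<open>N v\<close>, so at most
        \<open>2 ^ Suc r\<close> arcs disappear: exactly the share of the one vertex
        removed.\<close>
      define W where "W = N v - {u} - N u"
      define E' where "E' = E0 \<union> ({u} \<times> W) \<union> (W \<times> {u})"
      have WV: "W \<subseteq> V - {v}" "u \<notin> W" "finite W" using N by (auto simp: W_def)
      have E'sub: "E' \<subseteq> (V - {v}) \<times> (V - {v})" using WV u by (auto simp: E'_def E0_def)
      have "E = E0 \<union> ({v} \<times> N v) \<union> (N v \<times> {v})"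
        using EV symE by (auto simp: E0_def N_def dest: symD)
      also have "card \<dots> = card E0 + card (N v) + card (N v)"
        using N[of v] finE by (subst card_Un_disjoint; (subst card_Un_disjoint)?) (auto simp: E0_def)
      finally have cE: "card E = card E0 + 2 * card (N v)" by simp
      have cE': "card E' = card E0 + card W + card W"
        unfolding E'_def using WV finE u
        by (subst card_Un_disjoint; (subst card_Un_disjoint)?) (auto simp: E0_def W_def N_def dest: symD[OF symE])
      have "N v = insert u (W \<union> (N u \<inter> N v))" using uv Nsym by (auto simp: W_def N_def)
      then have "card (N v) \<le> Suc (card (W \<union> (N u \<inter> N v)))" by (metis card_insert_le_m1 card_insert_if le_SucI order_refl N(1) finite_insert)
      also have "card (W \<union> (N u \<inter> N v)) \<le> card W + card (N u \<inter> N v)" by (rule card_Un_le)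
      finally have "card (N v) \<le> card W + 2 ^ r" using uv(2) by linarith
      moreover have "card V = Suc (card (V - {v}))" using fin u by (metis card_Suc_Diff1)
      ultimately have dens: "2 ^ Suc r * card (V - {v}) \<le> card E'"
        using cE cE' \<open>2 ^ Suc r * card V \<le> card E\<close> by simp
      have "clique_minor E' (V - {v}) (Suc r + 2)"
      proof (rule less.hyps)
        show "card (V - {v}) < card V" using fin u(2) by (rule card_Diff1_less)
        show "V - {v} \<noteq> {}" using u by auto
        show "sym E'" using symE by (auto simp: E'_def E0_def sym_def)
        show "irrefl E'" using irr WV by (auto simp: E'_def E0_def irrefl_def)
      qed (use fin E'sub dens in auto)
      moreover have "W \<subseteq> E `` {v} - {u}" by (auto simp: W_def N_def)
      ultimately show ?thesis
        using clique_minor_contract[OF symE uv(1) u] E'_def E0_def by blast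
    next
      case False
      then have tri: "2 ^ r \<le> card (N u \<inter> N v)" if "v \<in> N u" for u v
        using that by (auto simp: N_def not_less)
      have "card E \<noteq> 0" using less.prems by auto
      then obtain u v where uv: "(u, v) \<in> E" by (metis card.empty ex_in_conv surj_pair)
      \<comment> \<open>Every edge at \<open>u\<close> lies in at least \<open>2 ^ r\<close>
        triangles, so the graph induced on \<open>N u\<close> meets the density hypothesis for
        \<open>r\<close>. Its \<open>r + 2\<close> branch sets, all adjacent to \<open>u\<close>,
        and the set \<open>{u}\<close> are the required \<open>r + 3\<close>.\<close>
      define M where "M = E \<inter> N u \<times> N u"
      have "(\<Sum>w\<in>N u. 2 ^ r) \<le> (\<Sum>w\<in>N u. card (M `` {w}))"
      proof (rule sum_mono)
        fix w assume w: "w \<in> N u"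
        then have "M `` {w} = N u \<inter> N w" by (auto simp: M_def N_def)
        then show "2 ^ r \<le> card (M `` {w})" using tri[OF w] by simp
      qed
      then have "2 ^ r * card (N u) \<le> card M"
        using card_arcs_eq_sum[of "N u" M] N(1) by (simp add: M_def mult.commute)
      moreover have "sym M" "irrefl M" using symE irr by (auto simp: M_def sym_def irrefl_def)
      moreover have "N u \<noteq> {}" using uv by (auto simp: N_def)
      moreover have "M \<subseteq> N u \<times> N u" by (simp add: M_def)
      ultimately have "clique_minor M (N u) (r + 2)"
        using Suc.IH[of "N u" M] N(1)[of u] by simp
      then obtain B where B: "\<forall>i<r+2. B i \<noteq> {} \<and> B i \<subseteq> N u \<and> connected_in M (B i)"
        "\<forall>i<r+2. \<forall>j<r+2. i \<noteq> j \<longrightarrow> B i \<inter> B j = {} \<and> (\<exists>x\<in>B i. \<exists>y\<in>B j. (x, y) \<in> M)"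
        unfolding clique_minor_def by blast
      define C where "C i = (if i < r + 2 then B i else {u})" for i
      have adj: "(\<exists>x\<in>B i. (x, u) \<in> E \<and> (u, x) \<in> E)" if "i < r + 2" for i
        using B(1) that symE by (fastforce simp: N_def dest: symD)
      have "clique_minor E V (Suc r + 2)"
        unfolding clique_minor_def
      proof (intro exI[of _ C] conjI allI impI)
        fix i assume i: "i < Suc r + 2"
        have "u \<in> V" using uv EV by auto
        show "C i \<noteq> {}" "C i \<subseteq> V" using B(1) N(2)[of u] \<open>u \<in> V\<close> by (auto simp: C_def)
        show "connected_in E (C i)"
          using B(1) connected_in_mono[of M _ E] by (auto simp: C_def connected_in_singleton M_def)
        fix j assume j: "j < Suc r + 2" "i \<noteq> j"
        have "u \<notin> B k" if "k < r + 2" for k using B(1) that N(3)[of u] by auto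
        then show "C i \<inter> C j = {}" using B(2) i j by (auto simp: C_def)
        show "\<exists>x\<in>C i. \<exists>y\<in>C j. (x, y) \<in> E"
        proof (cases "i < r + 2 \<and> j < r + 2")
          case True
          then obtain x y where "x \<in> B i" "y \<in> B j" "(x, y) \<in> M" using B(2) j(2) by blast
          then show ?thesis using True by (auto simp: C_def M_def)
        next
          case False
          then consider "i < r + 2" "C j = {u}" | "j < r + 2" "C i = {u}"
            using i j by (cases "i < r + 2") (auto simp: C_def)
          then show ?thesis
          proof cases
            case 1
            then show ?thesis using adj[of i] by (auto simp: C_def)
          next
            case 2
            then show ?thesis using adj[of j] by (auto simp: C_def)
          qed
        qed
      qed
      then show ?thesis .
    qed
  qed
qed

section \<open>Plane graphs\<close>

lemma pair_graph_iff:
  "pair_graph G \<longleftrightarrow> finite (pverts G) \<and> parcs G \<subseteq> pverts G \<times> pverts G \<and> sym (parcs G) \<and> irrefl (parcs G)"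
    (is "_ \<longleftrightarrow> ?R")
proof
  assume "pair_graph G"
  then interpret pair_graph G .
  have "sym (parcs G)"
    using sym_arcs by (simp add: symmetric_def arcs_ends_def arc_to_ends_def)
  moreover have "irrefl (parcs G)" using pair_no_loops[of "(a, a)" for a] by (auto simp: irrefl_def)
  ultimately show ?R using pair_finite_verts in_arcsD1 in_arcsD2 by auto
next
  assume ?R
  then show "pair_graph G"
    by unfold_locales (auto simp: symmetric_def arcs_ends_def arc_to_ends_def irrefl_def intro: finite_subset)
qed

text \<open>The part of the plane covered by the drawing of the subgraph induced by
  \<open>B\<close>. Such point sets hide the parametrisation and the direction of the edge
  curves.\<close>

definition region :: "'a pair_pre_digraph \<Rightarrow> ('a \<Rightarrow> complex) \<Rightarrow> ('a set \<Rightarrow> real \<Rightarrow> complex) \<Rightarrow> 'a set \<Rightarrow> complex set" where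
  "region G p \<gamma> B = p ` B \<union> (\<Union>(u, v)\<in>parcs G \<inter> B \<times> B. path_image (\<gamma> {u, v}))"

locale plane_graph =
  fixes G :: "'a pair_pre_digraph" and p :: "'a \<Rightarrow> complex" and \<gamma> :: "'a set \<Rightarrow> real \<Rightarrow> complex"
  assumes pair_graph: "pair_graph G" and drawing: "plane_drawing G p \<gamma>"
begin

abbreviation "V \<equiv> pverts G"
abbreviation "E \<equiv> parcs G"
abbreviation "R \<equiv> region G p \<gamma>"

lemma finV: "finite V" and EV: "E \<subseteq> V \<times> V" and symE: "sym E" and irreflE: "irrefl E"
  using pair_graph by (simp_all add: pair_graph_iff)

lemma inj_p: "inj_on p V"
  using drawing by (simp add: plane_drawing_def)

lemma edge:
  assumes "(u, v) \<in> E"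
  shows "arc (\<gamma> {u, v})" "{pathstart (\<gamma> {u, v}), pathfinish (\<gamma> {u, v})} = {p u, p v}"
    "path_image (\<gamma> {u, v}) \<inter> p ` V = {p u, p v}"
proof -
  have "\<forall>(u, v)\<in>E. arc (\<gamma> {u, v}) \<and> {pathstart (\<gamma> {u, v}), pathfinish (\<gamma> {u, v})} = {p u, p v} \<and>
      path_image (\<gamma> {u, v}) \<inter> p ` V = {p u, p v}"
    by (rule drawing[unfolded plane_drawing_def, THEN conjunct2, THEN conjunct1])
  from bspec[OF this assms] show "arc (\<gamma> {u, v})" "{pathstart (\<gamma> {u, v}), pathfinish (\<gamma> {u, v})} = {p u, p v}"
    "path_image (\<gamma> {u, v}) \<inter> p ` V = {p u, p v}" by simp_all
qed

lemma edge_inter: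
  assumes "(u, v) \<in> E" "(x, y) \<in> E" "{u, v} \<noteq> {x, y}"
  shows "path_image (\<gamma> {u, v}) \<inter> path_image (\<gamma> {x, y}) \<subseteq> p ` V"
proof -
  have "\<forall>(u, v)\<in>E. \<forall>(x, y)\<in>E. {u, v} \<noteq> {x, y} \<longrightarrow>
      path_image (\<gamma> {u, v}) \<inter> path_image (\<gamma> {x, y}) \<subseteq> p ` V"
    by (rule drawing[unfolded plane_drawing_def, THEN conjunct2, THEN conjunct2])
  from bspec[OF this assms(1), simplified, THEN bspec[OF _ assms(2)]] show ?thesis using assms(3) by simp
qed

text \<open>A point that is not a vertex lies on at most one edge curve. If it belongs to both
  regions, that edge has both ends in \<open>B \<inter> B'\<close>, which \<open>no\<close>
  forbids.\<close>

lemma region_inter: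
  assumes B: "B \<subseteq> V" "B' \<subseteq> V" and no: "E \<inter> (B \<inter> B') \<times> (B \<inter> B') = {}"
  shows "R B \<inter> R B' \<subseteq> p ` (B \<inter> B')"
proof
  fix z assume z: "z \<in> R B \<inter> R B'"
  have *: "z \<in> p ` X" if zX: "z \<in> R X" "X \<subseteq> V" "z \<in> p ` V" for X
  proof (cases "z \<in> p ` X")
    case False
    then obtain u v where uv: "(u, v) \<in> E" "u \<in> X" "v \<in> X" "z \<in> path_image (\<gamma> {u, v})"
      using zX(1) by (auto simp: region_def)
    then have "z \<in> {p u, p v}" using edge(3)[OF uv(1)] zX(3) by blast
    then show ?thesis using uv by auto
  qed
  have "z \<in> p ` V"
  proof (rule ccontr)
    assume "z \<notin> p ` V"
    then obtain u v x y where uv: "(u, v) \<in> E" "u \<in> B" "v \<in> B" "z \<in> path_image (\<gamma> {u, v})"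
      and xy: "(x, y) \<in> E" "x \<in> B'" "y \<in> B'" "z \<in> path_image (\<gamma> {x, y})"
      using z B by (auto simp: region_def)
    have "{u, v} = {x, y}" using edge_inter[OF uv(1) xy(1)] uv(4) xy(4) \<open>z \<notin> p ` V\<close> by blast
    then have "(u, v) \<in> E \<inter> (B \<inter> B') \<times> (B \<inter> B')" using uv xy by (auto simp: doubleton_eq_iff)
    then show False using no by simp
  qed
  then have "z \<in> p ` B" "z \<in> p ` B'" using * z B by auto
  then show "z \<in> p ` (B \<inter> B')" using inj_on_image_Int[OF inj_p B] by auto
qed

lemma region_inter_single:
  assumes "B \<subseteq> V" "B' \<subseteq> V" "B \<inter> B' \<subseteq> {x}"
  shows "R B \<inter> R B' \<subseteq> p ` (B \<inter> B')"
proof (rule region_inter[OF assms(1,2)])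
  have "(y, z) \<notin> E" if "y \<in> B \<inter> B'" "z \<in> B \<inter> B'" for y z
  proof -
    have "y = x" "z = x" using that assms(3) by auto
    then show ?thesis using irreflE by (simp add: irrefl_def)
  qed
  then show "E \<inter> (B \<inter> B') \<times> (B \<inter> B') = {}" by auto
qed

lemma path_connected_region:
  assumes B: "B \<subseteq> V" and conn: "connected_in E B"
  shows "path_connected (R B)"
proof -
  have edge_comp: "path_component (R B) x (p u) \<and> path_component (R B) x (p v)"
    if "(u, v) \<in> E" "u \<in> B" "v \<in> B" "x \<in> path_image (\<gamma> {u, v})" for u v x
  proof -
    have sub: "path_image (\<gamma> {u, v}) \<subseteq> R B" using that by (auto simp: region_def)
    have pc: "path_connected (path_image (\<gamma> {u, v}))"
      using edge(1)[OF that(1)] by (simp add: arc_imp_path path_connected_path_image)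
    have "p u \<in> path_image (\<gamma> {u, v})" "p v \<in> path_image (\<gamma> {u, v})" using edge(3)[OF that(1)] by auto
    then show ?thesis
      using pc sub that(4) by (meson path_component_of_subset path_connected_component)
  qed
  have vert: "path_component (R B) (p u) (p v)" if "u \<in> B" "v \<in> B" for u v
  proof -
    have "(u, v) \<in> (E \<inter> B \<times> B)\<^sup>*" using conn that by (simp add: connected_in_def)
    then show ?thesis
    proof (induction rule: rtrancl_induct)
      case base
      show ?case using that by (auto simp: region_def intro!: path_component_refl)
    next
      case (step y z)
      have "p y \<in> path_image (\<gamma> {y, z})" using step(2) edge(3)[of y z] by auto
      then have "path_component (R B) (p y) (p z)" using step(2) edge_comp[of y z "p y"] by auto
      with step(3) show ?case by (rule path_component_trans)
    qed
  qed
  have "\<exists>u\<in>B. path_component (R B) x (p u)" if "x \<in> R B" for x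
  proof (cases "x \<in> p ` B")
    case True
    then show ?thesis using that by (auto intro!: path_component_refl)
  next
    case False
    then show ?thesis using that edge_comp by (fastforce simp: region_def)
  qed
  then show ?thesis
    unfolding path_connected_component using vert by (meson path_component_sym path_component_trans)
qed

lemma region_arc:
  assumes "B \<subseteq> V" "connected_in E B" "u \<in> B" "v \<in> B" "u \<noteq> v"
  obtains g where "arc g" "pathstart g = p u" "pathfinish g = p v" "path_image g \<subseteq> R B"
proof -
  have "p u \<noteq> p v" using assms inj_p by (auto dest: inj_onD)
  moreover have "p u \<in> R B" "p v \<in> R B" using assms by (auto simp: region_def)
  ultimately show thesis
    using path_connected_region[OF assms(1,2)] that unfolding path_connected_arcwise by metis
qed

text \<open>The paths of the subdivision are given as connected vertex sets, and arcwise
  connectedness of their regions supplies the arcs. Two of the sets share at most one vertex, so no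
  edge curve belongs to two regions.\<close>

lemma no_K5_subdivision:
  fixes q :: "nat \<Rightarrow> 'a" and U :: "nat \<Rightarrow> nat \<Rightarrow> 'a set"
  assumes q: "inj_on q {..<5}"
    and U: "\<And>i j. i < j \<Longrightarrow> j < 5 \<Longrightarrow> U i j \<subseteq> V \<and> connected_in E (U i j) \<and> q i \<in> U i j \<and> q j \<in> U i j"
    and disj: "\<And>i j k l. i < j \<Longrightarrow> j < 5 \<Longrightarrow> k < l \<Longrightarrow> l < 5 \<Longrightarrow> (i, j) \<noteq> (k, l) \<Longrightarrow>
      U i j \<inter> U k l \<subseteq> q ` ({i, j} \<inter> {k, l})"
  shows False
proof -
  have "\<exists>g. arc g \<and> pathstart g = p (q i) \<and> pathfinish g = p (q j) \<and> path_image g \<subseteq> R (U i j)"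
    if "i < j" "j < 5" for i j
  proof -
    have "q i \<noteq> q j" using q that by (auto dest: inj_onD)
    show ?thesis
    proof (rule region_arc[of "U i j" "q i" "q j"])
      fix g assume "arc g" "pathstart g = p (q i)" "pathfinish g = p (q j)" "path_image g \<subseteq> R (U i j)"
      then show ?thesis by blast
    qed (use U[OF that] \<open>q i \<noteq> q j\<close> in auto)
  qed
  then obtain h where h: "\<And>i j. i < j \<Longrightarrow> j < 5 \<Longrightarrow> arc (h i j) \<and> pathstart (h i j) = p (q i) \<and>
      pathfinish (h i j) = p (q j) \<and> path_image (h i j) \<subseteq> R (U i j)" by metis
  show False
  proof (rule K5_arcs_impossible[of h "\<lambda>i. p (q i)"])
    fix i j k l :: nat assume ij: "i < j" "j < 5" and kl: "k < l" "l < 5" and ne: "(i, j) \<noteq> (k, l)"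
    note d = disj[OF ij kl ne]
    have "i \<notin> {k, l} \<or> j \<notin> {k, l}" using ij(1) kl(1) ne by auto
    then have "{i, j} \<inter> {k, l} \<subseteq> {j} \<or> {i, j} \<inter> {k, l} \<subseteq> {i}" by auto
    then obtain m where m: "{i, j} \<inter> {k, l} \<subseteq> {m}" by blast
    have "U i j \<inter> U k l \<subseteq> {q m}" using d image_mono[OF m, of q] by simp
    then have "R (U i j) \<inter> R (U k l) \<subseteq> p ` (U i j \<inter> U k l)"
      using U[OF ij] U[OF kl] by (intro region_inter_single) auto
    also have "\<dots> \<subseteq> p ` q ` ({i, j} \<inter> {k, l})" using d by (rule image_mono)
    finally show "path_image (h i j) \<inter> path_image (h k l) \<subseteq> (\<lambda>i. p (q i)) ` ({i, j} \<inter> {k, l})"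
      using h[OF ij] h[OF kl] by (auto simp: image_image)
  qed (use h in auto)
qed

text \<open>A branch set may be left at different vertices towards different partners. It is
  therefore kept as a connected region, and one chosen edge per pair provides the connecting
  arc.\<close>

lemma no_K33_minor:
  fixes A B :: "nat \<Rightarrow> 'a set"
  assumes AV: "\<And>i. i < 3 \<Longrightarrow> A i \<subseteq> V \<and> connected_in E (A i)" and BV: "\<And>i. i < 3 \<Longrightarrow> B i \<subseteq> V \<and> connected_in E (B i)"
    and AA: "\<And>i k. i < 3 \<Longrightarrow> k < 3 \<Longrightarrow> i \<noteq> k \<Longrightarrow> A i \<inter> A k = {}"
    and BB: "\<And>i k. i < 3 \<Longrightarrow> k < 3 \<Longrightarrow> i \<noteq> k \<Longrightarrow> B i \<inter> B k = {}"
    and AB: "\<And>i k. i < 3 \<Longrightarrow> k < 3 \<Longrightarrow> A i \<inter> B k = {}"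
    and adj: "\<And>i j. i < 3 \<Longrightarrow> j < 3 \<Longrightarrow> \<exists>u\<in>A i. \<exists>v\<in>B j. (u, v) \<in> E"
  shows False
proof -
  have "\<exists>u v. u \<in> A i \<and> v \<in> B j \<and> (u, v) \<in> E" if "i < 3" "j < 3" for i j
    using adj[OF that] by blast
  then obtain u v where uv: "\<And>i j. i < 3 \<Longrightarrow> j < 3 \<Longrightarrow> u i j \<in> A i \<and> v i j \<in> B j \<and> (u i j, v i j) \<in> E"
    by metis
  define e where "e i j = {u i j, v i j}" for i j
  have e: "e i j \<subseteq> V" "connected_in E (e i j)" if "i < 3" "j < 3" for i j
    using uv[OF that] EV symE connected_in_edge[of "u i j" "v i j" E] by (auto simp: e_def dest: symD)
  have "\<exists>g. arc g \<and> pathstart g = p (u i j) \<and> pathfinish g = p (v i j) \<and> path_image g \<subseteq> R (e i j)"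
    if "i < 3" "j < 3" for i j
  proof -
    have "u i j \<noteq> v i j" using uv[OF that] irreflE by (auto simp: irrefl_def)
    show ?thesis
    proof (rule region_arc[of "e i j" "u i j" "v i j"])
      fix g assume "arc g" "pathstart g = p (u i j)" "pathfinish g = p (v i j)" "path_image g \<subseteq> R (e i j)"
      then show ?thesis by blast
    qed (use e[OF that] \<open>u i j \<noteq> v i j\<close> in \<open>auto simp: e_def\<close>)
  qed
  then obtain g where g: "\<And>i j. i < 3 \<Longrightarrow> j < 3 \<Longrightarrow> arc (g i j) \<and> pathstart (g i j) = p (u i j) \<and>
      pathfinish (g i j) = p (v i j) \<and> path_image (g i j) \<subseteq> R (e i j)" by metis
  have disj: "R X \<inter> R Y = {}" if "X \<subseteq> V" "Y \<subseteq> V" "X \<inter> Y = {}" for X Y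
    using region_inter[of X Y] that by auto
  have pR: "p x \<in> R X" if "x \<in> X" for x X using that by (auto simp: region_def)
  have eA: "R (e i j) \<inter> R (A k) \<subseteq> {p (u i j)}" if "i < 3" "j < 3" "k < 3" for i j k
  proof -
    have "e i j \<inter> A k \<subseteq> {u i j}" using uv[OF that(1,2)] AB[OF that(3,2)] by (auto simp: e_def)
    then show ?thesis
      using region_inter_single[of "e i j" "A k" "u i j"] e(1)[OF that(1,2)] AV[OF that(3)] by auto
  qed
  have eB: "R (e i j) \<inter> R (B k) \<subseteq> {p (v i j)}" if "i < 3" "j < 3" "k < 3" for i j k
  proof -
    have "e i j \<inter> B k \<subseteq> {v i j}" using uv[OF that(1,2)] AB[OF that(1,3)] by (auto simp: e_def)
    then show ?thesis
      using region_inter_single[of "e i j" "B k" "v i j"] e(1)[OF that(1,2)] BV[OF that(3)] by auto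
  qed
  have ee: "R (e i j) \<inter> R (e k l) \<subseteq> (\<Union>k<3. R (A k) \<union> R (B k))"
    if ij: "i < 3" "j < 3" and kl: "k < 3" "l < 3" and ne: "(i, j) \<noteq> (k, l)" for i j k l
  proof -
    \<comment> \<open>Edges chosen for different pairs have different ends on a side where the pairs
      differ. So they share at most one vertex, and it lies in a branch set.\<close>
    have "u i j \<notin> e k l \<or> v i j \<notin> e k l"
    proof (cases "i = k")
      case True
      have "v i j \<in> B j" "v k l \<in> B l" "u k l \<in> A k" using uv[OF ij] uv[OF kl] by auto
      then have "v i j \<noteq> u k l" "v i j \<noteq> v k l" using BB[OF ij(2) kl(2)] AB[OF kl(1) ij(2)] True ne by auto
      then show ?thesis by (simp add: e_def)
    next
      case False
      have "u i j \<in> A i" "v k l \<in> B l" "u k l \<in> A k" using uv[OF ij] uv[OF kl] by auto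
      then have "u i j \<noteq> u k l" "u i j \<noteq> v k l" using AA[OF ij(1) kl(1) False] AB[OF ij(1) kl(2)] by auto
      then show ?thesis by (simp add: e_def)
    qed
    then have "e i j \<inter> e k l \<subseteq> {u i j} \<or> e i j \<inter> e k l \<subseteq> {v i j}" by (auto simp: e_def)
    then have "R (e i j) \<inter> R (e k l) \<subseteq> p ` (e i j \<inter> e k l)"
      using region_inter_single e(1)[OF ij] e(1)[OF kl] by blast
    also have "\<dots> \<subseteq> {p (u i j), p (v i j)}" by (auto simp: e_def)
    also have "\<dots> \<subseteq> (\<Union>k<3. R (A k) \<union> R (B k))" using uv[OF ij] pR ij by auto
    finally show ?thesis .
  qed
  show False
  proof (rule K33_fat_impossible[of "\<lambda>i. R (A i)" "\<lambda>i. R (B i)" g])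
    fix i j :: nat assume ij: "i < 3" "j < 3"
    show "arc (g i j) \<and> pathstart (g i j) \<in> R (A i) \<and> pathfinish (g i j) \<in> R (B j)"
      using g[OF ij] uv[OF ij] pR by auto
    show "path_image (g i j) \<inter> (\<Union>k<3. R (A k) \<union> R (B k)) \<subseteq> {pathstart (g i j), pathfinish (g i j)}"
    proof
      fix z assume z: "z \<in> path_image (g i j) \<inter> (\<Union>k<3. R (A k) \<union> R (B k))"
      then obtain k where k: "k < 3" "z \<in> R (A k) \<or> z \<in> R (B k)" by auto
      have "z \<in> R (e i j)" using z g[OF ij] by auto
      then show "z \<in> {pathstart (g i j), pathfinish (g i j)}"
        using k eA[OF ij k(1)] eB[OF ij k(1)] g[OF ij] by auto
    qed
    fix k l :: nat assume kl: "k < 3" "l < 3" "(i, j) \<noteq> (k, l)"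
    show "path_image (g i j) \<inter> path_image (g k l) \<subseteq> (\<Union>k<3. R (A k) \<union> R (B k))"
      using ee[OF ij kl] g[OF ij] g[OF kl(1,2)] by (meson Int_mono order_trans)
  next
    fix i k :: nat assume ik: "i < 3" "k < 3"
    show "R (A i) \<inter> R (B k) = {}" using AV[OF ik(1)] BV[OF ik(2)] AB[OF ik] by (intro disj) auto
    assume "i \<noteq> k"
    then show "R (A i) \<inter> R (A k) = {}" "R (B i) \<inter> R (B k) = {}"
      using AV[OF ik(1)] AV[OF ik(2)] AA[OF ik] BV[OF ik(1)] BV[OF ik(2)] BB[OF ik] by (simp_all add: disj)
  qed (use AV BV in \<open>auto intro!: path_connected_region\<close>)
qed

text \<open>Density \<open>2 ^ 4\<close> yields six pairwise adjacent branch sets, and three of them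
  against the other three form a K_{3,3} minor. Every edge counts as two arcs, whence 16 instead of
  8.\<close>

lemma arcs_less:
  assumes "W \<subseteq> V" "W \<noteq> {}"
  shows "card (E \<inter> W \<times> W) < 16 * card W"
proof (rule ccontr)
  assume "\<not> ?thesis"
  then have *: "2 ^ 4 * card W \<le> card (E \<inter> W \<times> W)" by simp
  have "sym (E \<inter> W \<times> W)" "irrefl (E \<inter> W \<times> W)" using symE irreflE by (auto simp: sym_def irrefl_def)
  then have "clique_minor (E \<inter> W \<times> W) W (4 + 2)"
    using assms finV by (intro dense_imp_clique_minor *) (auto intro: finite_subset)
  then obtain B :: "nat \<Rightarrow> 'a set" where B: "\<forall>i<6. B i \<noteq> {} \<and> B i \<subseteq> W \<and> connected_in (E \<inter> W \<times> W) (B i)"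
    "\<forall>i<6. \<forall>j<6. i \<noteq> j \<longrightarrow> B i \<inter> B j = {} \<and> (\<exists>u\<in>B i. \<exists>v\<in>B j. (u, v) \<in> E \<inter> W \<times> W)"
    unfolding clique_minor_def by auto
  have conn: "connected_in E (B i)" if "i < 6" for i
    using B(1) that connected_in_mono[of "E \<inter> W \<times> W" "B i" E] by auto
  have BV: "B i \<subseteq> V" if "i < 6" for i using B(1) that assms(1) by blast
  have disj: "B i \<inter> B j = {}" if "i < 6" "j < 6" "i \<noteq> j" for i j using B(2) that by blast
  show False
  proof (rule no_K33_minor[of B "\<lambda>j. B (3 + j)"])
    fix i j :: nat assume "i < 3" "j < 3"
    then have "i < 6" "3 + j < 6" "i \<noteq> 3 + j" by auto
    then show "\<exists>u\<in>B i. \<exists>v\<in>B (3 + j). (u, v) \<in> E" using B(2) by blast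
  qed (simp_all add: disj conn BV)
qed

lemma no_K33:
  fixes a b :: "nat \<Rightarrow> 'a"
  assumes "inj_on a {..<3}" "inj_on b {..<3}" "\<And>i j. i < 3 \<Longrightarrow> j < 3 \<Longrightarrow> (a i, b j) \<in> E"
  shows False
proof (rule no_K33_minor[of "\<lambda>i. {a i}" "\<lambda>i. {b i}"])
  fix i k :: nat assume ik: "i < 3" "k < 3"
  show "{a i} \<inter> {b k} = {}" using assms(3)[OF ik] irreflE by (auto simp: irrefl_def)
next
  fix i :: nat assume "i < 3"
  then show "{a i} \<subseteq> V \<and> connected_in E {a i}" "{b i} \<subseteq> V \<and> connected_in E {b i}"
    using assms(3)[of i 0] assms(3)[of 0 i] EV by (auto simp: connected_in_singleton)
qed (use assms in \<open>auto simp: inj_on_def\<close>)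

end

section \<open>A drawing of the join of an edge and a path\<close>

text \<open>The straight-line drawing of \<open>K\<^sub>2 + P\<close>, where \<open>0\<close> and \<open>1\<close> are the vertices of \<open>K\<^sub>2\<close>.\<close>

definition fan_point :: "nat \<Rightarrow> complex" where
  "fan_point k = (if k = 0 then \<i> else if k = 1 then - \<i> else of_real (real k - 1))"

definition fan_arcs :: "nat \<Rightarrow> (nat \<times> nat) set" where
  "fan_arcs n = {(u, v). u < n \<and> v < n \<and> u \<noteq> v \<and> (u < 2 \<or> v < 2 \<or> u = Suc v \<or> v = Suc u)}"

text \<open>A superset of the segment from \<open>fan_point u\<close> to \<open>fan_point v\<close>
  for \<open>u < v\<close>, with \<open>v = Suc u\<close> in the last case. The path vertices sit at
  1, 2, 3, ... on the real axis, so the segment between the poles can be relaxed to the whole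
  imaginary axis without creating intersections.\<close>

definition fan_segment :: "nat \<Rightarrow> nat \<Rightarrow> complex \<Rightarrow> bool" where
  "fan_segment u v z \<longleftrightarrow>
     (if u = 0 \<and> v = 1 then Re z = 0
      else if u = 0 then 0 \<le> Im z \<and> Im z \<le> 1 \<and> Re z = (1 - Im z) * (real v - 1)
      else if u = 1 then -1 \<le> Im z \<and> Im z \<le> 0 \<and> Re z = (1 + Im z) * (real v - 1)
      else Im z = 0 \<and> real u - 1 \<le> Re z \<and> Re z \<le> real u)"

lemma inj_fan_point: "inj fan_point"
  by (auto simp: inj_def fan_point_def complex_eq_iff split: if_splits)

lemma fan_segmentI:
  assumes "u < v" "u < 2 \<or> v = Suc u" "z \<in> closed_segment (fan_point u) (fan_point v)"
  shows "fan_segment u v z"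
proof -
  obtain t where t: "0 \<le> t" "t \<le> 1" "z = (1 - t) *\<^sub>R fan_point u + t *\<^sub>R fan_point v"
    using assms(3) by (auto simp: in_segment)
  consider "u = 0" "v = 1" | "u = 0" "v \<ge> 2" | "u = 1" "v \<ge> 2" | "u \<ge> 2" "v = Suc u"
    using assms(1,2) by linarith
  then show ?thesis
  proof cases
    case 4
    then have "Re z = real u - 1 + t" "Im z = 0"
      using arg_cong[OF t(3), of Re] arg_cong[OF t(3), of Im] by (auto simp: fan_point_def algebra_simps)
    then show ?thesis using 4 t by (simp add: fan_segment_def)
  qed (use t in \<open>auto simp: fan_segment_def fan_point_def\<close>)
qed

lemma fan_segment_vertex:
  assumes "u < v" "u < 2 \<or> v = Suc u" "fan_segment u v (fan_point w)"
  shows "w = u \<or> w = v"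
proof -
  consider "u = 0" "v = 1" | "u = 0" "v \<ge> 2" | "u = 1" "v \<ge> 2" | "u \<ge> 2" "v = Suc u"
    using assms(1,2) by linarith
  then show ?thesis
    by cases (use assms(3) in \<open>auto simp: fan_segment_def fan_point_def split: if_splits\<close>)
qed

lemma fan_segments_meet:
  assumes "u < v" "u < 2 \<or> v = Suc u" "x < y" "x < 2 \<or> y = Suc x" "(u, v) \<noteq> (x, y)"
    and z: "fan_segment u v z" "fan_segment x y z"
  shows "z \<in> fan_point ` {u, v}"
proof -
  have top: "z = fan_point 0" if "fan_segment 0 v z" "fan_segment 0 y z" "v \<noteq> y" "v > 0" "y > 0" for v y
  proof -
    have "Re z = (1 - Im z) * (real v - 1)" "Re z = (1 - Im z) * (real y - 1)"
      using that by (auto simp: fan_segment_def split: if_splits)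
    then have "(1 - Im z) * (real v - real y) = 0" by (simp add: algebra_simps)
    then have "Im z = 1" "Re z = 0" using that(3) \<open>Re z = (1 - Im z) * (real v - 1)\<close> by auto
    then show ?thesis by (simp add: fan_point_def complex_eq_iff)
  qed
  \<comment> \<open>The alternative \<open>fan_segment 0 1 z\<close> covers the edge between the
    poles. It does not mention \<open>y\<close>, which is then instantiated by a successor merely to
    satisfy the side conditions.\<close>
  have bot: "z = fan_point 1" if "fan_segment 1 v z" "fan_segment 1 y z \<or> fan_segment 0 1 z" "v \<noteq> y" "v > 1" "y > 1" for v y
  proof -
    have *: "Re z = (1 + Im z) * (real v - 1)" "Re z = (1 + Im z) * (real y - 1) \<or> Re z = 0"
      using that by (auto simp: fan_segment_def split: if_splits)
    have "(1 + Im z) * (real v - real y) = 0 \<or> (1 + Im z) * (real v - 1) = 0"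
      using * by (auto simp: algebra_simps)
    then have "Im z = -1" "Re z = 0" using that(3,4) *(1) by auto
    then show ?thesis by (simp add: fan_point_def complex_eq_iff)
  qed
  have real: "z = fan_point k" if "Im z = 0" "Re z = real k - 1" "k \<ge> 2" for k
    using that by (simp add: fan_point_def complex_eq_iff)
  consider "u = 0" "v = 1" | "u = 0" "v \<ge> 2" | "u = 1" "v \<ge> 2" | "u \<ge> 2" "v = Suc u"
    using assms(1,2) by linarith
  then show ?thesis
  proof cases
    case 1
    consider "x = 0" "y \<ge> 2" | "x = 1" "y \<ge> 2" | "x \<ge> 2" "y = Suc x"
      using assms(3,4,5) 1 by force
    then show ?thesis
    proof cases
      case 1
      then show ?thesis using top[of 1 y] z \<open>u = 0\<close> \<open>v = 1\<close> by auto
    next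
      case 2
      then show ?thesis using bot[of y "Suc y"] z \<open>u = 0\<close> \<open>v = 1\<close> by auto
    qed (use z 1 in \<open>auto simp: fan_segment_def split: if_splits\<close>)
  next
    case 2
    consider "x = 0" | "x = 1" "y \<ge> 2" | "x \<ge> 2" "y = Suc x"
      using assms(3,4) by linarith
    then show ?thesis
    proof cases
      case 1
      then show ?thesis using top[of v y] z 2 assms(3,5) by auto
    next
      case a: 2
      then have "Im z = 0" "Re z = real v - 1" using z 2 by (auto simp: fan_segment_def split: if_splits)
      then show ?thesis using real 2 by auto
    next
      case 3
      then have "Im z = 0" "Re z = real v - 1" using z 2 by (auto simp: fan_segment_def split: if_splits)
      then show ?thesis using real 2 by auto
    qed
  next
    case 3
    consider "x = 0" "y = 1" | "x = 1" "y \<ge> 2" | "x = 0" "y \<ge> 2" | "x \<ge> 2" "y = Suc x"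
      using assms(3,4) by linarith
    then show ?thesis
    proof cases
      case 1
      then show ?thesis using bot[of v "Suc v"] z 3 by auto
    next
      case 2
      then show ?thesis using bot[of v y] z 3 assms(5) by auto
    next
      case a: 3
      then have "Im z = 0" "Re z = real v - 1" using z 3 by (auto simp: fan_segment_def split: if_splits)
      then show ?thesis using real 3 by auto
    next
      case 4
      then have "Im z = 0" "Re z = real v - 1" using z 3 by (auto simp: fan_segment_def split: if_splits)
      then show ?thesis using real 3 by auto
    qed
  next
    case 4
    have z4: "Im z = 0" "real u - 1 \<le> Re z" "Re z \<le> real u" using z(1) 4 by (auto simp: fan_segment_def split: if_splits)
    consider "x = 0" "y = 1" | "x < 2" "y \<ge> 2" | "x \<ge> 2" "y = Suc x"
      using assms(3,4) by linarith
    then show ?thesis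
    proof cases
      case 1
      then show ?thesis using z4 z(2) 4 by (auto simp: fan_segment_def split: if_splits)
    next
      case 2
      then have "Re z = real y - 1" using z(2) z4 by (auto simp: fan_segment_def split: if_splits)
      moreover from this have "y = u \<or> y = v" using z4 4 by linarith
      ultimately show ?thesis using real[of y] z4 2 by auto
    next
      case 3
      then have "real x - 1 \<le> Re z" "Re z \<le> real x" using z(2) by (auto simp: fan_segment_def split: if_splits)
      moreover have "x < u \<or> u < x" using 3 4 assms(5) by auto
      ultimately have "x = Suc u \<and> Re z = real (Suc u) - 1 \<or> u = Suc x \<and> Re z = real u - 1"
        using z4 by (elim disjE) (simp, linarith)+
      then show ?thesis using real[of u] real[of "Suc u"] z4 4 by auto
    qed
  qed
qed

lemma planar_fan:
  assumes "pverts H = {..<n}" "parcs H \<subseteq> fan_arcs n"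
  shows "planar H"
proof -
  \<comment> \<open>Curves are indexed by unordered pairs; \<open>Min\<close> and \<open>Max\<close>
    choose a direction that agrees with \<open>fan_segment\<close>.\<close>
  define \<gamma> where "\<gamma> S = linepath (fan_point (Min S)) (fan_point (Max S))" for S
  have ord: "\<exists>u v. {a, b} = {u, v} \<and> u < v \<and> (u < 2 \<or> v = Suc u) \<and> u < n \<and> v < n \<and>
      \<gamma> {a, b} = linepath (fan_point u) (fan_point v)" if "(a, b) \<in> parcs H" for a b
  proof -
    have "a < n" "b < n" "a \<noteq> b" "a < 2 \<or> b < 2 \<or> a = Suc b \<or> b = Suc a"
      using that assms(2) by (auto simp: fan_arcs_def)
    then show ?thesis
      by (intro exI[of _ "min a b"] exI[of _ "max a b"]) (auto simp: \<gamma>_def min_def max_def)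
  qed
  have "inj_on fan_point (pverts H)" using inj_fan_point by (rule inj_on_subset) auto
  moreover have "arc (\<gamma> {a, b}) \<and> {pathstart (\<gamma> {a, b}), pathfinish (\<gamma> {a, b})} = {fan_point a, fan_point b} \<and>
      path_image (\<gamma> {a, b}) \<inter> fan_point ` pverts H = {fan_point a, fan_point b}" if ab: "(a, b) \<in> parcs H" for a b
  proof (intro conjI)
    obtain u v where uv: "{a, b} = {u, v}" "u < v" "u < 2 \<or> v = Suc u" "u < n" "v < n"
        "\<gamma> {a, b} = linepath (fan_point u) (fan_point v)" using ord[OF ab] by blast
    have ne: "fan_point u \<noteq> fan_point v" using uv(2) inj_fan_point by (auto dest: injD)
    have pts: "{fan_point a, fan_point b} = {fan_point u, fan_point v}"
      using arg_cong[OF uv(1), of "image fan_point"] by simp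
    show "arc (\<gamma> {a, b})" "{pathstart (\<gamma> {a, b}), pathfinish (\<gamma> {a, b})} = {fan_point a, fan_point b}"
      unfolding uv(6) pts using ne by auto
    have "w = u \<or> w = v" if "fan_point w \<in> path_image (\<gamma> {a, b})" for w
      using fan_segment_vertex[OF uv(2,3) fan_segmentI[OF uv(2,3)]] that uv(6) by simp
    then show "path_image (\<gamma> {a, b}) \<inter> fan_point ` pverts H = {fan_point a, fan_point b}"
      unfolding pts using uv(4,5,6) assms(1) by auto
  qed
  moreover have "path_image (\<gamma> {a, b}) \<inter> path_image (\<gamma> {x, y}) \<subseteq> fan_point ` pverts H"
    if ab: "(a, b) \<in> parcs H" and xy: "(x, y) \<in> parcs H" and ne: "{a, b} \<noteq> {x, y}" for a b x y
  proof -
    obtain u v where uv: "{a, b} = {u, v}" "u < v" "u < 2 \<or> v = Suc u" "u < n" "v < n"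
        "\<gamma> {a, b} = linepath (fan_point u) (fan_point v)" using ord[OF ab] by blast
    obtain s t where st: "{x, y} = {s, t}" "s < t" "s < 2 \<or> t = Suc s" "s < n" "t < n"
        "\<gamma> {x, y} = linepath (fan_point s) (fan_point t)" using ord[OF xy] by blast
    have "(u, v) \<noteq> (s, t)" using ne uv(1) st(1) by auto
    then have "path_image (\<gamma> {a, b}) \<inter> path_image (\<gamma> {x, y}) \<subseteq> fan_point ` {u, v}"
      using fan_segments_meet[OF uv(2,3) st(2,3)] fan_segmentI[OF uv(2,3)] fan_segmentI[OF st(2,3)]
      unfolding uv(6) st(6) by auto
    then show "path_image (\<gamma> {a, b}) \<inter> path_image (\<gamma> {x, y}) \<subseteq> fan_point ` pverts H"
      using uv(4,5) assms(1) by auto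
  qed
  ultimately have "plane_drawing H fan_point \<gamma>" unfolding plane_drawing_def by blast
  then show ?thesis unfolding planar_def by blast
qed

section \<open>The spectral radius as a maximum of the Rayleigh quotient\<close>

definition adj :: "('a \<times> 'a) set \<Rightarrow> 'a \<Rightarrow> 'a \<Rightarrow> real" where
  "adj E u v = (if (u, v) \<in> E then 1 else 0)"

definition adj_form :: "('a \<times> 'a) set \<Rightarrow> 'a set \<Rightarrow> ('a \<Rightarrow> real) \<Rightarrow> real" where
  "adj_form E V y = (\<Sum>u\<in>V. \<Sum>v\<in>V. adj E u v * y u * y v)"

text \<open>Near zero a linear term dominates a quadratic one: at \<open>t = a / (2 * c)\<close> the
  right-hand side is at most half of the left-hand side. This is the first-order condition at a
  maximum of the Rayleigh quotient.\<close>

lemma quadratic_bound_imp_zero: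
  fixes a b :: real
  assumes "\<And>t. a * t \<le> b * t\<^sup>2"
  shows "a = 0"
proof (rule ccontr)
  assume "a \<noteq> 0"
  define c where "c = \<bar>b\<bar> + 1"
  have c: "c > 0" by (simp add: c_def)
  have "a * (a / (2 * c)) \<le> b * (a / (2 * c))\<^sup>2" by (rule assms)
  also have "\<dots> \<le> c * (a / (2 * c))\<^sup>2" by (intro mult_right_mono) (auto simp: c_def)
  also have "\<dots> = a * (a / (2 * c)) / 2" using c by (simp add: power2_eq_square field_simps)
  finally have "a * (a / (2 * c)) \<le> a * (a / (2 * c)) / 2" .
  moreover have "x \<le> 0" if "x \<le> x / 2" for x :: real using that by simp
  ultimately have "a * (a / (2 * c)) \<le> 0" by blast
  moreover have "a * (a / (2 * c)) > 0"
    using \<open>a \<noteq> 0\<close> by (auto simp: c_def zero_less_mult_iff divide_less_0_iff zero_less_divide_iff)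
  ultimately show False by linarith
qed

lemma adj_form_perturb:
  assumes "finite V" "v \<in> V" "sym E"
  shows "adj_form E V (\<lambda>w. y w + t * (if w = v then 1 else 0)) =
    adj_form E V y + 2 * t * (\<Sum>u\<in>V. adj E v u * y u) + t\<^sup>2 * adj E v v"
proof -
  let ?d = "\<lambda>w. if w = v then 1 else (0::real)"
  have sym: "adj E u v = adj E v u" for u using assms(3) by (auto simp: adj_def dest: symD)
  have "adj E a b * (y a + t * ?d a) * (y b + t * ?d b) = adj E a b * y a * y b +
      t * (?d a * (adj E v b * y b)) + t * (?d b * (adj E a v * y a)) + t\<^sup>2 * (?d a * (?d b * adj E v v))" for a b
    by (simp add: algebra_simps power2_eq_square)
  then have "adj_form E V (\<lambda>w. y w + t * ?d w) = adj_form E V y +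
      t * (\<Sum>a\<in>V. \<Sum>b\<in>V. ?d a * (adj E v b * y b)) + t * (\<Sum>a\<in>V. \<Sum>b\<in>V. ?d b * (adj E a v * y a)) +
      t\<^sup>2 * (\<Sum>a\<in>V. \<Sum>b\<in>V. ?d a * (?d b * adj E v v))"
    by (simp only: adj_form_def sum.distrib sum_distrib_left)
  also have "(\<Sum>a\<in>V. \<Sum>b\<in>V. ?d a * (adj E v b * y b)) = (\<Sum>b\<in>V. adj E v b * y b)"
    unfolding sum_distrib_left[symmetric]
    using assms by (simp add: if_distrib[of "\<lambda>x. x * _"] sum.delta cong: if_cong)
  also have "(\<Sum>a\<in>V. \<Sum>b\<in>V. ?d b * (adj E a v * y a)) = (\<Sum>a\<in>V. adj E v a * y a)"
    using assms sym by (simp add: if_distrib[of "\<lambda>x. x * _"] sum.delta cong: if_cong)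
  also have "(\<Sum>a\<in>V. \<Sum>b\<in>V. ?d a * (?d b * adj E v v)) = adj E v v"
    unfolding sum_distrib_left[symmetric]
    using assms by (simp add: if_distrib[of "\<lambda>x. x * _"] sum.delta cong: if_cong)
  finally show ?thesis by simp
qed

text \<open>A maximiser is a critical point: moving only the coordinate \<open>v\<close> by
  \<open>t\<close> turns the Rayleigh bound into a quadratic inequality in \<open>t\<close>, whose
  linear coefficient must vanish. It serves both to obtain a Perron vector and, at the very end, to
  show that this vector is an eigenvector of the comparison graph.\<close>

lemma rayleigh_equality_imp_eigenvector:
  assumes "finite V" "sym E" "\<And>z. adj_form E V z \<le> l * (\<Sum>v\<in>V. (z v)\<^sup>2)"
    and eq: "adj_form E V y = l * (\<Sum>v\<in>V. (y v)\<^sup>2)" and v: "v \<in> V"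
  shows "(\<Sum>u\<in>V. adj E v u * y u) = l * y v"
proof -
  let ?d = "\<lambda>w. if w = v then 1 else (0::real)"
  define s where "s = (\<Sum>u\<in>V. adj E v u * y u)"
  have sq: "(\<Sum>w\<in>V. (y w + t * ?d w)\<^sup>2) = (\<Sum>w\<in>V. (y w)\<^sup>2) + 2 * t * y v + t\<^sup>2" for t
  proof -
    have "(y w + t * ?d w)\<^sup>2 = (y w)\<^sup>2 + (if w = v then 2 * t * y v + t\<^sup>2 else 0)" for w
      by (auto simp: power2_sum power_mult_distrib)
    then show ?thesis using assms(1) v by (simp add: sum.distrib sum.delta)
  qed
  have "(2 * (s - l * y v)) * t \<le> (l - adj E v v) * t\<^sup>2" for t
    using assms(3)[of "\<lambda>w. y w + t * ?d w"] eq
    unfolding adj_form_perturb[OF assms(1) v assms(2)] sq s_def by (simp add: algebra_simps)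
  then have "2 * (s - l * y v) = 0" by (rule quadratic_bound_imp_zero)
  then show ?thesis by (simp add: s_def)
qed

lemma rayleigh_maximum_exists:
  assumes "finite V" "V \<noteq> {}"
  obtains l y where "(\<Sum>v\<in>V. (y v)\<^sup>2) = (1::real)" "adj_form E V y = l"
    "\<And>z. adj_form E V z \<le> l * (\<Sum>v\<in>V. (z v)\<^sup>2)"
proof -
  \<comment> \<open>The vectors are functions on the whole type, which may be infinite. Pinning them
    to 0 outside \<open>V\<close> makes the cube compact in the product topology.\<close>
  define K :: "('a \<Rightarrow> real) set" where "K = PiE UNIV (\<lambda>v. if v \<in> V then {-1..1} else {0})"
  define S where "S = K \<inter> {y. (\<Sum>v\<in>V. (y v)\<^sup>2) = 1}"
  have "compactin (product_topology (\<lambda>_. euclidean) UNIV) K"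
    unfolding K_def compactin_PiE by auto
  then have "compact K" by (simp add: euclidean_product_topology)
  have coord: "continuous_on A (\<lambda>y::'a \<Rightarrow> real. y v)" for A v
    using continuous_on_product_coordinates by (rule continuous_on_subset) auto
  have "closed {y::'a \<Rightarrow> real. (\<Sum>v\<in>V. (y v)\<^sup>2) = 1}"
    by (intro closed_Collect_eq continuous_intros coord)
  with \<open>compact K\<close> have "compact S" unfolding S_def by (rule compact_Int_closed)
  obtain v0 where v0: "v0 \<in> V" using assms by blast
  have "(\<lambda>v. if v = v0 then 1 else 0) \<in> S"
    using v0 assms(1) by (auto simp: S_def K_def if_distrib[of "\<lambda>x. x\<^sup>2"] sum.delta cong: if_cong)
  then have "S \<noteq> {}" by blast
  have "continuous_on S (adj_form E V)"
    unfolding adj_form_def by (intro continuous_intros coord)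
  then obtain y where y: "y \<in> S" "\<And>z. z \<in> S \<Longrightarrow> adj_form E V z \<le> adj_form E V y"
    using continuous_attains_sup[OF \<open>compact S\<close> \<open>S \<noteq> {}\<close>] by blast
  show thesis
  proof (rule that[of y "adj_form E V y"])
    show "(\<Sum>v\<in>V. (y v)\<^sup>2) = 1" using y(1) by (auto simp: S_def)
    fix z :: "'a \<Rightarrow> real"
    define N where "N = (\<Sum>v\<in>V. (z v)\<^sup>2)"
    have N0: "N \<ge> 0" by (simp add: N_def sum_nonneg)
    show "adj_form E V z \<le> adj_form E V y * N"
    proof (cases "N = 0")
      case True
      then have "z v = 0" if "v \<in> V" for v
        using that assms(1) by (simp add: N_def sum_nonneg_eq_0_iff)
      then show ?thesis using True by (simp add: adj_form_def)
    next
      case False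
      define w where "w v = (if v \<in> V then z v / sqrt N else 0)" for v
      have sq: "(w v)\<^sup>2 = (z v)\<^sup>2 / N" if "v \<in> V" for v
        using that N0 by (simp add: w_def power_divide)
      have "(\<Sum>v\<in>V. (w v)\<^sup>2) = (\<Sum>v\<in>V. (z v)\<^sup>2 / N)" using sq by (rule sum.cong[OF refl])
      also have "\<dots> = 1" using False by (simp add: N_def sum_divide_distrib[symmetric])
      finally have w1: "(\<Sum>v\<in>V. (w v)\<^sup>2) = 1" .
      have "\<bar>w v\<bar> \<le> 1" if "v \<in> V" for v
      proof -
        have "(w v)\<^sup>2 \<le> (\<Sum>v\<in>V. (w v)\<^sup>2)" using that assms(1) by (intro member_le_sum) auto
        then show ?thesis using w1 by (simp add: abs_square_le_1)
      qed
      moreover have "w v = 0" if "v \<notin> V" for v using that by (simp add: w_def)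
      ultimately have "w \<in> K" by (force simp: K_def abs_le_iff)
      then have "adj_form E V w \<le> adj_form E V y" using w1 by (intro y(2)) (simp add: S_def)
      moreover have "adj_form E V w = adj_form E V z / N"
      proof -
        have "adj E u v * w u * w v = adj E u v * z u * z v / N" if "u \<in> V" "v \<in> V" for u v
        proof -
          have "w u * w v = z u * z v / (sqrt N * sqrt N)" using that by (simp add: w_def)
          then show ?thesis using N0 by (simp add: mult.assoc)
        qed
        then show ?thesis unfolding adj_form_def sum_divide_distrib by (intro sum.cong refl) auto
      qed
      ultimately show ?thesis using False N0 by (simp add: field_simps)
    qed
  qed auto
qed

text \<open>Taking absolute values does not decrease the quadratic form, so the maximum is attained
  at a nonnegative vector and is an eigenvalue. On a disconnected graph this vector may have zero
  entries, hence positivity at one vertex only.\<close>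

theorem graph_spectral_radius_rayleigh:
  assumes fin: "finite (pverts G)" "pverts G \<noteq> {}" and symE: "sym (parcs G)"
  shows "adj_form (parcs G) (pverts G) z \<le> graph_spectral_radius G * (\<Sum>v\<in>pverts G. (z v)\<^sup>2)"
    and "\<exists>x. (\<forall>v. 0 \<le> x v) \<and> (\<exists>v\<in>pverts G. x v > 0) \<and>
      (\<forall>v\<in>pverts G. (\<Sum>u\<in>pverts G. adj (parcs G) v u * x u) = graph_spectral_radius G * x v)"
proof -
  define V where "V = pverts G"
  define E where "E = parcs G"
  note fin = fin[folded V_def] and symE = symE[folded E_def]
  obtain xs where xs: "distinct xs" "set xs = V" using finite_distinct_list[OF fin(1)] by blast
  define A where "A = adj_mat G xs"
  have A: "A \<in> carrier_mat (length xs) (length xs)" by (simp add: A_def adj_mat_def)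
  have len: "length xs > 0" using xs fin by auto
  have rad: "graph_spectral_radius G = spectral_radius A"
    unfolding A_def using xs by (intro graph_spectral_radius_eq) (auto simp: V_def)
  note mem_max = spectral_radius_mem_max[OF A len]
  have eig: "k \<in> spectrum A \<longleftrightarrow> (\<exists>f. (\<exists>v\<in>V. f v \<noteq> 0) \<and>
      (\<forall>v\<in>V. (\<Sum>u\<in>V. if (v, u) \<in> E then f u else 0) = k * f v))" for k
    unfolding spectrum_def A_def using eigenvalue_adj_mat[OF xs(1), of G k] xs(2) by (simp add: E_def)
  obtain l y where y: "(\<Sum>v\<in>V. (y v)\<^sup>2) = (1::real)" "adj_form E V y = l"
    and l: "\<And>z. adj_form E V z \<le> l * (\<Sum>v\<in>V. (z v)\<^sup>2)"
    using rayleigh_maximum_exists[OF fin, of E] by metis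
  define x where "x v = \<bar>y v\<bar>" for v
  have adj0: "adj E u v \<ge> 0" for u v by (simp add: adj_def)
  have "l \<le> adj_form E V x"
    unfolding y(2)[symmetric] adj_form_def
  proof (intro sum_mono)
    fix u v
    have "y u * y v \<le> x u * x v" unfolding x_def abs_mult[symmetric] by (rule abs_ge_self)
    then have "adj E u v * (y u * y v) \<le> adj E u v * (x u * x v)" using adj0 by (rule mult_left_mono)
    then show "adj E u v * y u * y v \<le> adj E u v * x u * x v" by (simp only: mult.assoc)
  qed
  moreover have x1: "(\<Sum>v\<in>V. (x v)\<^sup>2) = 1" using y(1) by (simp add: x_def)
  ultimately have xeq: "adj_form E V x = l * (\<Sum>v\<in>V. (x v)\<^sup>2)" using l[of x] by simp
  have xeig: "(\<Sum>u\<in>V. adj E v u * x u) = l * x v" if "v \<in> V" for v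
    by (rule rayleigh_equality_imp_eigenvector[OF fin(1) symE l xeq that])
  obtain v where v: "v \<in> V" "x v \<noteq> 0"
    using x1 by (metis (no_types, lifting) sum.neutral zero_eq_power2 zero_neq_one)
  then have "x v > 0" by (simp add: x_def)
  have "0 \<le> l * x v"
    unfolding xeig[OF v(1), symmetric] using adj0 by (intro sum_nonneg mult_nonneg_nonneg) (auto simp: x_def)
  then have l0: "l \<ge> 0" using \<open>x v > 0\<close> by (simp add: zero_le_mult_iff)
  have "complex_of_real l \<in> spectrum A"
    unfolding eig
  proof (intro exI[of _ "\<lambda>v. complex_of_real (x v)"] conjI ballI)
    show "\<exists>v\<in>V. complex_of_real (x v) \<noteq> 0" using v by auto
    fix v assume "v \<in> V"
    have "(\<Sum>u\<in>V. if (v, u) \<in> E then complex_of_real (x u) else 0) = complex_of_real (\<Sum>u\<in>V. adj E v u * x u)"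
      unfolding of_real_sum by (intro sum.cong) (auto simp: adj_def)
    then show "(\<Sum>u\<in>V. if (v, u) \<in> E then complex_of_real (x u) else 0) = complex_of_real l * complex_of_real (x v)"
      using xeig[OF \<open>v \<in> V\<close>] by simp
  qed
  then have "l \<le> spectral_radius A" using mem_max(2)[of "norm (complex_of_real l)"] l0 by force
  moreover have "spectral_radius A \<le> l"
  proof -
    obtain k where k: "k \<in> spectrum A" "spectral_radius A = norm k" using mem_max(1) by blast
    then obtain f where f: "\<exists>v\<in>V. f v \<noteq> 0" "\<And>v. v \<in> V \<Longrightarrow> (\<Sum>u\<in>V. if (v, u) \<in> E then f u else 0) = k * f v"
      unfolding eig by blast
    \<comment> \<open>For an arbitrary complex eigenvalue \<open>k\<close>, the triangle inequality
      gives the absolute values of an eigenvector a Rayleigh quotient of at least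
      \<open>norm k\<close>.\<close>
    define w where "w v = norm (f v)" for v
    have "norm k * w v \<le> (\<Sum>u\<in>V. adj E v u * w u)" if "v \<in> V" for v
    proof -
      have "norm k * w v = norm (\<Sum>u\<in>V. if (v, u) \<in> E then f u else 0)"
        unfolding f(2)[OF that] by (simp add: w_def norm_mult)
      also have "\<dots> \<le> (\<Sum>u\<in>V. norm (if (v, u) \<in> E then f u else 0))" by (rule norm_sum)
      also have "\<dots> = (\<Sum>u\<in>V. adj E v u * w u)" by (intro sum.cong) (auto simp: adj_def w_def)
      finally show ?thesis .
    qed
    then have "(\<Sum>v\<in>V. w v * (norm k * w v)) \<le> (\<Sum>v\<in>V. w v * (\<Sum>u\<in>V. adj E v u * w u))"
      by (intro sum_mono mult_left_mono) (auto simp: w_def)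
    also have "\<dots> = adj_form E V w"
      unfolding adj_form_def sum_distrib_left by (intro sum.cong refl) (simp add: mult_ac)
    also have "\<dots> \<le> l * (\<Sum>v\<in>V. (w v)\<^sup>2)" by (rule l)
    finally have "norm k * (\<Sum>v\<in>V. (w v)\<^sup>2) \<le> l * (\<Sum>v\<in>V. (w v)\<^sup>2)"
      by (simp add: sum_distrib_left power2_eq_square mult_ac)
    moreover have "(\<Sum>v\<in>V. (w v)\<^sup>2) > 0"
    proof -
      obtain v where "v \<in> V" "f v \<noteq> 0" using f(1) by blast
      then show ?thesis using fin(1) by (intro sum_pos2[of _ v]) (auto simp: w_def)
    qed
    ultimately show ?thesis unfolding k(2) by simp
  qed
  ultimately have rho: "graph_spectral_radius G = l" using rad by simp
  show "adj_form (parcs G) (pverts G) z \<le> graph_spectral_radius G * (\<Sum>v\<in>pverts G. (z v)\<^sup>2)"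
    unfolding rho using l[of z] by (simp add: E_def V_def)
  show "\<exists>x. (\<forall>v. 0 \<le> x v) \<and> (\<exists>v\<in>pverts G. x v > 0) \<and>
      (\<forall>v\<in>pverts G. (\<Sum>u\<in>pverts G. adj (parcs G) v u * x u) = graph_spectral_radius G * x v)"
    unfolding rho using xeig v \<open>x v > 0\<close> by (intro exI[of _ x]) (auto simp: E_def V_def x_def)
qed

section \<open>Linear forests\<close>

text \<open>The paths of a linear forest laid out one after another. Consecutive entries need not be
  adjacent, so the list can be placed along the path of the fan.\<close>

definition linear_order_of :: "('a \<times> 'a) set \<Rightarrow> 'a list \<Rightarrow> bool" where
  "linear_order_of E xs \<longleftrightarrow>
     (\<forall>i<length xs. \<forall>j<length xs. (xs ! i, xs ! j) \<in> E \<longrightarrow> j = Suc i \<or> i = Suc j)"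

lemma linear_order_of_insert:
  assumes lin: "linear_order_of E L" and k: "k \<le> length L" and symE: "sym E" and irr: "irrefl E"
    and nbr: "\<And>i. i < length L \<Longrightarrow> (v, L ! i) \<in> E \<Longrightarrow> i = k \<or> Suc i = k"
    and gap: "0 < k \<Longrightarrow> k < length L \<Longrightarrow> (L ! (k - 1), L ! k) \<notin> E"
  shows "linear_order_of E (take k L @ v # drop k L)"
proof -
  define M where "M = take k L @ v # drop k L"
  have len: "length M = Suc (length L)" using k by (simp add: M_def)
  have M: "M ! i = (if i < k then L ! i else if i = k then v else L ! (i - 1))" if "i < length M" for i
    using that k by (auto simp: M_def nth_append nth_Cons' min_def)
  have "j = Suc i \<or> i = Suc j" if "i < length M" "j < length M" "i < j" and E: "(M ! i, M ! j) \<in> E" for i j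
  proof -
    consider "j < k" | "j = k" | "i < k" "k < j" | "i = k" | "k < i" using \<open>i < j\<close> by linarith
    then show ?thesis
    proof cases
      case 1
      then have "(L ! i, L ! j) \<in> E" "i < length L" "j < length L" using E M that k by auto
      then have "j = Suc i \<or> i = Suc j" using lin unfolding linear_order_of_def by blast
      then show ?thesis by simp
    next
      case 2
      then have "(v, L ! i) \<in> E" using E M that symE by (auto dest: symD)
      then show ?thesis using nbr[of i] 2 that len k by auto
    next
      case 3
      then have "(L ! i, L ! (j - 1)) \<in> E" using E M that by auto
      moreover have "i < length L" "j - 1 < length L" using 3 that len k by auto
      ultimately have "j - 1 = Suc i \<or> i = Suc (j - 1)" using lin unfolding linear_order_of_def by blast
      then have "i = k - 1" "j - 1 = k" using 3 by auto
      then show ?thesis using gap \<open>(L ! i, L ! (j - 1)) \<in> E\<close> \<open>j - 1 < length L\<close> 3 by auto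
    next
      case 4
      then have "(v, L ! (j - 1)) \<in> E" using E M that by auto
      then show ?thesis using nbr[of "j - 1"] 4 that len k by auto
    next
      case 5
      then have "(L ! (i - 1), L ! (j - 1)) \<in> E" using E M that by auto
      moreover have "i - 1 < length L" "j - 1 < length L" using 5 that len k by auto
      ultimately have "j - 1 = Suc (i - 1) \<or> i - 1 = Suc (j - 1)" using lin unfolding linear_order_of_def by blast
      then show ?thesis using 5 that by auto
    qed
  qed
  moreover have "(M ! i, M ! i) \<notin> E" for i using irr by (auto simp: irrefl_def)
  ultimately have "linear_order_of E M"
    unfolding linear_order_of_def by (metis symD[OF symE] linorder_neqE_nat)
  then show ?thesis by (simp add: M_def)
qed

text \<open>The last hypothesis excludes cycles, since a cycle has minimum degree two. A vertex of
  degree at most one is taken out, the rest is ordered by induction, and the vertex is put back next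
  to its only neighbour.\<close>

lemma linear_order_exists:
  assumes "finite A" and symE: "sym E" and irr: "irrefl E"
    and "\<And>v. v \<in> A \<Longrightarrow> card (E `` {v} \<inter> A) \<le> 2"
    and "\<And>W. W \<subseteq> A \<Longrightarrow> W \<noteq> {} \<Longrightarrow> \<exists>v\<in>W. card (E `` {v} \<inter> W) \<le> 1"
  shows "\<exists>xs. distinct xs \<and> set xs = A \<and> linear_order_of E xs"
  using assms(1,4,5)
proof (induction "card A" arbitrary: A)
  case 0
  then show ?case by (intro exI[of _ "[]"]) (auto simp: linear_order_of_def)
next
  case (Suc n)
  then obtain v where v: "v \<in> A" "card (E `` {v} \<inter> A) \<le> 1" by (metis card.empty nat.distinct(1) order_refl)
  have fin: "finite (A - {v})" using Suc by auto
  have "\<exists>xs. distinct xs \<and> set xs = A - {v} \<and> linear_order_of E xs"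
  proof (rule Suc.hyps(1))
    show "n = card (A - {v})" using Suc v by simp
    fix w assume w: "w \<in> A - {v}"
    have "card (E `` {w} \<inter> (A - {v})) \<le> card (E `` {w} \<inter> A)" using Suc.prems(1) by (intro card_mono) auto
    then show "card (E `` {w} \<inter> (A - {v})) \<le> 2" using Suc.prems(2)[of w] w by auto
  next
    fix W assume "W \<subseteq> A - {v}" "W \<noteq> {}"
    then show "\<exists>v\<in>W. card (E `` {v} \<inter> W) \<le> 1" by (intro Suc.prems(3)) auto
  qed (use fin in auto)
  then obtain L where L: "distinct L" "set L = A - {v}" "linear_order_of E L" by blast
  have "\<exists>k\<le>length L. (\<forall>i<length L. (v, L ! i) \<in> E \<longrightarrow> i = k \<or> Suc i = k) \<and>
      (0 < k \<and> k < length L \<longrightarrow> (L ! (k - 1), L ! k) \<notin> E)"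
  proof (cases "\<exists>m<length L. (v, L ! m) \<in> E")
    case False
    then show ?thesis by (intro exI[of _ "length L"]) auto
  next
    case True
    then obtain m where m: "m < length L" "(v, L ! m) \<in> E" by blast
    have Lm: "L ! i \<in> A - {v}" if "i < length L" for i using L(2) that nth_mem by blast
    have only: "i = m" if i: "i < length L" "(v, L ! i) \<in> E" for i
    proof -
      have "{L ! i, L ! m} \<subseteq> E `` {v} \<inter> A" using i m Lm by auto
      then have "card {L ! i, L ! m} \<le> 1"
        using v(2) Suc.prems(1) by (meson card_mono finite_Int order_trans)
      then have "L ! i = L ! m" by (cases "L ! i = L ! m") auto
      then show ?thesis using L(1) i m by (simp add: nth_eq_iff_index_eq)
    qed
    \<comment> \<open>\<open>L ! m\<close> has \<open>v\<close> as a neighbour, so at most one of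
      the entries beside it is adjacent to it. On the other side \<open>v\<close> can be inserted
      without pulling an edge apart.\<close>
    have "\<not> (0 < m \<and> Suc m < length L \<and> (L ! (m - 1), L ! m) \<in> E \<and> (L ! m, L ! Suc m) \<in> E)"
    proof
      assume *: "0 < m \<and> Suc m < length L \<and> (L ! (m - 1), L ! m) \<in> E \<and> (L ! m, L ! Suc m) \<in> E"
      have "m - 1 < length L" "Suc m < length L" using * by auto
      note L' = this Lm[OF this(1)] Lm[OF this(2)]
      have "(L ! m, v) \<in> E" "(L ! m, L ! (m - 1)) \<in> E" using symD[OF symE] m(2) * by blast+
      then have "{v, L ! (m - 1), L ! Suc m} \<subseteq> E `` {L ! m} \<inter> A"
        using v(1) L' * by auto
      then have "card {v, L ! (m - 1), L ! Suc m} \<le> card (E `` {L ! m} \<inter> A)"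
        using Suc.prems(1) by (intro card_mono) auto
      also have "\<dots> \<le> 2" using Suc.prems(2) Lm[OF m(1)] by auto
      finally have "card {v, L ! (m - 1), L ! Suc m} \<le> 2" .
      moreover have "L ! (m - 1) \<noteq> L ! Suc m" using L(1) L' by (simp add: nth_eq_iff_index_eq)
      moreover have "v \<noteq> L ! (m - 1)" "v \<noteq> L ! Suc m" using L' by auto
      ultimately show False by simp
    qed
    then consider "m = 0 \<or> (L ! (m - 1), L ! m) \<notin> E" | "Suc m = length L \<or> (L ! m, L ! Suc m) \<notin> E"
      using m by force
    then show ?thesis
    proof cases
      case 1
      show ?thesis
      proof (intro exI[of _ m] conjI allI impI)
        show "m \<le> length L" using m(1) by simp
        show "i = m \<or> Suc i = m" if "i < length L" "(v, L ! i) \<in> E" for i using only[OF that] by simp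
        show "(L ! (m - 1), L ! m) \<notin> E" if "0 < m \<and> m < length L" using 1 that by blast
      qed
    next
      case 2
      show ?thesis
      proof (intro exI[of _ "Suc m"] conjI allI impI)
        show "Suc m \<le> length L" using m(1) by simp
        show "i = Suc m \<or> Suc i = Suc m" if "i < length L" "(v, L ! i) \<in> E" for i using only[OF that] by simp
        show "(L ! (Suc m - 1), L ! Suc m) \<notin> E" if "0 < Suc m \<and> Suc m < length L" using 2 that by auto
      qed
    qed
  qed
  then obtain k where k: "k \<le> length L" "\<And>i. i < length L \<Longrightarrow> (v, L ! i) \<in> E \<Longrightarrow> i = k \<or> Suc i = k"
    "0 < k \<Longrightarrow> k < length L \<Longrightarrow> (L ! (k - 1), L ! k) \<notin> E" by blast
  have "linear_order_of E (take k L @ v # drop k L)"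
    by (rule linear_order_of_insert[OF L(3) k(1) symE irr k(2,3)])
  moreover have "set (take k L @ v # drop k L) = A"
  proof -
    have "set (take k L) \<union> set (drop k L) = set L" by (metis append_take_drop_id set_append)
    then show ?thesis using L(2) v(1) by auto
  qed
  moreover have "distinct (take k L @ v # drop k L)"
    using L(1,2) set_take_disj_set_drop_if_distinct[OF L(1), of k k] by (auto dest: in_set_takeD in_set_dropD)
  ultimately show ?case by blast
qed

text \<open>The first vertex of a longest path in a set of minimum degree two has a second neighbour on the path.\<close>

lemma cycle_exists:
  assumes "finite W" "W \<noteq> {}" and symE: "sym E" and irr: "irrefl E"
    and deg: "\<And>v. v \<in> W \<Longrightarrow> 2 \<le> card (E `` {v} \<inter> W)"
  obtains ps where "distinct ps" "set ps \<subseteq> W" "successively (\<lambda>x y. (x, y) \<in> E) ps" "length ps \<ge> 3"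
    "(hd ps, last ps) \<in> E"
proof -
  let ?P = "\<lambda>ps. distinct ps \<and> set ps \<subseteq> W \<and> successively (\<lambda>x y. (x, y) \<in> E) ps \<and> ps \<noteq> []"
  obtain w where "w \<in> W" using assms(2) by blast
  then have P1: "?P [w]" by simp
  have "length ps \<le> card W" if "?P ps" for ps
    using that assms(1) by (metis card_mono distinct_card)
  then have "\<forall>ps. ?P ps \<longrightarrow> length ps < Suc (card W)" by (auto simp: less_Suc_eq_le)
  with P1 have "\<exists>ps. ?P ps \<and> (\<forall>qs. ?P qs \<longrightarrow> length qs \<le> length ps)"
    by (rule ex_has_greatest_nat)
  then obtain ps where ps: "?P ps" and max: "\<And>qs. ?P qs \<Longrightarrow> length qs \<le> length ps"
    by (elim exE conjE) blast
  obtain x xs where px: "ps = x # xs" using ps by (cases ps) auto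
  have nb: "E `` {x} \<inter> W \<subseteq> set xs"
  proof
    fix y assume y: "y \<in> E `` {x} \<inter> W"
    show "y \<in> set xs"
    proof (rule ccontr)
      assume "y \<notin> set xs"
      moreover have "y \<noteq> x" using y irr by (auto simp: irrefl_def)
      ultimately have "?P (y # ps)" using ps y symE px by (auto dest: symD)
      then show False using max[of "y # ps"] by simp
    qed
  qed
  have "\<not> E `` {x} \<inter> W \<subseteq> {hd xs}"
  proof
    assume "E `` {x} \<inter> W \<subseteq> {hd xs}"
    then have "card (E `` {x} \<inter> W) \<le> card {hd xs}" by (rule card_mono[rotated]) simp
    then show False using deg[of x] ps px by simp
  qed
  then obtain y where y: "(x, y) \<in> E" "y \<noteq> hd xs" "y \<in> set xs" using nb by blast
  then obtain as bs where xs: "xs = as @ y # bs" by (meson split_list)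
  have "as \<noteq> []" using y(2) xs by auto
  show thesis
  proof (rule that[of "x # as @ [y]"])
    show "distinct (x # as @ [y])" "set (x # as @ [y]) \<subseteq> W" using ps px xs by auto
    have "successively (\<lambda>x y. (x, y) \<in> E) ((x # as @ [y]) @ bs)" using ps px xs by simp
    then show "successively (\<lambda>x y. (x, y) \<in> E) (x # as @ [y])" by (simp only: successively_append_iff)
    show "3 \<le> length (x # as @ [y])" using \<open>as \<noteq> []\<close> by (cases as) auto
    show "(hd (x # as @ [y]), last (x # as @ [y])) \<in> E" using y(1) by simp
  qed
qed

lemma connected_in_successively:
  assumes "successively (\<lambda>x y. (x, y) \<in> E) ps" "sym E"
  shows "connected_in E (set ps)"
  using assms(1)
proof (induction ps)
  case Nil
  then show ?case by (simp add: connected_in_def)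
next
  case (Cons x ps)
  show ?case
  proof (cases ps)
    case Nil
    then show ?thesis by (simp add: connected_in_singleton)
  next
    case (Cons y zs)
    let ?R = "(E \<inter> set (x # ps) \<times> set (x # ps))\<^sup>*"
    have xy: "(x, y) \<in> E" "(y, x) \<in> E" using Cons.prems Cons assms(2) by (auto dest: symD)
    have "(E \<inter> set ps \<times> set ps)\<^sup>* \<subseteq> ?R" by (intro rtrancl_mono) auto
    then have *: "(u, v) \<in> ?R" if "u \<in> set ps" "v \<in> set ps" for u v
      using Cons.IH Cons.prems that Cons unfolding connected_in_def by auto
    have "(x, y) \<in> ?R" "(y, x) \<in> ?R" using xy Cons by (auto intro!: r_into_rtrancl)
    then have "(x, v) \<in> ?R" "(v, x) \<in> ?R" if "v \<in> set ps" for v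
      using *[of y v] *[of v y] that Cons by (auto intro: rtrancl_trans)
    then show ?thesis using * unfolding connected_in_def by auto
  qed
qed

section \<open>Common neighbourhoods in plane graphs\<close>

context plane_graph
begin

text \<open>Three common neighbours would complete a K_{3,3}. Besides sparsity, this is the form in
  which planarity enters the spectral estimates.\<close>

lemma card_common_neighbours_le_2:
  assumes "x \<noteq> y" "x \<noteq> z" "y \<noteq> z"
  shows "card (E `` {x} \<inter> E `` {y} \<inter> E `` {z}) \<le> 2"
proof (rule ccontr)
  assume "\<not> ?thesis"
  then obtain T where T: "T \<subseteq> E `` {x} \<inter> E `` {y} \<inter> E `` {z}" "card T = 3" "finite T"
    by (metis not_less_eq_eq numeral_2_eq_2 numeral_3_eq_3 obtain_subset_with_card_n)
  then obtain b :: "nat \<Rightarrow> 'a" where b: "bij_betw b {0..<3} T" using ex_bij_betw_nat_finite by metis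
  show False
  proof (rule no_K33[of "\<lambda>i. if i = 0 then x else if i = 1 then y else z" b])
    show "inj_on (\<lambda>i::nat. if i = 0 then x else if i = 1 then y else z) {..<3}"
      using assms by (auto simp: inj_on_def)
    show "inj_on b {..<3}" using b by (simp add: bij_betw_def atLeast0LessThan)
    fix i j :: nat assume "i < 3" "j < 3"
    then have "b j \<in> T" using b by (auto simp: bij_betw_def)
    then show "(if i = 0 then x else if i = 1 then y else z, b j) \<in> E" using T(1) by auto
  qed
qed

text \<open>A third vertex has at most two neighbours in common with \<open>a\<close> and
  \<open>b\<close>, which bounds the degrees inside \<open>A\<close>. A cycle inside
  \<open>A\<close> is not spanning, by \<open>short\<close>, so some \<open>w\<close> in
  \<open>A\<close> lies off it; then \<open>a\<close>, \<open>b\<close> and three vertices of the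
  cycle are the branch vertices of a subdivided K_5.\<close>

lemma common_neighbours_linear:
  assumes ab: "a \<noteq> b" and A: "A \<subseteq> E `` {a} \<inter> E `` {b}"
    and short: "\<And>ps. distinct ps \<Longrightarrow> set ps \<subseteq> A \<Longrightarrow> successively (\<lambda>x y. (x, y) \<in> E) ps \<Longrightarrow> length ps < card A"
  shows "\<exists>xs. distinct xs \<and> set xs = A \<and> linear_order_of E xs"
proof (rule linear_order_exists[OF _ symE irreflE])
  have AV: "A \<subseteq> V" "a \<in> V \<or> A = {}" "b \<in> V \<or> A = {}" using A EV by blast+
  then show finA: "finite A" using finV by (auto intro: finite_subset)
  have abA: "a \<notin> A" "b \<notin> A" using A irreflE by (auto simp: irrefl_def)
  fix v assume v: "v \<in> A"
  have "card (E `` {v} \<inter> A) \<le> card (E `` {a} \<inter> E `` {b} \<inter> E `` {v})"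
    using A finite_subset[OF _ finV, of "E `` {a} \<inter> E `` {b} \<inter> E `` {v}"] EV by (intro card_mono) auto
  also have "\<dots> \<le> 2" using ab abA v by (intro card_common_neighbours_le_2) auto
  finally show "card (E `` {v} \<inter> A) \<le> 2" .
next
  fix W assume W: "W \<subseteq> A" "W \<noteq> {}"
  have AV: "A \<subseteq> V" and abV: "a \<in> V" "b \<in> V" using A EV W by blast+
  have finA: "finite A" using AV finV by (rule finite_subset)
  have abA: "a \<notin> A" "b \<notin> A" using A irreflE by (auto simp: irrefl_def)
  show "\<exists>v\<in>W. card (E `` {v} \<inter> W) \<le> 1"
  proof (rule ccontr)
    assume "\<not> ?thesis"
    then have "2 \<le> card (E `` {v} \<inter> W)" if "v \<in> W" for v using that by force
    then obtain ps where ps: "distinct ps" "set ps \<subseteq> W" "successively (\<lambda>x y. (x, y) \<in> E) ps" "length ps \<ge> 3"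
        "(hd ps, last ps) \<in> E"
      using cycle_exists[OF finite_subset[OF W(1) finA] W(2) symE irreflE] by metis
    have "card (set ps) < card A" using short[of ps] ps W(1) by (auto simp: distinct_card)
    then obtain w where w: "w \<in> A" "w \<notin> set ps"
      by (metis List.finite_set card_mono leD subsetI)
    obtain x y zs where ps_eq: "ps = x # y # zs" "zs \<noteq> []"
      using ps(4) by (cases ps; cases "tl ps"; cases "tl (tl ps)") auto
    define z where "z = last zs"
    have z: "z \<in> set zs" "last ps = z" using ps_eq by (auto simp: z_def)
    have psA: "set ps \<subseteq> A" using ps(2) W(1) by blast
    have nbA: "(a, v) \<in> E" "(v, a) \<in> E" "(b, v) \<in> E" "(v, b) \<in> E" if "v \<in> A" for v
      using that A symE by (auto dest: symD)
    have xyz: "x \<in> A" "y \<in> A" "z \<in> A" "x \<noteq> y" "x \<noteq> z" "y \<noteq> z" "w \<noteq> x" "w \<notin> insert y (set zs)"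
      using psA ps(1) ps_eq z w by auto
    have xy: "(x, y) \<in> E" "(y, x) \<in> E" and xz: "(x, z) \<in> E" "(z, x) \<in> E"
      using ps(3,5) ps_eq z symE by (auto dest: symD)
    define K where "K = insert y (set zs)"
    have K: "connected_in E K" "K \<subseteq> A" "x \<notin> K" "y \<in> K" "z \<in> K" "w \<notin> K"
      using connected_in_successively[of E "y # zs"] ps ps_eq symE psA z xyz by (auto simp: K_def)
    define q where "q i = [a, b, y, x, z] ! i" for i
    \<comment> \<open>Eight of the ten links are single edges. The pair \<open>a\<close>,
      \<open>b\<close> is linked over \<open>w\<close>, and \<open>y\<close>, \<open>z\<close> along
      the part of the cycle that avoids \<open>x\<close>.\<close>
    define U where "U i j = (if (i, j) = (0, 1) then {a, w, b} else if (i, j) = (2, 4) then K else {q i, q j})" for i j :: nat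
    have five: "i = 0 \<or> i = 1 \<or> i = 2 \<or> i = 3 \<or> i = 4" if "i < 5" for i :: nat using that by auto
    have q_simps: "q 0 = a" "q 1 = b" "q (Suc 0) = b" "q 2 = y" "q 3 = x" "q 4 = z"
      by (simp_all add: q_def numeral_eq_Suc)
    have pairs: "(i, j) = (0, 1) \<or> (i, j) = (0, 2) \<or> (i, j) = (0, 3) \<or> (i, j) = (0, 4) \<or> (i, j) = (1, 2) \<or>
        (i, j) = (1, 3) \<or> (i, j) = (1, 4) \<or> (i, j) = (2, 3) \<or> (i, j) = (2, 4) \<or> (i, j) = (3, 4)"
      if "i < j" "j < 5" for i j :: nat
      using that five[of i] five[of j] by auto
    have abK: "a \<notin> K" "b \<notin> K" using K(2) abA by auto
    have awb: "connected_in E {a, w, b}"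
      using connected_in_successively[of E "[a, w, b]"] symE nbA[OF w(1)] by simp
    have VV: "x \<in> V" "y \<in> V" "z \<in> V" "w \<in> V" "K \<subseteq> V" using xyz(1-3) w(1) K(2) AV by auto
    show False
    proof (rule no_K5_subdivision[of q U])
      show "inj_on q {..<5}"
      proof (rule inj_onI)
        fix i j assume "i \<in> {..<5}" "j \<in> {..<5}" "q i = q j"
        moreover have "distinct [a, b, y, x, z]" using xyz ab abA by auto
        ultimately show "i = j" by (simp add: q_def nth_eq_iff_index_eq)
      qed
      fix i j :: nat assume ij: "i < j" "j < 5"
      show "U i j \<subseteq> V \<and> connected_in E (U i j) \<and> q i \<in> U i j \<and> q j \<in> U i j"
        using pairs[OF ij] VV abV K awb nbA[OF xyz(1)] nbA[OF xyz(2)] nbA[OF xyz(3)] xy xz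
        by (elim disjE) (simp_all add: U_def q_simps connected_in_edge)
      fix k l :: nat assume kl: "k < l" "l < 5" and ne: "(i, j) \<noteq> (k, l)"
      show "U i j \<inter> U k l \<subseteq> q ` ({i, j} \<inter> {k, l})"
        using pairs[OF ij] pairs[OF kl] ne
        by (elim disjE) (use xyz ab abA abK K w in \<open>auto simp: U_def q_simps\<close>)
    qed
  qed
qed

end

section \<open>The Perron vector\<close>

text \<open>\<open>F\<close> does not occur here: the lower bound on \<open>\<rho>\<^sup>2\<close>,
  the value for K_{2,n-2}, is all that remains of extremality.\<close>

locale plane_spectral = plane_graph G p \<gamma>
  for G :: "'a pair_pre_digraph" and p \<gamma> +
  fixes n :: nat and \<rho> :: real and x :: "'a \<Rightarrow> real" and a :: 'a
  assumes card_V: "card (pverts G) = n" and n_large: "2.16 * 10 ^ 17 \<le> real n"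
    and \<rho>: "0 < \<rho>" "2 * real n - 4 \<le> \<rho>\<^sup>2"
    and x: "\<And>v. v \<in> pverts G \<Longrightarrow> 0 \<le> x v \<and> x v \<le> 1"
    and eigen: "\<And>v. v \<in> pverts G \<Longrightarrow> (\<Sum>u\<in>parcs G `` {v}. x u) = \<rho> * x v"
    and a: "a \<in> pverts G" "x a = 1"
begin

lemma nL: "216000000000000000 \<le> real n"
  using n_large by simp

abbreviation N :: "'a \<Rightarrow> 'a set" where "N v \<equiv> E `` {v}"

text \<open>For \<open>X = N v\<close> this is the entry at \<open>v\<close> of the squared
  adjacency matrix applied to \<open>x\<close>, that is \<open>\<rho>\<^sup>2 * x v\<close>.
  Splitting \<open>X\<close> splits this identity into pieces that are estimated separately.\<close>

definition walk_sum :: "'a set \<Rightarrow> real" where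
  "walk_sum X = (\<Sum>u\<in>X. \<Sum>w\<in>N u. x w)"

lemma N: "N v \<subseteq> V" "finite (N v)" "v \<notin> N v"
  using EV finite_subset[OF _ finV, of "N v"] irreflE by (auto simp: irrefl_def)

lemma N_sym: "u \<in> N v \<longleftrightarrow> v \<in> N u"
  using symE by (auto dest: symD)

lemma finE: "finite E"
  using finite_subset[OF EV] finV by simp

lemma card_pairs: "finite X \<Longrightarrow> card (E \<inter> X \<times> Y) = (\<Sum>u\<in>X. card (N u \<inter> Y))"
proof -
  assume X: "finite X"
  have "card (E \<inter> X \<times> Y) = card (Sigma X (\<lambda>u. N u \<inter> Y))"
    by (rule arg_cong[of _ _ card]) auto
  also have "\<dots> = (\<Sum>u\<in>X. card (N u \<inter> Y))"
    using X N(2) by (intro card_SigmaI) auto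
  finally show ?thesis .
qed

lemma pairs_le_16:
  assumes "X \<subseteq> V" "Y \<subseteq> V"
  shows "real (card (E \<inter> X \<times> Y)) \<le> 16 * real (card (X \<union> Y))"
proof (cases "X \<union> Y = {}")
  case False
  have "card (E \<inter> X \<times> Y) \<le> card (E \<inter> (X \<union> Y) \<times> (X \<union> Y))"
    using finE by (intro card_mono) auto
  also have "\<dots> < 16 * card (X \<union> Y)" using assms False by (intro arcs_less) auto
  finally show ?thesis by linarith
qed auto

lemma sum_pairs_le:
  assumes "X \<subseteq> V" "Y \<subseteq> V" "\<And>w. w \<in> Y \<Longrightarrow> x w \<le> c"
  shows "(\<Sum>u\<in>X. \<Sum>w\<in>N u \<inter> Y. x w) \<le> c * real (card (E \<inter> X \<times> Y))"
proof -
  have "(\<Sum>w\<in>N u \<inter> Y. x w) \<le> real (card (N u \<inter> Y)) * c" for u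
    using assms(3) by (intro sum_bounded_above) auto
  then have "(\<Sum>u\<in>X. \<Sum>w\<in>N u \<inter> Y. x w) \<le> (\<Sum>u\<in>X. real (card (N u \<inter> Y)) * c)"
    by (rule sum_mono)
  also have "\<dots> = c * real (card (E \<inter> X \<times> Y))"
    using finite_subset[OF assms(1) finV] by (simp add: card_pairs sum_distrib_left mult.commute)
  finally show ?thesis .
qed

lemma walk_sum_N: "v \<in> V \<Longrightarrow> walk_sum (N v) = \<rho>\<^sup>2 * x v"
proof -
  assume v: "v \<in> V"
  have "walk_sum (N v) = (\<Sum>u\<in>N v. \<rho> * x u)"
    unfolding walk_sum_def using eigen N(1) by (intro sum.cong) auto
  also have "\<dots> = \<rho>\<^sup>2 * x v"
    using eigen[OF v] by (simp add: sum_distrib_left[symmetric] power2_eq_square)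
  finally show ?thesis .
qed

lemma walk_sum_Un: "finite X \<Longrightarrow> finite Y \<Longrightarrow> X \<inter> Y = {} \<Longrightarrow> walk_sum (X \<union> Y) = walk_sum X + walk_sum Y"
  unfolding walk_sum_def by (rule sum.union_disjoint)

lemma walk_sum_mono: "X \<subseteq> Y \<Longrightarrow> Y \<subseteq> V \<Longrightarrow> walk_sum X \<le> walk_sum Y"
proof -
  assume *: "X \<subseteq> Y" "Y \<subseteq> V"
  have "0 \<le> (\<Sum>w\<in>N u. x w)" for u
    using x N(1)[of u] by (intro sum_nonneg) blast
  then show ?thesis
    unfolding walk_sum_def using * finite_subset[OF _ finV] by (intro sum_mono2) auto
qed

lemma walk_sum_le_card: "X \<subseteq> V \<Longrightarrow> walk_sum X \<le> \<rho> * real (card X)"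
proof -
  assume X: "X \<subseteq> V"
  have "walk_sum X = (\<Sum>u\<in>X. \<rho> * x u)"
    unfolding walk_sum_def using eigen X by (intro sum.cong) auto
  also have "\<dots> \<le> (\<Sum>u\<in>X. \<rho> * 1)"
    using X x \<rho>(1) by (intro sum_mono mult_left_mono) auto
  finally show ?thesis by (simp add: mult.commute)
qed

definition s :: real where "s = sqrt (real n)"

text \<open>464000000 is just below the square root of \<open>2.16 * 10 ^ 17\<close>, so terms of
  order \<open>s\<close> become tiny multiples of \<open>n\<close>.\<close>

lemma s: "464000000 \<le> s" "s * s = real n"
proof -
  have "(464000000)\<^sup>2 \<le> real n" using nL by (simp add: power2_eq_square)
  then show "464000000 \<le> s" unfolding s_def by (rule real_le_rsqrt)
qed (simp add: s_def)

lemma s_le: "s \<le> real n / (464000000)"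
proof -
  have "464000000 * s \<le> s * s" using s(1) by (intro mult_right_mono) auto
  then show ?thesis using s(2) by simp
qed

text \<open>For the upper bound, the walks of length two from \<open>a\<close> are at most as many
  as all arcs, that is 16 per vertex. Only the order of magnitude matters: terms with
  \<open>\<rho>\<close> will be negligible against \<open>n\<close>.\<close>

lemma \<rho>_bounds: "s \<le> \<rho>" "\<rho> \<le> 4 * s"
proof -
  have "s\<^sup>2 = real n" using s(2) by (simp only: power2_eq_square)
  then have "s\<^sup>2 \<le> \<rho>\<^sup>2" using \<rho>(2) nL by linarith
  then show "s \<le> \<rho>" using \<rho>(1) by (rule power2_le_imp_le[OF _ less_imp_le])
  have "\<rho>\<^sup>2 = walk_sum (N a)" using walk_sum_N[OF a(1)] a(2) by simp
  also have "\<dots> \<le> walk_sum V" using N(1) by (rule walk_sum_mono) simp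
  also have "\<dots> = (\<Sum>u\<in>V. \<Sum>w\<in>N u \<inter> V. x w)"
    unfolding walk_sum_def using N(1) by (simp add: Int_absorb2)
  also have "\<dots> \<le> 1 * real (card (E \<inter> V \<times> V))" using x by (intro sum_pairs_le) auto
  also have "\<dots> \<le> 16 * real (card (V \<union> V))" using pairs_le_16[of V V] by simp
  also have "\<dots> = (4 * s)\<^sup>2" using \<open>s\<^sup>2 = real n\<close> card_V by (simp add: power_mult_distrib)
  finally have "\<rho>\<^sup>2 \<le> (4 * s)\<^sup>2" .
  moreover have "0 \<le> 4 * s" using s(1) by simp
  ultimately show "\<rho> \<le> 4 * s" by (rule power2_le_imp_le)
qed

section \<open>Vertices of large weight\<close>

definition L :: "real \<Rightarrow> 'a set" where "L d = {v \<in> V. d \<le> x v}"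

lemma L: "L d \<subseteq> V" "finite (L d)"
  using finV by (auto simp: L_def)

lemma x_le_degree: "v \<in> V \<Longrightarrow> \<rho> * x v \<le> real (card (N v))"
proof -
  assume "v \<in> V"
  have "(\<Sum>u\<in>N v. x u) \<le> real (card (N v)) * 1" using x N(1) by (intro sum_bounded_above) auto
  then show ?thesis using eigen[OF \<open>v \<in> V\<close>] by simp
qed

lemma sum_degrees: "X \<subseteq> V \<Longrightarrow> (\<Sum>u\<in>X. real (card (N u))) \<le> 16 * real n"
proof -
  assume X: "X \<subseteq> V"
  have "(\<Sum>u\<in>X. real (card (N u))) = (\<Sum>u\<in>X. real (card (N u \<inter> V)))"
    using N(1) by (simp add: Int_absorb2)
  also have "\<dots> = real (card (E \<inter> X \<times> V))" using finite_subset[OF X finV] by (simp add: card_pairs)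
  also have "\<dots> \<le> 16 * real (card (X \<union> V))" using X by (intro pairs_le_16) auto
  also have "X \<union> V = V" using X by auto
  finally show ?thesis using card_V by simp
qed

lemma card_L_degree:
  assumes "\<And>v. v \<in> L d \<Longrightarrow> c \<le> real (card (N v))"
  shows "c * real (card (L d)) \<le> 16 * real n"
proof -
  have "c * real (card (L d)) = (\<Sum>v\<in>L d. c)" by simp
  also have "\<dots> \<le> (\<Sum>v\<in>L d. real (card (N v)))" using assms by (rule sum_mono)
  also have "\<dots> \<le> 16 * real n" using L(1) by (rule sum_degrees)
  finally show ?thesis .
qed

text \<open>Weight at least \<open>d\<close> forces degree at least \<open>\<rho> * d\<close>, and
  the degrees sum to at most \<open>16 * n\<close>. This first bound of order \<open>s\<close> is
  what the next round of counting needs.\<close>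

lemma card_L_small:
  assumes "0 < d"
  shows "d * real (card (L d)) \<le> 16 * s"
proof -
  have "s * d * real (card (L d)) \<le> 16 * real n"
  proof (rule card_L_degree)
    fix v assume v: "v \<in> L d"
    have "s * d \<le> \<rho> * x v" using v \<rho>_bounds(1) assms s(1) x by (intro mult_mono) (auto simp: L_def)
    also have "\<dots> \<le> real (card (N v))" using v by (intro x_le_degree) (simp add: L_def)
    finally show "s * d \<le> real (card (N v))" .
  qed
  then have "s * (d * real (card (L d))) \<le> s * (16 * s)" using s(2) by (simp add: mult_ac)
  then show ?thesis using s(1) by simp
qed

lemma walk_sum_split:
  assumes "X \<subseteq> V"
  shows "walk_sum X \<le> (\<Sum>u\<in>X. \<Sum>w\<in>N u \<inter> L d. x w) + d * real (card (E \<inter> X \<times> (V - L d)))"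
proof -
  have "walk_sum X = (\<Sum>u\<in>X. (\<Sum>w\<in>N u \<inter> L d. x w) + (\<Sum>w\<in>N u \<inter> (V - L d). x w))"
    unfolding walk_sum_def
  proof (rule sum.cong[OF refl])
    fix u
    have "N u = (N u \<inter> L d) \<union> (N u \<inter> (V - L d))" using N(1)[of u] by auto
    moreover have "(\<Sum>w\<in>(N u \<inter> L d) \<union> (N u \<inter> (V - L d)). x w) = (\<Sum>w\<in>N u \<inter> L d. x w) + (\<Sum>w\<in>N u \<inter> (V - L d). x w)"
      using N(2) by (intro sum.union_disjoint) auto
    ultimately show "(\<Sum>w\<in>N u. x w) = (\<Sum>w\<in>N u \<inter> L d. x w) + (\<Sum>w\<in>N u \<inter> (V - L d). x w)" by simp
  qed
  also have "\<dots> = (\<Sum>u\<in>X. \<Sum>w\<in>N u \<inter> L d. x w) + (\<Sum>u\<in>X. \<Sum>w\<in>N u \<inter> (V - L d). x w)"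
    by (rule sum.distrib)
  also have "(\<Sum>u\<in>X. \<Sum>w\<in>N u \<inter> (V - L d). x w) \<le> d * real (card (E \<inter> X \<times> (V - L d)))"
    using assms by (intro sum_pairs_le) (auto simp: L_def)
  finally show ?thesis by simp
qed

text \<open>Weight 1/150 requires many walks of length two. Those ending in \<open>L d\<close> are
  limited by the degree of \<open>v\<close>, because \<open>L d\<close> is small; the others end at
  weight below \<open>d\<close>. Linear degree in turn leaves room for only a bounded number of such
  vertices.\<close>

lemma degree_large:
  assumes v: "v \<in> L (1/150)"
  shows "real n / 3000 \<le> real (card (N v))"
proof -
  \<comment> \<open>With this \<open>d\<close> the walks ending outside \<open>L d\<close>
    contribute at most 16 n d = n / 150, half of the left-hand side. What remains gives degree n /
    2400 up to the error 38400 s from \<open>card (L d)\<close>. The margin n / 2400 - n / 3000 = n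
    / 12000 just covers this error, one of the two places that fix the size of
    \<open>n\<close>.\<close>
  define d :: real where "d = 1/2400"
  have vV: "v \<in> V" and xv: "1/150 \<le> x v" using v by (auto simp: L_def)
  have "(2 * real n - 4) * (1/150) \<le> \<rho>\<^sup>2 * x v"
    using \<rho>(2) xv nL by (intro mult_mono) auto
  also have "\<dots> = walk_sum (N v)" using walk_sum_N[OF vV] by simp
  also have "\<dots> \<le> (\<Sum>u\<in>N v. \<Sum>w\<in>N u \<inter> L d. x w) + d * real (card (E \<inter> N v \<times> (V - L d)))"
    using N(1) by (rule walk_sum_split)
  also have "(\<Sum>u\<in>N v. \<Sum>w\<in>N u \<inter> L d. x w) \<le> 1 * real (card (E \<inter> N v \<times> L d))"
    using x L N(1) by (intro sum_pairs_le) auto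
  also have "1 * real (card (E \<inter> N v \<times> L d)) \<le> 16 * real (card (N v \<union> L d))"
    using pairs_le_16[OF N(1) L(1)] by simp
  also have "real (card (N v \<union> L d)) \<le> real (card (N v)) + real (card (L d))"
    using card_Un_le[of "N v" "L d"] by linarith
  also have "real (card (E \<inter> N v \<times> (V - L d))) \<le> 16 * real (card (N v \<union> (V - L d)))"
    using N(1) by (intro pairs_le_16) auto
  also have "real (card (N v \<union> (V - L d))) \<le> real n"
    using card_V finV N(1) by (auto intro!: card_mono)
  finally have "(2 * real n - 4) * (1/150) \<le> 16 * (real (card (N v)) + real (card (L d))) + d * (16 * real n)"
    by (simp add: d_def)
  moreover have "real (card (L d)) \<le> 38400 * s"
    using card_L_small[of d] by (simp add: d_def)
  ultimately show ?thesis using s_le nL by (simp add: d_def)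
qed

abbreviation "LL \<equiv> L (1/150)"

lemma card_LL: "real (card LL) \<le> 48000"
proof -
  have "real n / 3000 * real (card LL) \<le> 16 * real n" by (rule card_L_degree[OF degree_large])
  then show ?thesis using nL by (simp add: field_simps)
qed

definition B :: "'a set" where "B = {u \<in> V. 3 \<le> card (N u \<inter> LL)}"

text \<open>A vertex of \<open>B\<close> is a common neighbour of some triple in \<open>LL\<close>,
  and each triple has at most two common neighbours.\<close>

lemma card_B: "real (card B) \<le> real (card LL) ^ 3 / 3"
proof -
  define S where "S = {T. T \<subseteq> LL \<and> card T = 3}"
  have finS: "finite S" using L(2) by (auto simp: S_def)
  have "B \<subseteq> (\<Union>T\<in>S. {u \<in> V. T \<subseteq> N u})"
  proof
    fix u assume "u \<in> B"
    then have "3 \<le> card (N u \<inter> LL)" "u \<in> V" by (auto simp: B_def)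
    then obtain T where "T \<subseteq> N u \<inter> LL" "card T = 3" "finite T" by (meson obtain_subset_with_card_n)
    then show "u \<in> (\<Union>T\<in>S. {u \<in> V. T \<subseteq> N u})" using \<open>u \<in> V\<close> by (auto simp: S_def)
  qed
  then have "card B \<le> card (\<Union>T\<in>S. {u \<in> V. T \<subseteq> N u})"
    using finS finV by (intro card_mono) auto
  also have "\<dots> \<le> (\<Sum>T\<in>S. card {u \<in> V. T \<subseteq> N u})" using finS by (rule card_UN_le)
  also have "\<dots> \<le> (\<Sum>T\<in>S. 2)"
  proof (rule sum_mono)
    fix T assume "T \<in> S"
    then obtain y z w where T: "T = {y, z, w}" "y \<noteq> z" "y \<noteq> w" "z \<noteq> w"
      by (auto simp: S_def card_3_iff)
    have "{u \<in> V. T \<subseteq> N u} \<subseteq> N y \<inter> N z \<inter> N w" using T N_sym by auto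
    then have "card {u \<in> V. T \<subseteq> N u} \<le> card (N y \<inter> N z \<inter> N w)"
      using N(2) by (intro card_mono) auto
    then show "card {u \<in> V. T \<subseteq> N u} \<le> 2" using card_common_neighbours_le_2[OF T(2-4)] by linarith
  qed
  also have "\<dots> = 2 * (card LL choose 3)" using n_subsets[OF L(2)] by (simp add: S_def)
  finally have "3 * card B \<le> (card LL choose 3) * fact 3" by (simp add: fact_numeral)
  also have "\<dots> \<le> card LL ^ 3"
    by (cases "3 \<le> card LL") (simp_all add: binomial_fact_pow)
  finally have "real (3 * card B) \<le> real (card LL ^ 3)" by (simp only: of_nat_le_iff)
  then show ?thesis by simp
qed

text \<open>Bounds the arcs from \<open>B\<close> to \<open>LL\<close>, and so the weight that the
  exceptional vertices can add. With 48000 vertices in \<open>LL\<close> it is about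
  \<open>5.9 * 10 ^ 14\<close>; this cubic term is the other place that fixes the size of
  \<open>n\<close>.\<close>

definition \<beta> :: real where "\<beta> = 16 * real (card (B \<union> LL))"

lemma \<beta>: "0 \<le> \<beta>" "\<beta> \<le> (28 / 10000) * real n"
proof -
  have "real (card (B \<union> LL)) \<le> real (card B) + real (card LL)"
    using card_Un_le[of B LL] by linarith
  moreover have "real (card LL) ^ 3 \<le> 48000 ^ 3" using card_LL by (intro power_mono) auto
  ultimately have "real (card (B \<union> LL)) \<le> 48000 ^ 3 / 3 + 48000" using card_B card_LL by linarith
  then show "\<beta> \<le> (28 / 10000) * real n" using nL by (simp add: \<beta>_def)
qed (simp add: \<beta>_def)

text \<open>Vertices outside \<open>B\<close> have at most two neighbours in \<open>LL\<close>; everything else is an error term.\<close>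

lemma walk_sum_main:
  assumes "X \<subseteq> V" "\<And>u. u \<in> X - B \<Longrightarrow> (\<Sum>w\<in>N u \<inter> LL. x w) \<le> c"
    and "0 \<le> c"
  shows "walk_sum X \<le> c * real (card X) + \<beta> + real (card (E \<inter> X \<times> (V - LL))) / 150"
proof -
  have finX: "finite X" using assms(1) finV by (rule finite_subset)
  have "(\<Sum>u\<in>X. \<Sum>w\<in>N u \<inter> LL. x w) = (\<Sum>u\<in>X - B. \<Sum>w\<in>N u \<inter> LL. x w) + (\<Sum>u\<in>X \<inter> B. \<Sum>w\<in>N u \<inter> LL. x w)"
    using finX by (subst sum.union_disjoint[symmetric]) (auto intro: arg_cong[of _ _ "sum _"])
  also have "(\<Sum>u\<in>X - B. \<Sum>w\<in>N u \<inter> LL. x w) \<le> real (card (X - B)) * c"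
    using assms(2) by (intro sum_bounded_above) auto
  also have "real (card (X - B)) * c \<le> real (card X) * c"
    using assms(3) finX by (intro mult_right_mono) (auto intro: card_mono)
  also have "(\<Sum>u\<in>X \<inter> B. \<Sum>w\<in>N u \<inter> LL. x w) \<le> 1 * real (card (E \<inter> (X \<inter> B) \<times> LL))"
    using x L assms(1) by (intro sum_pairs_le) auto
  also have "1 * real (card (E \<inter> (X \<inter> B) \<times> LL)) \<le> 16 * real (card (X \<inter> B \<union> LL))"
    using pairs_le_16[of "X \<inter> B" LL] assms(1) L(1) by auto
  also have "real (card (X \<inter> B \<union> LL)) \<le> real (card (B \<union> LL))"
    using finV L(2) by (auto intro!: card_mono simp: B_def)
  finally have "(\<Sum>u\<in>X. \<Sum>w\<in>N u \<inter> LL. x w) \<le> c * real (card X) + \<beta>"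
    by (simp add: \<beta>_def mult.commute)
  then show ?thesis using walk_sum_split[OF assms(1), of "1/150"] by simp
qed

lemma sum_LL_one_large:
  assumes u: "u \<in> V - B" and c: "c \<in> N u \<inter> LL" and m: "0 \<le> m" "\<And>w. w \<in> N u \<inter> LL \<Longrightarrow> w \<noteq> c \<Longrightarrow> x w \<le> m"
  shows "(\<Sum>w\<in>N u \<inter> LL. x w) \<le> x c + m"
proof -
  have fin: "finite (N u \<inter> LL)" using N(2) by simp
  have "(\<Sum>w\<in>N u \<inter> LL. x w) = x c + (\<Sum>w\<in>N u \<inter> LL - {c}. x w)"
    using fin c by (rule sum.remove)
  also have "(\<Sum>w\<in>N u \<inter> LL - {c}. x w) \<le> real (card (N u \<inter> LL - {c})) * m"
    using m(2) by (intro sum_bounded_above) auto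
  also have "\<dots> \<le> 1 * m"
  proof (rule mult_right_mono[OF _ m(1)])
    have "card (N u \<inter> LL) \<le> 2" using u by (auto simp: B_def)
    then show "real (card (N u \<inter> LL - {c})) \<le> 1" using fin c by simp
  qed
  finally show ?thesis by simp
qed

lemma sum_LL_le_2: "u \<in> V - B \<Longrightarrow> (\<Sum>w\<in>N u \<inter> LL. x w) \<le> 2"
proof -
  assume u: "u \<in> V - B"
  have "(\<Sum>w\<in>N u \<inter> LL. x w) \<le> real (card (N u \<inter> LL)) * 1"
    using x L(1) by (intro sum_bounded_above) auto
  also have "\<dots> \<le> 2" using u by (auto simp: B_def)
  finally show ?thesis .
qed

text \<open>The error 0.1095 n collects \<open>\<beta>\<close> with 0.0028 n and the walks to
  vertices of weight below 1/150, with 16 n / 150 < 0.1067 n.\<close>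

lemma walk_sum_N_le:
  assumes "v \<in> V" "\<And>u. u \<in> N v - B \<Longrightarrow> (\<Sum>w\<in>N u \<inter> LL. x w) \<le> c" "0 \<le> c"
  shows "(2 * real n - 4) * x v \<le> c * real (card (N v)) + (1095 / 10000) * real n"
proof -
  have "(2 * real n - 4) * x v \<le> \<rho>\<^sup>2 * x v" using \<rho>(2) x[OF assms(1)] by (intro mult_right_mono) auto
  also have "\<dots> = walk_sum (N v)" using walk_sum_N[OF assms(1)] by simp
  also have "\<dots> \<le> c * real (card (N v)) + \<beta> + real (card (E \<inter> N v \<times> (V - LL))) / 150"
    using N(1) assms(2,3) by (rule walk_sum_main)
  also have "real (card (E \<inter> N v \<times> (V - LL))) \<le> 16 * real (card (N v \<union> (V - LL)))"
    using N(1) by (intro pairs_le_16) auto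
  also have "real (card (N v \<union> (V - LL))) \<le> real n"
    using card_V finV N(1) by (auto intro!: card_mono)
  finally show ?thesis using \<beta>(2) nL by simp
qed

section \<open>The two dominant vertices\<close>

lemma card_N_le: "card (N v) \<le> n"
  using card_mono[OF finV N(1)] card_V by simp

text \<open>\<open>b\<close> is a vertex of second largest weight. A first count uses 16 arcs per
  vertex and gives rough values for \<open>x b\<close> and the degrees of \<open>a\<close> and
  \<open>b\<close>. These already make the set \<open>R\<close> of vertices outside
  \<open>{a, b} \<union> A\<close> small; a second count, in which most arcs are controlled by
  common neighbourhoods, sharpens the bound on \<open>R\<close> and then the bound on all other
  weights.\<close>

theorem two_large_vertices:
  obtains b where "b \<in> V" "b \<noteq> a" "(889 / 1000) \<le> x b" "(97 / 100) * real n \<le> real (card (N a \<inter> N b))"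
    "\<And>v. v \<in> V - {a, b} \<Longrightarrow> x v \<le> (34 / 1000)"
proof -
  have "V - {a} \<noteq> {}"
  proof
    assume "V - {a} = {}"
    then have "V = {a}" using a(1) by auto
    then show False using card_V nL by simp
  qed
  then obtain b where b: "b \<in> V - {a}" and "Max (x ` (V - {a})) = x b"
    using obtains_MAX[of "V - {a}" x] finV by blast
  then have b_max: "x v \<le> x b" if "v \<in> V - {a}" for v
    using that finV Max_ge[of "x ` (V - {a})" "x v"] by simp
  define m where "m = x b"
  have m01: "0 \<le> m" "m \<le> 1" using x b by (auto simp: m_def)
  have aLL: "a \<in> LL" using a by (simp add: L_def)
  have goodV: "u \<in> V - B" if "u \<in> N v - B" for u v using that N(1) by blast
  have Na: "(\<Sum>w\<in>N u \<inter> LL. x w) \<le> 1 + m" if "u \<in> N a - B" for u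
  proof -
    have "(\<Sum>w\<in>N u \<inter> LL. x w) \<le> x a + m"
    proof (rule sum_LL_one_large[OF goodV[OF that]])
      show "a \<in> N u \<inter> LL" using that aLL N_sym by blast
      show "x w \<le> m" if "w \<in> N u \<inter> LL" "w \<noteq> a" for w
        using b_max[of w] that L(1)[of "1/150"] by (auto simp: m_def)
    qed (rule m01)
    then show ?thesis using a(2) by simp
  qed
  have 1: "2 * real n - 4 \<le> (1 + m) * real (card (N a)) + (1095 / 10000) * real n"
    using walk_sum_N_le[OF a(1) Na] m01 a(2) by simp
  also have "(1 + m) * real (card (N a)) \<le> (1 + m) * real n"
    using m01 card_N_le by (intro mult_left_mono) auto
  finally have "2 * real n - 4 \<le> (1 + m) * real n + (1095 / 10000) * real n" by simp
  moreover have "(1 + m) * real n = real n + m * real n" by (simp add: algebra_simps)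
  \<comment> \<open>2 n - 4 against (1 + m) n + 0.1095 n leaves m close to 0.8905.\<close>
  ultimately have "(889 / 1000) * real n \<le> m * real n" using nL by linarith
  then have m: "(889 / 1000) \<le> m" using nL by simp
  have "(1 + m) * real (card (N a)) \<le> 2 * real (card (N a))" using m01 by (intro mult_right_mono) auto
  then have d1: "(945 / 1000) * real n \<le> real (card (N a))" using 1 nL by simp
  have bLL: "b \<in> LL" using b m by (simp add: L_def m_def)
  have Nb: "(\<Sum>w\<in>N u \<inter> LL. x w) \<le> m + 1" if "u \<in> N b - B" for u
  proof -
    have "(\<Sum>w\<in>N u \<inter> LL. x w) \<le> x b + 1"
    proof (rule sum_LL_one_large[OF goodV[OF that]])
      show "b \<in> N u \<inter> LL" using that bLL N_sym by blast
      show "x w \<le> 1" if "w \<in> N u \<inter> LL" "w \<noteq> b" for w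
        using x[of w] that L(1)[of "1/150"] by auto
    qed simp
    then show ?thesis by (simp add: m_def)
  qed
  have 2: "(2 * real n - 4) * m \<le> (m + 1) * real (card (N b)) + (1095 / 10000) * real n"
    unfolding m_def by (rule walk_sum_N_le) (use b Nb m01 in \<open>auto simp: m_def\<close>)
  \<comment> \<open>A smaller degree would give 1.12 m at most about 0.88 + 0.1095 = 0.9895, whereas
    1.12 times 0.889 exceeds 0.995.\<close>
  have d2: "(88 / 100) * real n \<le> real (card (N b))"
  proof (rule ccontr)
    assume "\<not> ?thesis"
    then have "(m + 1) * real (card (N b)) \<le> (m + 1) * ((88 / 100) * real n)"
      using m01 by (intro mult_left_mono) auto
    with 2 have "m * ((112 / 100) * real n - 4) \<le> (9895 / 10000) * real n" by (simp add: algebra_simps)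
    moreover have "(889 / 1000) * ((112 / 100) * real n - 4) \<le> m * ((112 / 100) * real n - 4)"
      using m nL by (intro mult_right_mono) auto
    ultimately show False using nL by simp
  qed
  define A where "A = N a \<inter> N b"
  define R where "R = V - {a, b} - A"
  have AV: "A \<subseteq> V" "a \<notin> A" "b \<notin> A" "finite A" using N by (auto simp: A_def)
  have RV: "R \<subseteq> V" "finite R" using finV by (auto simp: R_def)
  have ab: "a \<noteq> b" "a \<in> V" "b \<in> V" using a b by auto
  have split: "V = {a, b} \<union> A \<union> R" using ab AV by (auto simp: R_def)
  have "card V = card {a, b} + card A + card R"
    unfolding split using AV RV by (subst card_Un_disjoint; (subst card_Un_disjoint)?) (auto simp: R_def)
  then have nAR: "real n = 2 + real (card A) + real (card R)" using ab card_V by simp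
  have "card (N a) + card (N b) = card (N a \<union> N b) + card A"
    unfolding A_def using N(2) N(2) by (rule card_Un_Int)
  moreover have "card (N a \<union> N b) \<le> n" using card_mono[OF finV] N(1) card_V by (metis Un_least)
  ultimately have "real (card (N a)) + real (card (N b)) \<le> real n + real (card A)" by linarith
  then have R1: "real (card R) \<le> (175 / 1000) * real n" using d1 d2 nAR by simp
  have few: "card (N v \<inter> A) \<le> 2" if "v \<in> V - {a, b}" for v
  proof -
    have "card (N a \<inter> N b \<inter> N v) \<le> 2" using that ab by (intro card_common_neighbours_le_2) auto
    then show ?thesis by (simp add: A_def Int_commute)
  qed
  have deg: "real (card (N v)) \<le> 4 + real (card R)" if "v \<in> V - {a, b}" for v
  proof -
    have "N v \<subseteq> {a, b} \<union> (N v \<inter> A) \<union> R" using N(1)[of v] split by auto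
    then have "card (N v) \<le> card ({a, b} \<union> (N v \<inter> A) \<union> R)" using RV AV by (intro card_mono) auto
    also have "\<dots> \<le> card {a, b} + card (N v \<inter> A) + card R"
      using card_Un_le[of "{a, b} \<union> (N v \<inter> A)" R] card_Un_le[of "{a, b}" "N v \<inter> A"] by linarith
    also have "\<dots> \<le> 2 + 2 + card R" using few[OF that] ab by simp
    finally show ?thesis by linarith
  qed
  \<comment> \<open>The degree of \<open>v\<close> is essentially at most 0.175 n, and 2 times 0.175
    plus 0.1095 is just below 2 times 0.23.\<close>
  have small1: "x v \<le> (23 / 100)" if v: "v \<in> V - {a, b}" for v
  proof -
    have "(2 * real n - 4) * x v \<le> 2 * real (card (N v)) + (1095 / 10000) * real n"
      by (rule walk_sum_N_le) (use v sum_LL_le_2 goodV in auto)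
    also have "\<dots> \<le> (23 / 100) * (2 * real n - 4)" using deg[OF v] R1 nL by simp
    finally have "(2 * real n - 4) * x v \<le> (2 * real n - 4) * (23 / 100)" by (simp only: mult.commute)
    then show ?thesis by (rule mult_left_le_imp_le) (use nL in simp)
  qed
  \<comment> \<open>Away from \<open>a\<close> and \<open>b\<close> a vertex has at most two
    neighbours in \<open>A\<close>. Since \<open>V - LL\<close> lies in \<open>A \<union> R\<close>,
    the arcs into it drop from 16 n to about 2 n for walks through \<open>A\<close>, and to 18 per
    vertex of \<open>R\<close> for walks through \<open>R\<close>.\<close>
  have pairs_A: "real (card (E \<inter> X \<times> A)) \<le> 2 * real (card X)" if X: "X \<subseteq> V - {a, b}" for X
  proof -
    have finX: "finite X" using X finV by (auto intro: finite_subset)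
    have "card (E \<inter> X \<times> A) = (\<Sum>u\<in>X. card (N u \<inter> A))" using finX by (rule card_pairs)
    also have "\<dots> \<le> (\<Sum>u\<in>X. 2)" using few X by (intro sum_mono) auto
    finally show ?thesis using finX by simp
  qed
  have sub: "A \<subseteq> V - {a, b}" "R \<subseteq> V - {a, b}" using AV by (auto simp: R_def)
  have pairs_AR: "real (card (E \<inter> A \<times> R)) \<le> 2 * real (card R)"
  proof -
    have "E \<inter> A \<times> R = (E \<inter> R \<times> A)\<inverse>" using symE by (auto dest: symD)
    then have "card (E \<inter> A \<times> R) = card (E \<inter> R \<times> A)" by simp
    then show ?thesis using pairs_A[OF sub(2)] by simp
  qed
  have pairs_RR: "real (card (E \<inter> R \<times> R)) \<le> 16 * real (card R)" using pairs_le_16[of R R] RV by simp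
  have LLsub: "V - LL \<subseteq> A \<union> R" using split aLL bLL by auto
  have pairs_R: "real (card (E \<inter> X \<times> (V - LL))) \<le> 18 * real (card R)" if X: "X \<subseteq> R" for X
  proof -
    have "E \<inter> X \<times> (V - LL) \<subseteq> (E \<inter> R \<times> A) \<union> (E \<inter> R \<times> R)" using X LLsub by auto
    then have "card (E \<inter> X \<times> (V - LL)) \<le> card ((E \<inter> R \<times> A) \<union> (E \<inter> R \<times> R))" using finE by (intro card_mono) auto
    also have "\<dots> \<le> card (E \<inter> R \<times> A) + card (E \<inter> R \<times> R)" by (rule card_Un_le)
    finally show ?thesis using pairs_A[OF sub(2)] pairs_RR by linarith
  qed
  have pairs_A': "real (card (E \<inter> A \<times> (V - LL))) \<le> 2 * real (card A) + 2 * real (card R)"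
  proof -
    have "E \<inter> A \<times> (V - LL) \<subseteq> (E \<inter> A \<times> A) \<union> (E \<inter> A \<times> R)" using LLsub by auto
    then have "card (E \<inter> A \<times> (V - LL)) \<le> card ((E \<inter> A \<times> A) \<union> (E \<inter> A \<times> R))" using finE by (intro card_mono) auto
    also have "\<dots> \<le> card (E \<inter> A \<times> A) + card (E \<inter> A \<times> R)" by (rule card_Un_le)
    finally show ?thesis using pairs_A[OF sub(1)] pairs_AR by linarith
  qed
  \<comment> \<open>A neighbour of \<open>a\<close> in \<open>R\<close> is not adjacent to
    \<open>b\<close>, so outside \<open>B\<close> its neighbours in \<open>LL\<close> weigh at most
    1 + 0.23 instead of 2. With 18/150 = 0.12 for its walks to light vertices, each vertex of
    \<open>R\<close> costs 2 - 1.23 - 0.12 = 0.65, while the errors 2 n / 150 and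
    \<open>2 * \<beta>\<close> allow only about 0.019 n.\<close>
  have R2: "real (card R) \<le> (298 / 10000) * real n"
  proof -
    define Ra where "Ra = R \<inter> N a"
    have "2 * real n - 4 \<le> walk_sum (N a)" using walk_sum_N[OF a(1)] a(2) \<rho>(2) by simp
    also have "\<dots> \<le> walk_sum (A \<union> Ra \<union> {b})"
    proof (rule walk_sum_mono)
      show "N a \<subseteq> A \<union> Ra \<union> {b}" using N(1)[of a] N(3)[of a] split by (auto simp: Ra_def)
    qed (use AV ab RV in \<open>auto simp: Ra_def\<close>)
    also have "\<dots> = walk_sum A + walk_sum Ra + walk_sum {b}"
    proof -
      have "walk_sum (A \<union> Ra \<union> {b}) = walk_sum (A \<union> Ra) + walk_sum {b}"
        using AV RV by (intro walk_sum_Un) (auto simp: Ra_def R_def)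
      moreover have "walk_sum (A \<union> Ra) = walk_sum A + walk_sum Ra"
        using AV RV by (intro walk_sum_Un) (auto simp: Ra_def R_def)
      ultimately show ?thesis by simp
    qed
    also have "walk_sum {b} \<le> \<rho>" using walk_sum_le_card[of "{b}"] ab by simp
    also have "walk_sum A \<le> 2 * real (card A) + \<beta> + real (card (E \<inter> A \<times> (V - LL))) / 150"
      by (rule walk_sum_main) (use AV sum_LL_le_2 in auto)
    also have "walk_sum Ra \<le> (123 / 100) * real (card Ra) + \<beta> + real (card (E \<inter> Ra \<times> (V - LL))) / 150"
    proof (rule walk_sum_main)
      fix u assume u: "u \<in> Ra - B"
      have "a \<in> N u \<inter> LL" "b \<notin> N u" using u aLL N_sym by (auto simp: Ra_def R_def A_def)
      moreover have "x w \<le> (23 / 100)" if "w \<in> N u \<inter> LL" "w \<noteq> a" for w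
        using that small1[of w] L(1)[of "1/150"] \<open>b \<notin> N u\<close> by auto
      ultimately show "(\<Sum>w\<in>N u \<inter> LL. x w) \<le> (123 / 100)"
        using sum_LL_one_large[of u a "(23 / 100)"] u RV a(2) by (auto simp: Ra_def)
    qed (use RV in \<open>auto simp: Ra_def\<close>)
    also have "real (card (E \<inter> Ra \<times> (V - LL))) \<le> 18 * real (card R)" by (rule pairs_R) (simp add: Ra_def)
    also have "real (card Ra) \<le> real (card R)" using RV by (auto intro!: card_mono simp: Ra_def)
    finally have "2 * real n - 4 \<le> 2 * real (card A) + \<beta> + real (card (E \<inter> A \<times> (V - LL))) / 150 +
        ((123 / 100) * real (card R) + \<beta> + 18 * real (card R) / 150) + \<rho>"
      by simp
    then show ?thesis using pairs_A' nAR \<rho>_bounds(2) s_le \<beta>(2) nL by linarith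
  qed
  \<comment> \<open>At most four neighbours lie in \<open>{a, b} \<union> A\<close>, costing
    \<open>4 * \<rho>\<close>. The others lie in \<open>R\<close> and give about 2.12 times 0.0298
    plus 0.0028, which is below 2 times 0.034.\<close>
  have small2: "x v \<le> (34 / 1000)" if v: "v \<in> V - {a, b}" for v
  proof -
    define Y where "Y = {a, b} \<union> (N v \<inter> A)"
    define X where "X = N v \<inter> R"
    have YX: "Y \<inter> X = {}" "Y \<subseteq> V" "X \<subseteq> V" "finite Y" "finite X" using AV ab RV by (auto simp: Y_def X_def R_def)
    have cY: "card Y \<le> 4"
      using card_Un_le[of "{a, b}" "N v \<inter> A"] few[OF v] ab by (simp add: Y_def)
    have "(2 * real n - 4) * x v \<le> \<rho>\<^sup>2 * x v" using \<rho>(2) x v by (intro mult_right_mono) auto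
    also have "\<dots> = walk_sum (N v)" using walk_sum_N v by simp
    also have "\<dots> \<le> walk_sum (Y \<union> X)"
      by (rule walk_sum_mono) (use YX N(1)[of v] split in \<open>auto simp: Y_def X_def\<close>)
    also have "\<dots> = walk_sum Y + walk_sum X" using YX by (intro walk_sum_Un) auto
    also have "walk_sum Y \<le> \<rho> * real (card Y)" using YX by (intro walk_sum_le_card) auto
    also have "\<rho> * real (card Y) \<le> \<rho> * 4" using cY \<rho>(1) by (intro mult_left_mono) auto
    also have "walk_sum X \<le> 2 * real (card X) + \<beta> + real (card (E \<inter> X \<times> (V - LL))) / 150"
      by (rule walk_sum_main) (use YX sum_LL_le_2 in auto)
    also have "real (card (E \<inter> X \<times> (V - LL))) \<le> 18 * real (card R)" by (rule pairs_R) (simp add: X_def)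
    also have "real (card X) \<le> real (card R)" using RV by (auto intro!: card_mono simp: X_def)
    finally have "(2 * real n - 4) * x v \<le> \<rho> * 4 + (2 * real (card R) + \<beta> + 18 * real (card R) / 150)" by simp
    also have "\<dots> \<le> (34 / 1000) * (2 * real n - 4)" using R2 \<rho>_bounds(2) s_le \<beta>(2) nL by simp
    finally have "(2 * real n - 4) * x v \<le> (2 * real n - 4) * (34 / 1000)" by (simp only: mult.commute)
    then show ?thesis by (rule mult_left_le_imp_le) (use nL in simp)
  qed
  show thesis
  proof (rule that[of b])
    show "(97 / 100) * real n \<le> real (card (N a \<inter> N b))" using R2 nAR nL by (simp add: A_def)
  qed (use ab m small2 in \<open>auto simp: m_def\<close>)
qed

end

section \<open>Comparison graphs\<close>

lemma contains_copy_trans: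
  assumes "contains_copy H F" "contains_copy G H"
  shows "contains_copy G F"
proof -
  obtain f where f: "inj_on f (pverts F)" "f ` pverts F \<subseteq> pverts H" "\<forall>(u, v)\<in>parcs F. (f u, f v) \<in> parcs H"
    using assms(1) by (auto simp: contains_copy_def)
  obtain g where g: "inj_on g (pverts H)" "g ` pverts H \<subseteq> pverts G" "\<forall>(u, v)\<in>parcs H. (g u, g v) \<in> parcs G"
    using assms(2) by (auto simp: contains_copy_def)
  have "inj_on (g \<circ> f) (pverts F)"
    using f g by (intro comp_inj_on) (auto intro: inj_on_subset)
  then show ?thesis
    unfolding contains_copy_def using f g by (intro exI[of _ "g \<circ> f"]) fastforce
qed

lemma graph_spectral_radius_le_spex_planar:
  assumes "pair_graph H" "pverts H = {..<n}" "planar H" "\<not> contains_copy H F"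
  shows "graph_spectral_radius H \<le> spex_planar n F"
proof -
  let ?S = "{graph_spectral_radius H | H :: nat pair_pre_digraph.
     pair_graph H \<and> pverts H = {..<n} \<and> planar H \<and> \<not> contains_copy H F}"
  have "?S \<subseteq> (\<lambda>E. graph_spectral_radius \<lparr>pverts = {..<n}, parcs = E\<rparr>) ` Pow ({..<n} \<times> {..<n})"
  proof
    fix r assume "r \<in> ?S"
    then obtain H :: "nat pair_pre_digraph" where H: "r = graph_spectral_radius H" "pair_graph H" "pverts H = {..<n}"
      by blast
    then have "parcs H \<subseteq> {..<n} \<times> {..<n}" "H = \<lparr>pverts = {..<n}, parcs = parcs H\<rparr>"
      by (simp_all add: pair_graph_iff)
    then show "r \<in> (\<lambda>E. graph_spectral_radius \<lparr>pverts = {..<n}, parcs = E\<rparr>) ` Pow ({..<n} \<times> {..<n})"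
      using H(1) by (intro image_eqI[of _ _ "parcs H"]) auto
  qed
  then have "finite ?S" by (rule finite_subset) auto
  then show ?thesis unfolding spex_planar_def using assms by (intro Max_ge) auto
qed

text \<open>The quadratic form of the adjacency matrix as a sum over arcs, so that exchanging arcs
  amounts to splitting a disjoint union.\<close>

definition arc_sum :: "('a \<Rightarrow> real) \<Rightarrow> ('a \<times> 'a) set \<Rightarrow> real" where
  "arc_sum x F = (\<Sum>(u, v)\<in>F. x u * x v)"

lemma arc_sum_Un: "finite F \<Longrightarrow> finite F' \<Longrightarrow> F \<inter> F' = {} \<Longrightarrow> arc_sum x (F \<union> F') = arc_sum x F + arc_sum x F'"
  unfolding arc_sum_def by (rule sum.union_disjoint)

lemma arc_sum_converse: "arc_sum x (F\<inverse>) = arc_sum x F"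
  unfolding arc_sum_def
  by (rule sum.reindex_bij_witness[of _ prod.swap prod.swap]) (auto simp: mult.commute)

lemma arc_sum_Sigma: "finite X \<Longrightarrow> (\<And>u. u \<in> X \<Longrightarrow> finite (Y u)) \<Longrightarrow> arc_sum x (Sigma X Y) = (\<Sum>u\<in>X. x u * (\<Sum>v\<in>Y u. x v))"
  unfolding arc_sum_def by (simp add: sum.Sigma sum_distrib_left)

lemma adj_form_eq_arc_sum:
  assumes "finite V" "E \<subseteq> V \<times> V"
  shows "adj_form E V x = arc_sum x E"
proof -
  have "adj_form E V x = (\<Sum>(u, v)\<in>V \<times> V. adj E u v * x u * x v)"
    unfolding adj_form_def using assms(1) by (simp add: sum.cartesian_product)
  also have "\<dots> = (\<Sum>(u, v)\<in>V \<times> V. if (u, v) \<in> E then x u * x v else 0)"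
    by (intro sum.cong) (auto simp: adj_def)
  also have "\<dots> = (\<Sum>p\<in>V \<times> V. if p \<in> E then (case p of (u, v) \<Rightarrow> x u * x v) else 0)"
    by (intro sum.cong) auto
  also have "\<dots> = (\<Sum>p\<in>V \<times> V \<inter> E. case p of (u, v) \<Rightarrow> x u * x v)"
    using assms(1) by (simp add: sum.inter_restrict)
  also have "V \<times> V \<inter> E = E" using assms(2) by auto
  finally show ?thesis by (simp add: arc_sum_def)
qed

section \<open>The lower bound for the spectral radius from K_{2,n-2}\<close>

definition two_pole_graph :: "nat \<Rightarrow> nat pair_pre_digraph" where
  "two_pole_graph n = \<lparr>pverts = {..<n}, parcs = {(i, j). i < n \<and> j < n \<and> (i < 2 \<longleftrightarrow> \<not> j < 2)}\<rparr>"

text \<open>The graph is K_{2,n-2} on the labels of the fan, with poles 0 and 1. The third claim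
  embeds it into \<open>complete_bipartite_graph 2 (n - 2)\<close>, so that a copy of
  \<open>F\<close> in it would be one there.\<close>

lemma two_pole_graph:
  assumes "2 \<le> n"
  shows "pair_graph (two_pole_graph n)" "planar (two_pole_graph n)"
    "contains_copy (complete_bipartite_graph 2 (n - 2)) (two_pole_graph n)"
    "2 * real n - 4 \<le> (graph_spectral_radius (two_pole_graph n))\<^sup>2" "0 \<le> graph_spectral_radius (two_pole_graph n)"
proof -
  let ?K = "two_pole_graph n"
  have pv: "pverts ?K = {..<n}" by (simp add: two_pole_graph_def)
  have sub: "parcs ?K \<subseteq> {..<n} \<times> {..<n}" by (auto simp: two_pole_graph_def)
  show pg: "pair_graph ?K"
    using sub pv by (auto simp: pair_graph_iff two_pole_graph_def sym_def irrefl_def)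
  show "planar ?K" using pv by (rule planar_fan) (auto simp: two_pole_graph_def fan_arcs_def)
  show "contains_copy (complete_bipartite_graph 2 (n - 2)) ?K"
    unfolding contains_copy_def
  proof (intro exI[of _ "\<lambda>i. if i < 2 then Inl i else Inr (i - 2)"] conjI)
    show "inj_on (\<lambda>i. if i < 2 then Inl i else Inr (i - 2)) (pverts ?K)" by (auto simp: inj_on_def split: if_splits)
    show "(\<lambda>i. if i < 2 then Inl i else Inr (i - 2)) ` pverts ?K \<subseteq> pverts (complete_bipartite_graph 2 (n - 2))"
      using assms by (auto simp: complete_bipartite_graph_def pv)
    show "\<forall>(u, v)\<in>parcs ?K. (if u < 2 then Inl u else Inr (u - 2), if v < 2 then Inl v else Inr (v - 2))
        \<in> parcs (complete_bipartite_graph 2 (n - 2))"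
      using assms by (auto simp: complete_bipartite_graph_def two_pole_graph_def)
  qed
  have symE: "sym (parcs ?K)" using pg by (simp add: pair_graph_iff)
  have ne: "pverts ?K \<noteq> {}" "finite (pverts ?K)" using assms pv by (auto simp: lessThan_empty_iff)
  define \<rho> where "\<rho> = graph_spectral_radius ?K"
  note ray = graph_spectral_radius_rayleigh(1)[OF ne(2,1) symE, folded \<rho>_def]
  define k where "k = real (n - 2)"
  have k: "0 \<le> k" "real n = k + 2" using assms by (simp_all add: k_def)
  \<comment> \<open>With weight \<open>c\<close> on the poles and 1 elsewhere, \<open>z\<close> is
    the Perron vector of K_{2,k}: its Rayleigh quotient is 4 k c / (2 k) = sqrt (2 k). The case
    \<open>k = 0\<close> is treated apart because \<open>z\<close> then vanishes.\<close>
  define c where "c = sqrt (k / 2)"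
  have c: "0 \<le> c" "c\<^sup>2 = k / 2" using k by (simp_all add: c_def)
  define z where "z i = (if i < (2::nat) then c else 1)" for i
  have V2: "{..<n} = {..<2} \<union> {2..<n}" using assms by auto
  have "(\<Sum>v<n. (z v)\<^sup>2) = (\<Sum>v<2. (z v)\<^sup>2) + (\<Sum>v=2..<n. (z v)\<^sup>2)"
    unfolding V2 by (rule sum.union_disjoint) auto
  also have "(\<Sum>v<2. (z v)\<^sup>2) = 2 * c\<^sup>2" by (simp add: z_def numeral_2_eq_2)
  also have "(\<Sum>v=2..<n. (z v)\<^sup>2) = k" by (simp add: z_def k_def)
  finally have nz: "(\<Sum>v<n. (z v)\<^sup>2) = 2 * k" using c by simp
  have "parcs ?K = {..<2} \<times> {2..<n} \<union> {2..<n} \<times> {..<2}"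
    using assms by (auto simp: two_pole_graph_def)
  then have "adj_form (parcs ?K) (pverts ?K) z = arc_sum z ({..<2} \<times> {2..<n} \<union> {2..<n} \<times> {..<2})"
    using adj_form_eq_arc_sum[of "pverts ?K" "parcs ?K" z] sub ne(2) pv by simp
  also have "\<dots> = arc_sum z ({..<2} \<times> {2..<n}) + arc_sum z ({2..<n} \<times> {..<2})"
    by (rule arc_sum_Un) auto
  also have "\<dots> = 4 * (k * c)"
    by (simp add: arc_sum_Sigma z_def numeral_2_eq_2 k_def algebra_simps)
  finally have "4 * (k * c) \<le> \<rho> * (2 * k)" using ray[of z] nz pv by simp
  then have cr: "2 * c \<le> \<rho>" if "k > 0" using that by (simp add: mult_ac)
  show r0: "0 \<le> graph_spectral_radius ?K"
  proof (cases "k > 0")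
    case True
    then show ?thesis using cr c by (simp add: \<rho>_def)
  next
    case False
    have "adj_form (parcs ?K) (pverts ?K) (\<lambda>_. 1) \<ge> 0"
      unfolding adj_form_def by (intro sum_nonneg) (auto simp: adj_def)
    then have "0 \<le> \<rho> * real n" using ray[of "\<lambda>_. 1"] pv by simp
    then show ?thesis using assms by (simp add: \<rho>_def zero_le_mult_iff)
  qed
  show "2 * real n - 4 \<le> (graph_spectral_radius ?K)\<^sup>2"
  proof (cases "k > 0")
    case True
    have "(2 * c)\<^sup>2 \<le> \<rho>\<^sup>2" using cr[OF True] c(1) by (intro power_mono) auto
    then show ?thesis using c(2) k(2) by (simp add: power_mult_distrib \<rho>_def)
  next
    case False
    then show ?thesis using k by simp
  qed
qed

section \<open>The gain from joining the remaining vertices to both poles\<close>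

context plane_graph
begin

lemma low_degree_vertex:
  assumes "W \<subseteq> V" "W \<noteq> {}"
  obtains v where "v \<in> W" "card (E `` {v} \<inter> W) \<le> 15"
proof -
  have "\<exists>v\<in>W. card (E `` {v} \<inter> W) \<le> 15"
  proof (rule ccontr)
    assume "\<not> ?thesis"
    then have *: "16 \<le> card (E `` {v} \<inter> W)" if "v \<in> W" for v using that by force
    have finW: "finite W" using assms(1) finV by (rule finite_subset)
    have "16 * card W = (\<Sum>v\<in>W. 16)" by simp
    also have "\<dots> \<le> (\<Sum>v\<in>W. card ((E \<inter> W \<times> W) `` {v}))"
    proof (rule sum_mono)
      fix v assume v: "v \<in> W"
      then have "(E \<inter> W \<times> W) `` {v} = E `` {v} \<inter> W" by auto
      then show "16 \<le> card ((E \<inter> W \<times> W) `` {v})" using *[OF v] by simp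
    qed
    also have "\<dots> = card (E \<inter> W \<times> W)" using finW by (intro card_arcs_eq_sum[symmetric]) auto
    finally show False using arcs_less[OF assms] by simp
  qed
  then show thesis using that by blast
qed

text \<open>Vertices of degree at most 15 are peeled off one after another. Each arc is charged to
  the end that is removed first: 15 neighbours of weight at most \<open>c\<close>, counted in both
  directions, give 30.\<close>

lemma arc_sum_induced_le:
  assumes "W \<subseteq> V" "\<And>v. v \<in> W \<Longrightarrow> 0 \<le> x v \<and> x v \<le> c"
  shows "arc_sum x (E \<inter> W \<times> W) \<le> 30 * c * (\<Sum>v\<in>W. x v)"
  using assms
proof (induction "card W" arbitrary: W)
  case 0
  then have "W = {}" using finV by (auto dest: finite_subset)
  then show ?case by (simp add: arc_sum_def)
next
  case (Suc k)
  have finW: "finite W" using Suc.prems(1) finV by (rule finite_subset)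
  have "W \<noteq> {}" using Suc.hyps(2) by auto
  then obtain v where v: "v \<in> W" "card (E `` {v} \<inter> W) \<le> 15" using low_degree_vertex Suc.prems(1) by blast
  define Y where "Y = E `` {v} \<inter> W"
  define W' where "W' = W - {v}"
  have Y: "finite Y" "Y \<subseteq> W'" "v \<notin> Y" using finW irreflE by (auto simp: Y_def W'_def irrefl_def)
  have "E \<inter> W \<times> W = (E \<inter> W' \<times> W') \<union> ({v} \<times> Y \<union> ({v} \<times> Y)\<inverse>)"
    using v(1) symE irreflE by (auto simp: Y_def W'_def irrefl_def dest: symD)
  then have "arc_sum x (E \<inter> W \<times> W) = arc_sum x (E \<inter> W' \<times> W') + arc_sum x ({v} \<times> Y \<union> ({v} \<times> Y)\<inverse>)"
    using Y finW by (simp only:) (rule arc_sum_Un; auto simp: W'_def)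
  also have "arc_sum x ({v} \<times> Y \<union> ({v} \<times> Y)\<inverse>) = arc_sum x ({v} \<times> Y) + arc_sum x ({v} \<times> Y)"
    using Y by (subst arc_sum_Un) (auto simp: arc_sum_converse)
  also have "arc_sum x ({v} \<times> Y) = x v * (\<Sum>w\<in>Y. x w)" using Y by (simp add: arc_sum_Sigma)
  also have "arc_sum x (E \<inter> W' \<times> W') \<le> 30 * c * (\<Sum>v\<in>W'. x v)"
    using Suc.prems v finW Suc.hyps(2) by (intro Suc.hyps(1)) (auto simp: W'_def)
  finally have *: "arc_sum x (E \<inter> W \<times> W) \<le> 30 * c * (\<Sum>v\<in>W'. x v) + 2 * (x v * (\<Sum>w\<in>Y. x w))" by simp
  have c0: "0 \<le> c" using Suc.prems(2)[OF v(1)] by linarith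
  have "(\<Sum>w\<in>Y. x w) \<le> real (card Y) * c" using Suc.prems(2) Y by (intro sum_bounded_above) (auto simp: Y_def)
  also have "\<dots> \<le> 15 * c" using v(2) c0 by (intro mult_right_mono) (auto simp: Y_def)
  finally have "x v * (\<Sum>w\<in>Y. x w) \<le> x v * (15 * c)" using Suc.prems(2)[OF v(1)] by (intro mult_left_mono) auto
  moreover have "(\<Sum>v\<in>W. x v) = x v + (\<Sum>v\<in>W'. x v)" unfolding W'_def using finW v(1) by (rule sum.remove)
  ultimately show ?case using * by (simp add: algebra_simps)
qed

end

lemma contains_copy_join_path:
  assumes "a \<noteq> b" "a \<in> pverts G" "b \<in> pverts G" "sym (parcs G)" "irrefl (parcs G)"
    and A: "A \<subseteq> pverts G" "A \<subseteq> parcs G `` {a} \<inter> parcs G `` {b}"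
    and ps: "distinct ps" "set ps \<subseteq> A" "successively (\<lambda>x y. (x, y) \<in> parcs G) ps" "m \<le> length ps"
  shows "contains_copy G (graph_join (isolated_graph 2) (path_graph m))"
proof -
  define f where "f s = (case s of Inl i \<Rightarrow> if i = (0::nat) then a else b | Inr i \<Rightarrow> ps ! i)" for s
  have abA: "a \<notin> A" "b \<notin> A" using A(2) assms(5) by (auto simp: irrefl_def)
  have psA: "ps ! i \<in> A" if "i < m" for i using ps(2,4) that by (auto dest: nth_mem)
  have step: "(ps ! i, ps ! Suc i) \<in> parcs G" if "Suc i < m" for i
    using ps(3,4) that by (auto simp: successively_conv_nth)
  have nb: "(a, y) \<in> parcs G" "(b, y) \<in> parcs G" "(y, a) \<in> parcs G" "(y, b) \<in> parcs G" if "y \<in> A" for y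
    using that A(2) assms(4) by (auto dest: symD)
  show ?thesis
    unfolding contains_copy_def
  proof (intro exI[of _ f] conjI)
    show "inj_on f (pverts (graph_join (isolated_graph 2) (path_graph m)))"
    proof (rule inj_onI)
      fix s t assume st: "s \<in> pverts (graph_join (isolated_graph 2) (path_graph m))"
        "t \<in> pverts (graph_join (isolated_graph 2) (path_graph m))" "f s = f t"
      then show "s = t"
        using assms(1) abA psA ps(1,4)
        by (auto simp: graph_join_def isolated_graph_def path_graph_def f_def nth_eq_iff_index_eq less_2_cases_iff split: if_splits)
    qed
    show "f ` pverts (graph_join (isolated_graph 2) (path_graph m)) \<subseteq> pverts G"
      using assms(2,3) A(1) psA by (auto simp: graph_join_def isolated_graph_def path_graph_def f_def)
    show "\<forall>(u, v)\<in>parcs (graph_join (isolated_graph 2) (path_graph m)). (f u, f v) \<in> parcs G"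
      using step nb psA symD[OF assms(4) step]
      by (auto simp: graph_join_def isolated_graph_def path_graph_def f_def)
  qed
qed

text \<open>A vertex \<open>r\<close> of \<open>R\<close> gains both poles. It gives up at most one
  pole, as it is not in \<open>A\<close>, and at most two vertices of \<open>A\<close>, so
  \<open>m - 2 * c\<close> remains. The arcs inside \<open>R\<close> cost 30 c per vertex, or 15 c
  after the common factor 2 is taken out; hence 17 = 2 + 15.\<close>

lemma (in plane_graph) arc_sum_gain:
  fixes x :: "'a \<Rightarrow> real" and A R :: "'a set"
  assumes ab: "a \<noteq> b" "a \<in> V" "b \<in> V" and A: "A = E `` {a} \<inter> E `` {b}" and R: "R = V - {a, b} - A"
    and x: "\<And>v. v \<in> V \<Longrightarrow> 0 \<le> x v" "m \<le> x a" "m \<le> x b" "\<And>v. v \<in> V - {a, b} \<Longrightarrow> x v \<le> c"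
    and E1: "E1 = (E \<inter> ({a, b} \<union> A) \<times> ({a, b} \<union> A)) \<union> ({a, b} \<times> R) \<union> (R \<times> {a, b})"
  shows "arc_sum x E + 2 * (m - 17 * c) * (\<Sum>r\<in>R. x r) \<le> arc_sum x E1"
proof -
  let ?P = "{a, b}"
  define C where "C = ?P \<union> A"
  have AV: "A \<subseteq> V" "a \<notin> A" "b \<notin> A" using A EV irreflE by (auto simp: irrefl_def)
  have fin: "finite A" "finite R" "finite E" "finite C"
    using AV finV R finite_subset[OF EV] by (auto simp: C_def intro: finite_subset)
  have CR: "V = C \<union> R" "C \<inter> R = {}" "?P \<inter> R = {}" "?P \<inter> A = {}" "A \<inter> R = {}"
    using ab AV R by (auto simp: C_def)
  have "E1 = (E \<inter> C \<times> C) \<union> (R \<times> ?P \<union> (R \<times> ?P)\<inverse>)" using E1 by (auto simp: C_def)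
  also have "arc_sum x \<dots> = arc_sum x (E \<inter> C \<times> C) + arc_sum x (R \<times> ?P \<union> (R \<times> ?P)\<inverse>)"
    using fin CR by (intro arc_sum_Un) auto
  also have "arc_sum x (R \<times> ?P \<union> (R \<times> ?P)\<inverse>) = 2 * arc_sum x (R \<times> ?P)"
    using fin CR by (subst arc_sum_Un) (auto simp: arc_sum_converse)
  also have "arc_sum x (R \<times> ?P) = (\<Sum>r\<in>R. x r * (x a + x b))"
    using fin ab by (simp add: arc_sum_Sigma)
  finally have 1: "arc_sum x E1 = arc_sum x (E \<inter> C \<times> C) + 2 * (\<Sum>r\<in>R. x r * (x a + x b))" .
  define Z where "Z r = E `` {r} \<inter> C" for r
  have Z: "Z r \<subseteq> C" "finite (Z r)" for r using fin by (auto simp: Z_def)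
  have ZR: "v \<notin> Z r" if "v \<in> R" for v r using that CR(2) by (auto simp: Z_def)
  have "E = (E \<inter> C \<times> C) \<union> ((E \<inter> R \<times> R) \<union> (Sigma R Z \<union> (Sigma R Z)\<inverse>))"
    using EV CR(1) symE by (auto simp: Z_def dest: symD)
  also have "arc_sum x \<dots> = arc_sum x (E \<inter> C \<times> C) + arc_sum x ((E \<inter> R \<times> R) \<union> (Sigma R Z \<union> (Sigma R Z)\<inverse>))"
    using fin CR Z ZR by (intro arc_sum_Un) auto
  also have "arc_sum x ((E \<inter> R \<times> R) \<union> (Sigma R Z \<union> (Sigma R Z)\<inverse>)) = arc_sum x (E \<inter> R \<times> R) + arc_sum x (Sigma R Z \<union> (Sigma R Z)\<inverse>)"
    using fin CR Z ZR by (intro arc_sum_Un) auto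
  also have "arc_sum x (Sigma R Z \<union> (Sigma R Z)\<inverse>) = 2 * arc_sum x (Sigma R Z)"
    using fin CR Z ZR by (subst arc_sum_Un) (auto simp: arc_sum_converse)
  also have "arc_sum x (Sigma R Z) = (\<Sum>r\<in>R. x r * (\<Sum>v\<in>Z r. x v))"
    using fin Z by (intro arc_sum_Sigma) auto
  finally have 2: "arc_sum x E = arc_sum x (E \<inter> C \<times> C) + (arc_sum x (E \<inter> R \<times> R) + 2 * (\<Sum>r\<in>R. x r * (\<Sum>v\<in>Z r. x v)))" .
  have 3: "arc_sum x (E \<inter> R \<times> R) \<le> 30 * c * (\<Sum>r\<in>R. x r)"
    using x R by (intro arc_sum_induced_le) auto
  have "(\<Sum>r\<in>R. x r * (\<Sum>v\<in>Z r. x v)) + (\<Sum>r\<in>R. x r * (m - 2 * c)) \<le> (\<Sum>r\<in>R. x r * (x a + x b))"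
    unfolding sum.distrib[symmetric] distrib_left[symmetric]
  proof (intro sum_mono mult_left_mono)
    fix r assume r: "r \<in> R"
    then have rV: "r \<in> V - {a, b}" using R by auto
    show "0 \<le> x r" using x(1) rV by auto
    have c0: "0 \<le> c" using x(1)[of r] x(4)[OF rV] rV by auto
    have "card (E `` {a} \<inter> E `` {b} \<inter> E `` {r}) \<le> 2" using ab rV by (intro card_common_neighbours_le_2) auto
    then have "card (E `` {r} \<inter> A) \<le> 2" by (simp add: A Int_commute)
    moreover have "(\<Sum>v\<in>E `` {r} \<inter> A. x v) \<le> real (card (E `` {r} \<inter> A)) * c"
      using AV by (intro sum_bounded_above x(4)) auto
    ultimately have sA: "(\<Sum>v\<in>E `` {r} \<inter> A. x v) \<le> 2 * c"
      using c0 by (meson mult_right_mono of_nat_le_numeral_iff order_trans)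
    have "r \<notin> A" using r R by auto
    then have "a \<notin> E `` {r} \<or> b \<notin> E `` {r}" using symE by (auto simp: A dest: symD)
    then have "E `` {r} \<inter> ?P \<subseteq> {a} \<or> E `` {r} \<inter> ?P \<subseteq> {b}" by auto
    then have sP: "(\<Sum>v\<in>E `` {r} \<inter> ?P. x v) \<le> x a + x b - m"
    proof
      assume "E `` {r} \<inter> ?P \<subseteq> {a}"
      then have "(\<Sum>v\<in>E `` {r} \<inter> ?P. x v) \<le> (\<Sum>v\<in>{a}. x v)" using x(1) ab by (intro sum_mono2) auto
      then show ?thesis using x(3) by simp
    next
      assume "E `` {r} \<inter> ?P \<subseteq> {b}"
      then have "(\<Sum>v\<in>E `` {r} \<inter> ?P. x v) \<le> (\<Sum>v\<in>{b}. x v)" using x(1) ab by (intro sum_mono2) auto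
      then show ?thesis using x(2) by simp
    qed
    have "Z r = (E `` {r} \<inter> ?P) \<union> (E `` {r} \<inter> A)" by (auto simp: Z_def C_def)
    then have "(\<Sum>v\<in>Z r. x v) = (\<Sum>v\<in>E `` {r} \<inter> ?P. x v) + (\<Sum>v\<in>E `` {r} \<inter> A. x v)"
      using fin AV by (simp only:) (rule sum.union_disjoint; auto)
    then show "(\<Sum>v\<in>Z r. x v) + (m - 2 * c) \<le> x a + x b" using sA sP by linarith
  qed
  then have "(\<Sum>r\<in>R. x r * (\<Sum>v\<in>Z r. x v)) + (m - 2 * c) * (\<Sum>r\<in>R. x r) \<le> (\<Sum>r\<in>R. x r * (x a + x b))"
    unfolding sum_distrib_right[symmetric] by (simp only: mult.commute)
  then show ?thesis using 1 2 3 by (simp add: algebra_simps)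
qed

text \<open>A vertex of \<open>R\<close> has no neighbours other than \<open>a\<close> and \<open>b\<close> in \<open>E1\<close>, so in a copy of \<open>F\<close> it can be
  traded for an unused common neighbour of \<open>a\<close> and \<open>b\<close>.\<close>

lemma contains_copy_replace:
  assumes F: "finite (pverts F)" "parcs F \<subseteq> pverts F \<times> pverts F" "card (pverts F) \<le> card A"
    and G: "finite (pverts G)" "sym (parcs G)" "A = parcs G `` {a} \<inter> parcs G `` {b}" "A \<subseteq> pverts G"
    and R: "R = pverts G - {a, b} - A"
    and E1: "E1 = (parcs G \<inter> ({a, b} \<union> A) \<times> ({a, b} \<union> A)) \<union> ({a, b} \<times> R) \<union> (R \<times> {a, b})"
    and copy: "contains_copy \<lparr>pverts = pverts G, parcs = E1\<rparr> F"
  shows "contains_copy G F"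
proof -
  obtain \<phi> where \<phi>: "inj_on \<phi> (pverts F)" "\<phi> ` pverts F \<subseteq> pverts G" and arcs: "\<forall>(u, v)\<in>parcs F. (\<phi> u, \<phi> v) \<in> E1"
    using copy by (auto simp: contains_copy_def)
  define I where "I = \<phi> ` pverts F"
  have fin: "finite I" "finite A" "finite R" using F G R by (auto simp: I_def intro: finite_subset)
  \<comment> \<open>\<open>A\<close> has at least as many vertices as \<open>F\<close>, hence enough
    of them outside the copy to replace those it uses in \<open>R\<close>.\<close>
  have "card (R \<inter> I) + card (A \<inter> I) = card ((R \<inter> I) \<union> (A \<inter> I))"
    using fin R by (intro card_Un_disjoint[symmetric]) auto
  also have "\<dots> \<le> card I" using fin by (intro card_mono) auto
  also have "card I \<le> card (pverts F)" unfolding I_def using F(1) by (rule card_image_le)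
  also have "\<dots> \<le> card A" by (rule F(3))
  also have "card A = card (A - I) + card (A \<inter> I)" using fin by (metis card_Int_Diff add.commute)
  finally have "card (R \<inter> I) \<le> card (A - I)" by simp
  then obtain g where g: "g ` (R \<inter> I) \<subseteq> A - I" "inj_on g (R \<inter> I)"
    using card_le_inj[of "R \<inter> I" "A - I"] fin by auto
  define \<sigma> where "\<sigma> v = (if v \<in> R then g v else v)" for v
  have gA: "g v \<in> A" "g v \<notin> I" if "v \<in> R" "v \<in> I" for v using g(1) that by auto
  have "inj_on \<sigma> I"
  proof (rule inj_onI)
    fix u v assume uv: "u \<in> I" "v \<in> I" "\<sigma> u = \<sigma> v"
    show "u = v"
    proof (cases "u \<in> R"; cases "v \<in> R")
      assume "u \<in> R" "v \<in> R"
      then show ?thesis using uv inj_onD[OF g(2), of u v] by (simp add: \<sigma>_def)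
    qed (use uv gA in \<open>auto simp: \<sigma>_def\<close>)
  qed
  then have "inj_on (\<sigma> \<circ> \<phi>) (pverts F)" using \<phi>(1) by (intro comp_inj_on) (simp_all add: I_def)
  moreover have "(\<sigma> \<circ> \<phi>) ` pverts F \<subseteq> pverts G"
  proof
    fix w assume "w \<in> (\<sigma> \<circ> \<phi>) ` pverts F"
    then obtain v where v: "v \<in> I" "w = \<sigma> v" by (auto simp: I_def)
    then show "w \<in> pverts G" using \<phi>(2) gA[of v] G(4) by (auto simp: \<sigma>_def I_def)
  qed
  moreover have "(\<sigma> (\<phi> u), \<sigma> (\<phi> v)) \<in> parcs G" if uv: "(u, v) \<in> parcs F" for u v
  proof -
    have I: "\<phi> u \<in> I" "\<phi> v \<in> I" using uv F(2) by (auto simp: I_def)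
    have nb: "(w, y) \<in> parcs G" "(y, w) \<in> parcs G" if "w \<in> {a, b}" "y \<in> A" for w y
      using that G(2,3) by (auto dest: symD)
    have notR: "w \<notin> R" if "w \<in> {a, b} \<union> A" for w using that R by auto
    consider "(\<phi> u, \<phi> v) \<in> parcs G" "\<phi> u \<in> {a, b} \<union> A" "\<phi> v \<in> {a, b} \<union> A"
      | "\<phi> u \<in> {a, b}" "\<phi> v \<in> R" | "\<phi> u \<in> R" "\<phi> v \<in> {a, b}"
      using bspec[OF arcs uv] E1 by blast
    then show ?thesis
    proof cases
      case 1
      then show ?thesis using notR by (simp add: \<sigma>_def)
    next
      case 2
      then have "\<phi> u \<notin> R" using notR by blast
      with 2 show ?thesis using nb(1) gA I by (simp add: \<sigma>_def)
    next
      case 3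
      then have "\<phi> v \<notin> R" using notR by blast
      with 3 show ?thesis using nb(2) gA I by (simp add: \<sigma>_def)
    qed
  qed
  ultimately show ?thesis unfolding contains_copy_def by (intro exI[of _ "\<sigma> \<circ> \<phi>"]) auto
qed

text \<open>Relabelling by list positions: both the maximum in \<open>spex_planar\<close> and the
  fan drawing refer to graphs on \<open>{..<n}\<close>.\<close>

definition listed_graph :: "'a list \<Rightarrow> ('a \<times> 'a) set \<Rightarrow> nat pair_pre_digraph" where
  "listed_graph ys E = \<lparr>pverts = {..<length ys},
     parcs = {(i, j). i < length ys \<and> j < length ys \<and> (ys ! i, ys ! j) \<in> E}\<rparr>"

lemma pair_graph_listed_graph: "sym E \<Longrightarrow> irrefl E \<Longrightarrow> pair_graph (listed_graph ys E)"
  by (auto simp: pair_graph_iff listed_graph_def sym_def irrefl_def)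

lemma contains_copy_listed_graph:
  assumes "distinct ys" "set ys = V"
  shows "contains_copy \<lparr>pverts = V, parcs = E\<rparr> (listed_graph ys E)"
  unfolding contains_copy_def using assms
  by (intro exI[of _ "(!) ys"]) (auto simp: listed_graph_def inj_on_def nth_eq_iff_index_eq)

lemma sum_nth_eq: "distinct ys \<Longrightarrow> (\<Sum>i<length ys. f (ys ! i)) = (\<Sum>v\<in>set ys. f v)"
  by (rule sum.reindex_bij_betw[OF bij_betw_nth]) auto

lemma listed_graph_rayleigh:
  assumes "distinct ys" "ys \<noteq> []" "sym E"
  shows "adj_form E (set ys) z \<le> graph_spectral_radius (listed_graph ys E) * (\<Sum>v\<in>set ys. (z v)\<^sup>2)"
proof -
  let ?H = "listed_graph ys E"
  have "adj_form (parcs ?H) (pverts ?H) (\<lambda>i. z (ys ! i)) =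
      (\<Sum>i<length ys. \<Sum>j<length ys. adj E (ys ! i) (ys ! j) * z (ys ! i) * z (ys ! j))"
    unfolding adj_form_def by (intro sum.cong) (auto simp: listed_graph_def adj_def)
  also have "\<dots> = (\<Sum>i<length ys. \<Sum>v\<in>set ys. adj E (ys ! i) v * z (ys ! i) * z v)"
    using assms(1) by (intro sum.cong refl sum_nth_eq)
  also have "\<dots> = adj_form E (set ys) z"
    unfolding adj_form_def using assms(1) by (rule sum_nth_eq)
  finally have 1: "adj_form (parcs ?H) (pverts ?H) (\<lambda>i. z (ys ! i)) = adj_form E (set ys) z" .
  have 2: "(\<Sum>i\<in>pverts ?H. (z (ys ! i))\<^sup>2) = (\<Sum>v\<in>set ys. (z v)\<^sup>2)"
    using sum_nth_eq[OF assms(1), of "\<lambda>v. (z v)\<^sup>2"] by (simp add: listed_graph_def)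
  have "finite (pverts ?H)" "pverts ?H \<noteq> {}" "sym (parcs ?H)"
    using assms(2,3) by (auto simp: listed_graph_def sym_def lessThan_empty_iff)
  from graph_spectral_radius_rayleigh(1)[OF this, of "\<lambda>i. z (ys ! i)"] show ?thesis by (simp only: 1 2)
qed

text \<open>\<open>a\<close> and \<open>b\<close> come first and become the poles. The vertices of
  \<open>R\<close> come last: in \<open>E1\<close> they have no arcs except to the poles, so along
  the path only the linear order of \<open>A\<close> matters.\<close>

lemma listed_graph_subset_fan:
  assumes A: "set xs = A" "linear_order_of E xs" and ab: "a \<notin> A" "b \<notin> A"
    and irr: "irrefl E1" and R: "set rs = R" "R \<inter> (insert a (insert b A)) = {}"
    and E1: "E1 = (E \<inter> ({a, b} \<union> A) \<times> ({a, b} \<union> A)) \<union> ({a, b} \<times> R) \<union> (R \<times> {a, b})"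
  shows "parcs (listed_graph (a # b # xs @ rs) E1) \<subseteq> fan_arcs (length (a # b # xs @ rs))"
proof
  let ?ys = "a # b # xs @ rs"
  fix p assume "p \<in> parcs (listed_graph ?ys E1)"
  then obtain i j where p: "p = (i, j)" "i < length ?ys" "j < length ?ys" "(?ys ! i, ?ys ! j) \<in> E1"
    by (auto simp: listed_graph_def)
  have "i \<noteq> j" using p(4) irr by (auto simp: irrefl_def)
  moreover have "i = Suc j \<or> j = Suc i" if "2 \<le> i" "2 \<le> j"
  proof -
    have inAR: "(k < length xs \<and> (xs @ rs) ! k \<in> A \<and> (xs @ rs) ! k = xs ! k) \<or>
        (xs @ rs) ! k \<in> R" if "k < length (xs @ rs)" for k
      using that A(1) R(1) by (auto simp: nth_append)
    obtain k l where kl: "i = Suc (Suc k)" "j = Suc (Suc l)"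
      using \<open>2 \<le> i\<close> \<open>2 \<le> j\<close> by (metis Suc_le_D Suc_le_mono numeral_2_eq_2)
    then have kl': "k < length (xs @ rs)" "l < length (xs @ rs)" "((xs @ rs) ! k, (xs @ rs) ! l) \<in> E1" using p by auto
    have "(xs @ rs) ! k \<in> A \<and> (xs @ rs) ! l \<in> A \<and> ((xs @ rs) ! k, (xs @ rs) ! l) \<in> E"
      using inAR[OF kl'(1)] inAR[OF kl'(2)] kl'(3) E1 R(2) ab by auto
    then have "k < length xs" "l < length xs" "(xs ! k, xs ! l) \<in> E"
      using inAR[OF kl'(1)] inAR[OF kl'(2)] R(2) by auto
    then show ?thesis using A(2) kl unfolding linear_order_of_def by blast
  qed
  ultimately show "p \<in> fan_arcs (length ?ys)" using p by (auto simp: fan_arcs_def not_less)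
qed

lemma contains_copy_complete_bipartite:
  assumes "a \<noteq> b" "a \<in> pverts G" "b \<in> pverts G" "sym (parcs G)" "distinct xs" "set xs \<subseteq> pverts G"
    "set xs \<subseteq> parcs G `` {a} \<inter> parcs G `` {b}" "a \<notin> set xs" "b \<notin> set xs"
  shows "contains_copy G (complete_bipartite_graph 2 (length xs))"
proof -
  have nb: "(a, xs ! i) \<in> parcs G" "(b, xs ! i) \<in> parcs G" "(xs ! i, a) \<in> parcs G" "(xs ! i, b) \<in> parcs G"
    if "i < length xs" for i
    using assms(4,7) nth_mem[OF that] by (auto dest: symD)
  show ?thesis
    unfolding contains_copy_def
    using assms nb
    by (intro exI[of _ "case_sum (\<lambda>i. if i = 0 then a else b) ((!) xs)"])
      (auto simp: complete_bipartite_graph_def inj_on_def nth_eq_iff_index_eq less_2_cases_iff)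
qed

theorem theorem1p1:
  fixes F :: "'a pair_pre_digraph" and G :: "'b pair_pre_digraph" and n :: nat
  assumes "pair_graph F" and "planar F"
    and "real n \<ge> max (2.16 * 10 ^ 17) (2 * real (card (pverts F)))"
    and "contains_copy (graph_join (isolated_graph 2) (path_graph (n div 2))) F"
    and "\<not> contains_copy (complete_bipartite_graph 2 (n - 2)) F"
    and "extremal_spex_planar n F G"
  shows "contains_copy G (complete_bipartite_graph 2 (n - 2))"
proof -
  have n: "2.16 * 10 ^ 17 \<le> real n" "2 * real (card (pverts F)) \<le> real n" using assms(3) by auto
  have F: "finite (pverts F)" "parcs F \<subseteq> pverts F \<times> pverts F" using assms(1) by (simp_all add: pair_graph_iff)
  have G: "pair_graph G" "card (pverts G) = n" "planar G" "\<not> contains_copy G F"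
    and extremal: "graph_spectral_radius G = spex_planar n F"
    using assms(6) by (simp_all add: extremal_spex_planar_def)
  define \<rho> where "\<rho> = graph_spectral_radius G"
  have max: "graph_spectral_radius H \<le> \<rho>" if "pair_graph H" "pverts H = {..<n}" "planar H" "\<not> contains_copy H F" for H
    using graph_spectral_radius_le_spex_planar[OF that] extremal by (simp add: \<rho>_def)
  obtain p \<gamma> where "plane_drawing G p \<gamma>" using G(3) by (auto simp: planar_def)
  with G(1) interpret plane_graph G p \<gamma> by (rule plane_graph.intro)
  have n2: "2 \<le> n" using n(1) by simp
  \<comment> \<open>Since \<open>F\<close> is not a subgraph of K_{2,n-2}, this graph competes in
    the maximum and bounds \<open>\<rho>\<close> from below.\<close>
  have "\<not> contains_copy (two_pole_graph n) F"
    using assms(5) contains_copy_trans two_pole_graph(3)[OF n2] by blast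
  then have K: "graph_spectral_radius (two_pole_graph n) \<le> \<rho>"
    using two_pole_graph(1,2)[OF n2] by (intro max) (auto simp: two_pole_graph_def)
  have "(graph_spectral_radius (two_pole_graph n))\<^sup>2 \<le> \<rho>\<^sup>2"
    using K two_pole_graph(5)[OF n2] by (rule power_mono)
  then have \<rho>2: "2 * real n - 4 \<le> \<rho>\<^sup>2" using two_pole_graph(4)[OF n2] by linarith
  moreover have "0 \<le> \<rho>" using K two_pole_graph(5)[OF n2] by linarith
  ultimately have \<rho>0: "0 < \<rho>" using n(1) by (cases "\<rho> = 0") auto
  have Vne: "V \<noteq> {}" using G(2) n2 by auto
  note ray = graph_spectral_radius_rayleigh[OF finV Vne symE, folded \<rho>_def]
  obtain y where y: "\<And>v. 0 \<le> y v" "\<exists>v\<in>V. y v > 0" "\<And>v. v \<in> V \<Longrightarrow> (\<Sum>u\<in>V. adj E v u * y u) = \<rho> * y v"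
    using ray(2) by blast
  obtain a where a: "a \<in> V" and "Max (y ` V) = y a" using obtains_MAX[OF finV Vne] by blast
  then have amax: "y v \<le> y a" if "v \<in> V" for v using that finV Max_ge[of "y ` V" "y v"] by simp
  have ya: "0 < y a" using y(2) amax by force
  define x where "x v = y v / y a" for v
  have x01: "0 \<le> x v \<and> x v \<le> 1" if "v \<in> V" for v using y(1) amax[OF that] ya by (simp add: x_def)
  have xa: "x a = 1" using ya by (simp add: x_def)
  have adj_eigen: "(\<Sum>u\<in>V. adj E v u * x u) = \<rho> * x v" if "v \<in> V" for v
    using y(3)[OF that] by (simp add: x_def sum_divide_distrib[symmetric])
  have eigen: "(\<Sum>u\<in>E `` {v}. x u) = \<rho> * x v" if "v \<in> V" for v
  proof -
    have "(\<Sum>u\<in>E `` {v}. x u) = (\<Sum>u\<in>E `` {v}. adj E v u * x u)"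
      by (intro sum.cong) (auto simp: adj_def)
    also have "\<dots> = (\<Sum>u\<in>V. adj E v u * x u)"
      using EV finV by (intro sum.mono_neutral_left) (auto simp: adj_def)
    finally show ?thesis using adj_eigen[OF that] by simp
  qed
  interpret plane_spectral G p \<gamma> n \<rho> x a
    by unfold_locales (use G(2) n(1) \<rho>0 \<rho>2 x01 eigen a xa in auto)
  obtain b where b: "b \<in> V" "b \<noteq> a" "889 / 1000 \<le> x b" "97 / 100 * real n \<le> real (card (E `` {a} \<inter> E `` {b}))"
    and small: "\<And>v. v \<in> V - {a, b} \<Longrightarrow> x v \<le> 34 / 1000"
    using two_large_vertices by blast
  define A where "A = E `` {a} \<inter> E `` {b}"
  define R where "R = V - {a, b} - A"
  have AV: "A \<subseteq> V" "a \<notin> A" "b \<notin> A" "finite A"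
    using EV irreflE finV by (auto simp: A_def irrefl_def intro: finite_subset)
  \<comment> \<open>\<open>A\<close> is long enough for a spanning path of it to contain the path on
    \<open>n div 2\<close> vertices, and, as \<open>F\<close> has at most n / 2 vertices, large
    enough for the replacement argument.\<close>
  have "n div 2 \<le> card A" "card (pverts F) \<le> card A"
    using b(4) n by (simp_all add: A_def)
  have short: "length ps < card A" if "distinct ps" "set ps \<subseteq> A" "successively (\<lambda>x y. (x, y) \<in> E) ps" for ps
  proof (rule ccontr)
    assume "\<not> ?thesis"
    then have "n div 2 \<le> length ps" using \<open>n div 2 \<le> card A\<close> by simp
    then have "contains_copy G (graph_join (isolated_graph 2) (path_graph (n div 2)))"
      using that a b AV symE irreflE by (intro contains_copy_join_path[of a b G A ps]) (auto simp: A_def)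
    then show False using contains_copy_trans[OF assms(4)] G(4) by blast
  qed
  then obtain xs where xs: "distinct xs" "set xs = A" "linear_order_of E xs"
    using common_neighbours_linear[of a b A] b(2) by (auto simp: A_def)
  obtain rs where rs: "distinct rs" "set rs = R" using finite_distinct_list finV by (metis R_def finite_Diff)
  define E1 where "E1 = (E \<inter> ({a, b} \<union> A) \<times> ({a, b} \<union> A)) \<union> ({a, b} \<times> R) \<union> (R \<times> {a, b})"
  have E1: "E1 \<subseteq> V \<times> V" "sym E1" "irrefl E1"
    using a b(1) EV symE irreflE by (auto simp: E1_def R_def sym_def irrefl_def)
  define ys where "ys = a # b # xs @ rs"
  have ys: "distinct ys" "set ys = V" "length ys = n" "ys \<noteq> []"
  proof -
    show "distinct ys" "set ys = V" using xs rs a b AV by (auto simp: ys_def R_def)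
    then show "length ys = n" using G(2) distinct_card by fastforce
  qed (simp add: ys_def)
  define H where "H = listed_graph ys E1"
  have "parcs H \<subseteq> fan_arcs n"
    using listed_graph_subset_fan[OF xs(2,3) AV(2,3) E1(3) rs(2) _ E1_def] ys(3) by (auto simp: H_def ys_def R_def)
  moreover have pvH: "pverts H = {..<n}" using ys(3) by (simp add: H_def listed_graph_def)
  ultimately have "planar H" by (intro planar_fan)
  moreover have "\<not> contains_copy H F"
  proof
    assume "contains_copy H F"
    then have "contains_copy \<lparr>pverts = V, parcs = E1\<rparr> F"
      using contains_copy_listed_graph[OF ys(1,2)] contains_copy_trans unfolding H_def by blast
    then have "contains_copy G F"
      by (rule contains_copy_replace[OF F \<open>card (pverts F) \<le> card A\<close> finV symE A_def AV(1) R_def E1_def])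
    then show False using G(4) by simp
  qed
  ultimately have "graph_spectral_radius H \<le> \<rho>"
    using pvH E1 by (intro max) (auto simp: H_def intro: pair_graph_listed_graph)
  have E1_ray: "adj_form E1 V z \<le> \<rho> * (\<Sum>v\<in>V. (z v)\<^sup>2)" for z
  proof -
    have "adj_form E1 V z \<le> graph_spectral_radius H * (\<Sum>v\<in>V. (z v)\<^sup>2)"
      using listed_graph_rayleigh[OF ys(1,4) E1(2), of z] by (simp add: H_def ys(2))
    also have "\<dots> \<le> \<rho> * (\<Sum>v\<in>V. (z v)\<^sup>2)"
      using \<open>graph_spectral_radius H \<le> \<rho>\<close> by (intro mult_right_mono sum_nonneg) auto
    finally show ?thesis .
  qed
  have "adj_form E V x = (\<Sum>v\<in>V. x v * (\<Sum>u\<in>V. adj E v u * x u))"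
    unfolding adj_form_def sum_distrib_left by (intro sum.cong refl) (simp add: mult_ac)
  also have "\<dots> = (\<Sum>v\<in>V. \<rho> * (x v)\<^sup>2)"
    using adj_eigen by (intro sum.cong refl) (simp add: power2_eq_square)
  also have "\<dots> = \<rho> * (\<Sum>v\<in>V. (x v)\<^sup>2)" by (simp only: sum_distrib_left)
  finally have Ex: "adj_form E V x = \<rho> * (\<Sum>v\<in>V. (x v)\<^sup>2)" .
  have xR: "0 \<le> x r" if "r \<in> R" for r using x01[of r] that by (simp add: R_def)
  \<comment> \<open>The constants were tuned to make this factor positive: 17 times 0.034 is 0.578,
    below 0.889.\<close>
  have "arc_sum x E + 2 * (889 / 1000 - 17 * (34 / 1000)) * (\<Sum>r\<in>R. x r) \<le> arc_sum x E1"
    by (rule arc_sum_gain[of a b A R]) (use a b x01 xa small in \<open>auto simp: A_def R_def E1_def\<close>)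
  then have "(\<Sum>r\<in>R. x r) \<le> 0" and E1x: "adj_form E V x \<le> adj_form E1 V x"
    using Ex E1_ray[of x] sum_nonneg[of R x] xR
    by (simp_all add: adj_form_eq_arc_sum[OF finV EV] adj_form_eq_arc_sum[OF finV E1(1)])
  have finR: "finite R" using finV by (simp add: R_def)
  have x0: "x r = 0" if "r \<in> R" for r
    using \<open>(\<Sum>r\<in>R. x r) \<le> 0\<close> sum_nonneg_eq_0_iff[OF finR, of x] xR sum_nonneg[of R x] that by force
  \<comment> \<open>\<open>x\<close> vanishes on \<open>R\<close>, which is no contradiction by
    itself. But now \<open>E1\<close> attains the bound \<open>\<rho>\<close> at \<open>x\<close>,
    so the eigenvalue equation of \<open>E1\<close> holds at \<open>r\<close>: its right-hand side
    is 0, while the neighbour \<open>a\<close> contributes 1 to the left.\<close>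
  have "R = {}"
  proof (rule ccontr)
    assume "R \<noteq> {}"
    then obtain r where r: "r \<in> R" by blast
    then have rV: "r \<in> V" by (simp add: R_def)
    have "adj_form E1 V x = \<rho> * (\<Sum>v\<in>V. (x v)\<^sup>2)" using E1_ray[of x] E1x Ex by linarith
    then have "(\<Sum>u\<in>V. adj E1 r u * x u) = \<rho> * x r"
      by (rule rayleigh_equality_imp_eigenvector[OF finV E1(2) E1_ray _ rV])
    also have "\<dots> = 0" using x0[OF r] by simp
    finally have "(\<Sum>u\<in>V. adj E1 r u * x u) = 0" .
    moreover have "adj E1 r a * x a \<le> (\<Sum>u\<in>V. adj E1 r u * x u)"
      using a finV x01 by (intro member_le_sum) (auto simp: adj_def)
    moreover have "adj E1 r a = 1" using r by (simp add: adj_def E1_def)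
    ultimately show False using xa by simp
  qed
  then have "length xs = n - 2" using rs ys(3) by (simp add: ys_def)
  moreover have "contains_copy G (complete_bipartite_graph 2 (length xs))"
    using a b AV symE xs by (intro contains_copy_complete_bipartite[of a b]) (auto simp: A_def)
  ultimately show ?thesis by simp
qed

end
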